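(* Let $G$ be a finite group. Then $\mathcal{CD}(G)=[G/Z(G)]$ if and only if $G$ decomposes as an (internal) direct product $G=G_1\times\cdots\times G_r\times A$ for some integer $r\ge 0$, where $\gcd(|G_i|,|G_j|)=1$ for all $i\neq j$ and $\gcd(|G_i|,|A|)=1$ for all $i$, $A$ is an abelian group, and for every $i$ the group $G_i$ is a $p_i$-group for some prime $p_i$ (depending on $i$) such that the lattice $[G_i/Z(G_i)]$ is modular and the derived subgroup $G_i'$ is cyclic.
   Context: For a finite group $G$, $L(G)$ denotes the lattice of all subgroups of $G$ (ordered by inclusion), $Z(G)$ its center, $G'$ its derived (commutator) subgroup. The Chermak-Delgado measure of a subgroup $H\le G$ is $m_G(H)=|H|\,|C_G(H)|$, where $C_G(H)$ is the centralizer of $H$ in $G$. Put $m(G)=\max\{m_G(H)\mid H\le G\}$ and $\mathcal{CD}(G)=\{H\le G\mid m_G(H)=m(G)\}$; this set is a sublattice of $L(G)$, called the Chermak-Delgado lattice of $G$. The interval $[G/Z(G)]$ is $\{H\in L(G)\mid Z(G)\le H\le G\}$, regarded as a sublattice of $L(G)$; saying it is modular means it is a modular lattice. *)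

theory Defs
  imports "HOL-Algebra.Algebra"
begin

definition group_center :: "('a, 'b) monoid_scheme \<Rightarrow> 'a set" where
  "group_center G = {z \<in> carrier G. \<forall>x \<in> carrier G. z \<otimes>\<^bsub>G\<^esub> x = x \<otimes>\<^bsub>G\<^esub> z}"

definition centralizer :: "('a, 'b) monoid_scheme \<Rightarrow> 'a set \<Rightarrow> 'a set" where
  "centralizer G H = {x \<in> carrier G. \<forall>h \<in> H. x \<otimes>\<^bsub>G\<^esub> h = h \<otimes>\<^bsub>G\<^esub> x}"

definition CD_measure :: "('a, 'b) monoid_scheme \<Rightarrow> 'a set \<Rightarrow> nat" where
  "CD_measure G H = card H * card (centralizer G H)"

definition CD_max :: "('a, 'b) monoid_scheme \<Rightarrow> nat" where
  "CD_max G = Max (CD_measure G ` {H. subgroup H G})"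

definition CD_lattice :: "('a, 'b) monoid_scheme \<Rightarrow> 'a set set" where
  "CD_lattice G = {H. subgroup H G \<and> CD_measure G H = CD_max G}"

definition center_interval :: "('a, 'b) monoid_scheme \<Rightarrow> 'a set set" where
  "center_interval G = {H. subgroup H G \<and> group_center G \<subseteq> H}"

abbreviation inclusion_order :: "'a set set \<Rightarrow> 'a set gorder" where
  "inclusion_order \<S> \<equiv> \<lparr>carrier = \<S>, eq = (=), le = (\<subseteq>)\<rparr>"

locale modular_lattice = Lattice.lattice +
  assumes modular_law:
    "\<lbrakk>x \<in> carrier L; y \<in> carrier L; z \<in> carrier L; x \<sqsubseteq> z\<rbrakk>
      \<Longrightarrow> x \<squnion> (y \<sqinter> z) = (x \<squnion> y) \<sqinter> z"

definition p_group :: "nat \<Rightarrow> ('a, 'b) monoid_scheme \<Rightarrow> bool" where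
  "p_group p G \<longleftrightarrow> Factorial_Ring.prime p \<and> group G \<and> (\<exists>n. order G = p ^ n)"

text \<open>The factors form a list, since trivial factors may occur repeatedly.\<close>

definition internal_direct_product :: "('a, 'b) monoid_scheme \<Rightarrow> 'a set list \<Rightarrow> bool" where
  "internal_direct_product G Hs \<longleftrightarrow>
     (\<forall>i < length Hs. Hs ! i \<lhd> G) \<and>
     generate G (\<Union>i \<in> {..<length Hs}. Hs ! i) = carrier G \<and>
     (\<forall>i < length Hs. Hs ! i \<inter> generate G (\<Union>j \<in> {..<length Hs} - {i}. Hs ! j) = {\<one>\<^bsub>G\<^esub>})"

text \<open>The order-theoretic operations on the interval above the center are those of the
  subgroup lattice, i.e. the interval really carries the sublattice structure.\<close>

context group
begin

lemma center_interval_least: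
  assumes "H \<in> center_interval G" "K \<in> center_interval G"
  shows "least (inclusion_order (center_interval G)) (generate G (H \<union> K))
           (Upper (inclusion_order (center_interval G)) {H, K})"
proof -
  have HK: "subgroup H G" "subgroup K G" "group_center G \<subseteq> H"
    using assms by (auto simp: center_interval_def)
  then have sub: "H \<union> K \<subseteq> carrier G" by (meson le_sup_iff subgroup.subset)
  have inc: "H \<union> K \<subseteq> generate G (H \<union> K)" by (auto intro: generate.incl)
  have "generate G (H \<union> K) \<in> center_interval G"
    using generate_is_subgroup[OF sub] inc HK(3) by (auto simp: center_interval_def)
  moreover have "generate G (H \<union> K) \<subseteq> M" if "subgroup M G" "H \<subseteq> M" "K \<subseteq> M" for M
    using generate_subgroup_incl[OF _ that(1)] that by auto
  ultimately show ?thesis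
    using inc assms by (auto simp: least_def Upper_def center_interval_def)
qed

lemma center_interval_greatest:
  assumes "H \<in> center_interval G" "K \<in> center_interval G"
  shows "greatest (inclusion_order (center_interval G)) (H \<inter> K)
           (Lower (inclusion_order (center_interval G)) {H, K})"
  using assms subgroups_Inter_pair by (auto simp: greatest_def Lower_def center_interval_def)

lemma center_interval_lattice: "Lattice.lattice (inclusion_order (center_interval G))"
proof (unfold_locales, simp_all)
  fix H K assume "H \<in> center_interval G" "K \<in> center_interval G"
  from center_interval_least[OF this] center_interval_greatest[OF this]
  show "\<exists>s. least (inclusion_order (center_interval G)) s
              (Upper (inclusion_order (center_interval G)) {H, K})"
    and "\<exists>s. greatest (inclusion_order (center_interval G)) s
              (Lower (inclusion_order (center_interval G)) {H, K})"
    by blast+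
qed

lemma center_interval_join:
  assumes "H \<in> center_interval G" "K \<in> center_interval G"
  shows "H \<squnion>\<^bsub>inclusion_order (center_interval G)\<^esub> K = generate G (H \<union> K)"
proof -
  let ?L = "inclusion_order (center_interval G)"
  interpret L: Lattice.lattice ?L by (rule center_interval_lattice)
  have "least ?L (H \<squnion>\<^bsub>?L\<^esub> K) (Upper ?L {H, K})"
    unfolding join_def using L.sup_of_two_least assms by simp
  with center_interval_least[OF assms] show ?thesis
    using L.least_unique by blast
qed

lemma center_interval_meet:
  assumes "H \<in> center_interval G" "K \<in> center_interval G"
  shows "H \<sqinter>\<^bsub>inclusion_order (center_interval G)\<^esub> K = H \<inter> K"
proof -
  let ?L = "inclusion_order (center_interval G)"
  interpret L: Lattice.lattice ?L by (rule center_interval_lattice)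
  have "greatest ?L (H \<sqinter>\<^bsub>?L\<^esub> K) (Lower ?L {H, K})"
    unfolding meet_def using L.inf_of_two_greatest assms by simp
  with center_interval_greatest[OF assms] show ?thesis
    using L.greatest_unique by blast
qed

end

end

theory Submission
  imports Defs "HOL-Number_Theory.Residues"
begin

text \<open>
  Call \<open>G\<close> balanced if all subgroups above the center \<open>Z\<close> have measure \<open>|G| |Z|\<close>; this is equivalent to
  the equality of the two lattices. In a balanced group the subgroups above \<open>Z\<close> permute, which
  gives the modular law and the normality of all Sylow subgroups, and balance passes to direct
  factors and to products of coprime factors. It remains to treat a group of order \<open>p\<^sup>n\<close>.

  If it is balanced, then \<open>C(b\<^sup>p)/C(b)\<close> has order at most \<open>p\<close>. Hence the commutators \<open>[g, b]\<close> with \<open>g\<close>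
  commuting with \<open>b\<^sup>p\<close> all lie in one central subgroup \<open>P\<close> of order \<open>p\<close>, so that centralizers modulo \<open>P\<close>
  are centralizers of sets of \<open>p\<close>-th powers and \<open>G/P\<close> is balanced again. By induction the commutators of
  \<open>G/P\<close> lie in a cyclic group generated by a commutator, and this lifts to \<open>G\<close>.

  Conversely, it suffices that \<open>|H| |C(H)|\<close> does not decrease when \<open>K\<close> is enlarged to \<open>\<langle>K, h\<rangle>\<close> with
  \<open>h\<^sup>p \<in> K\<close>. For \<open>d \<in> C(K)\<close> the commutator \<open>[h, d]\<close> lies in the cyclic group \<open>G'\<close> and has order
  dividing \<open>p\<close>, which leaves at most \<open>p\<close> values. The modular law is only needed for \<open>p = 2\<close>, where it
  excludes that \<open>h\<close> inverts an element of order \<open>4\<close>.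
\<close>

text \<open>The centralizer of \<open>Z\<close> is \<open>G\<close> and that of \<open>G\<close> is
  \<open>Z\<close>, so both ends of the interval have measure |G| |Z|. A measure that never drops
  along chains from \<open>Z\<close> to \<open>G\<close> is therefore constant, which is why
  one-sided estimates are enough, both in the converse and for \<open>G/P\<close>. The obstacle in
  the forward direction is to find one \<open>P\<close> for all pairs. Pairs as described there that
  do not commute are treated as edges of a graph (\<open>linked\<close>). The relation is symmetric,
  the commutators at a vertex all generate the same group of order \<open>p\<close>, and any two
  noncentral elements are joined by a path. In the lift, the cyclic group \<open>T\<close> of a
  commutator \<open>[g, y]\<close> might miss \<open>P\<close>. Replacing \<open>g\<close> by
  \<open>g y^j\<close> keeps the commutator, and \<open>j\<close> can be chosen so that
  \<open>g y^j\<close> normalizes \<open>T\<close>; the commutator of a suitable power of it with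
  \<open>y\<close> is then a nontrivial element of both \<open>T\<close> and
  \<open>P\<close>.\<close>

text \<open>This order of the factors is that of the generators of \<open>derived\<close>, and
  conjugation reads \<open>x y x^-1 = [x, y] y\<close>.\<close>

definition commutator :: "('a, 'b) monoid_scheme \<Rightarrow> 'a \<Rightarrow> 'a \<Rightarrow> 'a" where
  "commutator G x y = x \<otimes>\<^bsub>G\<^esub> y \<otimes>\<^bsub>G\<^esub> inv\<^bsub>G\<^esub> x \<otimes>\<^bsub>G\<^esub> inv\<^bsub>G\<^esub> y"

definition balanced :: "('a, 'b) monoid_scheme \<Rightarrow> bool" where
  "balanced G \<longleftrightarrow>
     (\<forall>H \<in> center_interval G. CD_measure G H = order G * card (group_center G))"

section \<open>Centralizers and commutators\<close>

lemma group_center_eq: "group_center G = centralizer G (carrier G)"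
  by (simp add: group_center_def centralizer_def)

lemma centralizer_antimono: "H \<subseteq> K \<Longrightarrow> centralizer G K \<subseteq> centralizer G H"
  by (auto simp: centralizer_def)

lemma centralizer_subset: "centralizer G H \<subseteq> carrier G"
  by (auto simp: centralizer_def)

lemma centralizer_Un: "centralizer G (H \<union> K) = centralizer G H \<inter> centralizer G K"
  by (auto simp: centralizer_def)

lemma group_center_subset_centralizer:
  "H \<subseteq> carrier G \<Longrightarrow> group_center G \<subseteq> centralizer G H"
  by (auto simp: centralizer_def group_center_def)

lemma subset_centralizer_centralizer:
  "H \<subseteq> carrier G \<Longrightarrow> H \<subseteq> centralizer G (centralizer G H)"
  by (auto simp: centralizer_def)

lemma set_multI: "h \<in> H \<Longrightarrow> k \<in> K \<Longrightarrow> h \<otimes>\<^bsub>G\<^esub> k \<in> H <#>\<^bsub>G\<^esub> K"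
  by (auto simp: set_mult_def)

lemma set_multE:
  assumes "x \<in> H <#>\<^bsub>G\<^esub> K" obtains h k where "h \<in> H" "k \<in> K" "x = h \<otimes>\<^bsub>G\<^esub> k"
  using assms by (auto simp: set_mult_def)

context group
begin

lemma cancel_inv_left [simp]:
  "x \<in> carrier G \<Longrightarrow> y \<in> carrier G \<Longrightarrow> inv x \<otimes> (x \<otimes> y) = y"
  by (simp flip: m_assoc)

lemma cancel_left_inv [simp]:
  "x \<in> carrier G \<Longrightarrow> y \<in> carrier G \<Longrightarrow> x \<otimes> (inv x \<otimes> y) = y"
  by (simp flip: m_assoc)

lemma subgroup_centralizer:
  assumes "H \<subseteq> carrier G" shows "subgroup (centralizer G H) G"
proof (rule subgroupI)
  fix a b assume a: "a \<in> centralizer G H" and b: "b \<in> centralizer G H"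
  have "inv a \<otimes> h = h \<otimes> inv a" if "h \<in> H" for h
  proof -
    have "a \<in> carrier G" "h \<in> carrier G" "a \<otimes> h = h \<otimes> a"
      using a that assms by (auto simp: centralizer_def)
    then show ?thesis
      by (metis inv_closed inv_solve_left inv_solve_right m_assoc m_closed)
  qed
  then show "inv a \<in> centralizer G H" using a by (auto simp: centralizer_def)
  have "a \<otimes> b \<otimes> h = h \<otimes> (a \<otimes> b)" if "h \<in> H" for h
  proof -
    have "a \<in> carrier G" "b \<in> carrier G" "h \<in> carrier G" "a \<otimes> h = h \<otimes> a" "b \<otimes> h = h \<otimes> b"
      using a b that assms by (auto simp: centralizer_def)
    then show ?thesis by (metis m_assoc)
  qed
  then show "a \<otimes> b \<in> centralizer G H" using a b by (auto simp: centralizer_def)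
next
  show "centralizer G H \<noteq> {}" using assms by (auto simp: centralizer_def intro!: exI[of _ \<one>])
qed (auto simp: centralizer_def)

lemma subgroup_group_center: "subgroup (group_center G) G"
  by (simp add: group_center_eq subgroup_centralizer)

text \<open>The double centralizer of \<open>H\<close> is a subgroup containing \<open>H\<close>,
  hence contains everything that \<open>H\<close> generates.\<close>

lemma centralizer_generate:
  assumes "H \<subseteq> carrier G" shows "centralizer G (generate G H) = centralizer G H"
proof
  show "centralizer G (generate G H) \<subseteq> centralizer G H"
    by (rule centralizer_antimono) (auto intro: generate.incl)
  have "generate G H \<subseteq> centralizer G (centralizer G H)"
    using assms by (intro generate_subgroup_incl subgroup_centralizer subset_centralizer_centralizer)
      (auto simp: centralizer_def)
  then show "centralizer G H \<subseteq> centralizer G (generate G H)"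
    by (fastforce simp: centralizer_def)
qed

lemma card_subgroup_dvd:
  assumes "subgroup H G" "subgroup K G" "H \<subseteq> K" shows "card H dvd card K"
proof -
  interpret K: group "G\<lparr>carrier := K\<rparr>" by (rule subgroup_imp_group[OF assms(2)])
  have "subgroup H (G\<lparr>carrier := K\<rparr>)" using subgroup_incl assms by blast
  from K.lagrange[OF this] show ?thesis by (simp add: order_def) (metis dvd_triv_right)
qed

lemma commutator_closed [simp]:
  "x \<in> carrier G \<Longrightarrow> y \<in> carrier G \<Longrightarrow> commutator G x y \<in> carrier G"
  by (simp add: commutator_def)

lemma commutator_eq_one_iff:
  assumes "x \<in> carrier G" "y \<in> carrier G"
  shows "commutator G x y = \<one> \<longleftrightarrow> x \<otimes> y = y \<otimes> x"
  using assms by (simp add: commutator_def inv_solve_right')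

lemma commutator_mult:
  assumes "x \<in> carrier G" "y \<in> carrier G"
  shows "x \<otimes> y = commutator G x y \<otimes> y \<otimes> x"
  using assms by (simp add: commutator_def m_assoc)

lemma conj_eq_commutator:
  assumes "x \<in> carrier G" "y \<in> carrier G"
  shows "x \<otimes> y \<otimes> inv x = commutator G x y \<otimes> y"
  using assms by (simp add: commutator_def m_assoc)

lemma inv_commutator:
  assumes "x \<in> carrier G" "y \<in> carrier G"
  shows "inv (commutator G x y) = commutator G y x"
  using assms by (simp add: commutator_def m_assoc inv_mult_group)

end

section \<open>Counting in finite groups and the reduction to balance\<close>

locale finite_group = group G for G (structure) +
  assumes finite_carrier: "finite (carrier G)"
begin

lemma finite_subset_carrier: "H \<subseteq> carrier G \<Longrightarrow> finite H"
  using finite_carrier finite_subset by blast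

lemma finite_subgroup: "subgroup H G \<Longrightarrow> finite H"
  using finite_subset_carrier subgroup.subset by blast

lemma card_subgroup_pos: "subgroup H G \<Longrightarrow> 0 < card H"
  using finite_subgroup subgroup.one_closed by (fastforce simp: card_gt_0_iff)

lemma order_pos: "0 < order G"
  using finite_carrier by (simp add: order_gt_0_iff_finite)

lemma inv_eq_pow: "a \<in> carrier G \<Longrightarrow> inv a = a [^] (order G - 1)"
  using nat_pow_Suc[of a "order G - 1"] pow_order_eq_1[of a] order_pos
  by (intro inv_equality) auto

lemma finite_subgroupI:
  assumes "H \<subseteq> carrier G" "\<one> \<in> H" and mult: "\<And>a b. a \<in> H \<Longrightarrow> b \<in> H \<Longrightarrow> a \<otimes> b \<in> H"
  shows "subgroup H G"
proof (rule subgroupI)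
  fix a assume a: "a \<in> H"
  have "a [^] n \<in> H" for n :: nat by (induct n) (use a assms in auto)
  then show "inv a \<in> H" using a assms(1) inv_eq_pow by auto
qed (use assms in auto)

text \<open>Counts the fibres of the multiplication map; \<open>H <#> K\<close> is only a set here,
  so Lagrange's theorem cannot be applied to it.\<close>

lemma card_set_mult:
  assumes H: "subgroup H G" and K: "subgroup K G"
  shows "card (H <#> K) * card (H \<inter> K) = card H * card K"
proof -
  let ?f = "\<lambda>(h, k). h \<otimes> k"
  have Hc: "H \<subseteq> carrier G" and Kc: "K \<subseteq> carrier G" using H K subgroup.subset by auto
  have fin: "finite (H \<times> K)" using H K finite_subgroup by auto
  have img: "?f ` (H \<times> K) = H <#> K" by (force simp: set_mult_def)
  have fib: "card {x \<in> H \<times> K. ?f x = y} = card (H \<inter> K)" if "y \<in> H <#> K" for y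
  proof -
    from that obtain h k where hk: "h \<in> H" "k \<in> K" "y = h \<otimes> k" by (auto simp: set_mult_def)
    note hkc = subsetD[OF Hc hk(1)] subsetD[OF Kc hk(2)]
    \<comment> \<open>The fibre over \<open>h k\<close> consists of the pairs
      \<open>(h d, d^-1 k)\<close> with \<open>d\<close> in the intersection, and \<open>d\<close>
      is recovered from the first component.\<close>
    have "bij_betw (\<lambda>d. (h \<otimes> d, inv d \<otimes> k)) (H \<inter> K) {x \<in> H \<times> K. ?f x = y}"
    proof (rule bij_betw_byWitness[where f' = "\<lambda>(a, b). inv h \<otimes> a"])
      show "\<forall>d\<in>H \<inter> K. (case (h \<otimes> d, inv d \<otimes> k) of (a, b) \<Rightarrow> inv h \<otimes> a) = d"
        using hkc Hc by auto
      have "inv (inv h \<otimes> a) \<otimes> k = b" "h \<otimes> (inv h \<otimes> a) = a"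
        if ab: "a \<in> H" "b \<in> K" "a \<otimes> b = y" for a b
      proof -
        note abc = subsetD[OF Hc ab(1)] subsetD[OF Kc ab(2)]
        have "inv (inv h \<otimes> a) \<otimes> k = inv a \<otimes> (a \<otimes> b)"
          using hkc abc hk(3) ab(3) by (simp add: inv_mult_group m_assoc)
        then show "inv (inv h \<otimes> a) \<otimes> k = b" "h \<otimes> (inv h \<otimes> a) = a" using hkc abc by auto
      qed
      then show "\<forall>x\<in>{x \<in> H \<times> K. ?f x = y}. (h \<otimes> (case x of (a, b) \<Rightarrow> inv h \<otimes> a),
             inv (case x of (a, b) \<Rightarrow> inv h \<otimes> a) \<otimes> k) = x"
        by auto
      have "h \<otimes> d \<in> H" "inv d \<otimes> k \<in> K" "h \<otimes> d \<otimes> (inv d \<otimes> k) = y"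
        if d: "d \<in> H" "d \<in> K" for d
        using d subsetD[OF Hc d(1)] hk hkc H K
        by (auto simp: m_assoc subgroup.m_closed subgroup.m_inv_closed)
      then show "(\<lambda>d. (h \<otimes> d, inv d \<otimes> k)) ` (H \<inter> K) \<subseteq> {x \<in> H \<times> K. ?f x = y}"
        by auto
      have "inv h \<otimes> a \<in> H" "inv h \<otimes> a \<in> K"
        if ab: "a \<in> H" "b \<in> K" "a \<otimes> b = y" for a b
      proof -
        note abc = subsetD[OF Hc ab(1)] subsetD[OF Kc ab(2)]
        have "inv h \<otimes> a = k \<otimes> inv b"
          using ab(3) hk(3) abc hkc by (metis cancel_inv_left inv_solve_right m_assoc m_closed inv_closed)
        moreover have "inv h \<otimes> a \<in> H" "k \<otimes> inv b \<in> K"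
          using ab hk H K by (auto simp: subgroup.m_closed subgroup.m_inv_closed)
        ultimately show "inv h \<otimes> a \<in> H" "inv h \<otimes> a \<in> K" by simp_all
      qed
      then show "(\<lambda>(a, b). inv h \<otimes> a) ` {x \<in> H \<times> K. ?f x = y} \<subseteq> H \<inter> K"
        by auto
    qed
    from bij_betw_same_card[OF this] show ?thesis by simp
  qed
  have "card H * card K = (\<Sum>x\<in>H \<times> K. 1)" by (simp add: card_cartesian_product)
  also have "\<dots> = (\<Sum>y\<in>?f ` (H \<times> K). \<Sum>x\<in>{x \<in> H \<times> K. ?f x = y}. 1)"
    by (rule sum.image_gen[OF fin])
  also have "\<dots> = (\<Sum>y\<in>H <#> K. card (H \<inter> K))"
    unfolding img by (rule sum.cong) (use fib in auto)
  finally show ?thesis by simp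
qed

lemma subset_set_mult:
  assumes "subgroup H G" "subgroup K G"
  shows "H \<subseteq> H <#> K" "K \<subseteq> H <#> K"
proof -
  have "h \<otimes> \<one> \<in> H <#> K" if "h \<in> H" for h
    using that assms(2) subgroup.one_closed by (force simp: set_mult_def)
  then show "H \<subseteq> H <#> K" using assms subgroup.subset by fastforce
  have "\<one> \<otimes> k \<in> H <#> K" if "k \<in> K" for k
    using that assms(1) subgroup.one_closed by (force simp: set_mult_def)
  then show "K \<subseteq> H <#> K" using assms subgroup.subset by fastforce
qed

lemma subgroup_set_mult:
  assumes H: "subgroup H G" and K: "subgroup K G" and sub: "K <#> H \<subseteq> H <#> K"
  shows "subgroup (H <#> K) G"
proof (rule finite_subgroupI)
  note Hc = subgroup.subset[OF H] and Kc = subgroup.subset[OF K]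
  show "H <#> K \<subseteq> carrier G" using Hc Kc by (auto simp: set_mult_def)
  show "\<one> \<in> H <#> K" using subset_set_mult[OF H K] subgroup.one_closed[OF H] by auto
  fix a b assume "a \<in> H <#> K" "b \<in> H <#> K"
  then obtain h k h' k' where hk: "h \<in> H" "k \<in> K" "a = h \<otimes> k" "h' \<in> H" "k' \<in> K" "b = h' \<otimes> k'"
    by (auto simp: set_mult_def)
  obtain h2 k2 where 2: "h2 \<in> H" "k2 \<in> K" "k \<otimes> h' = h2 \<otimes> k2"
    using set_multE[OF subsetD[OF sub set_multI[OF hk(2,4)]]] by metis
  have c: "h \<in> carrier G" "k \<in> carrier G" "h' \<in> carrier G" "k' \<in> carrier G"
    "h2 \<in> carrier G" "k2 \<in> carrier G" using hk 2 Hc Kc by auto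
  have "a \<otimes> b = h \<otimes> (k \<otimes> h') \<otimes> k'" using hk c by (simp add: m_assoc)
  also have "\<dots> = (h \<otimes> h2) \<otimes> (k2 \<otimes> k')" using 2 c by (simp add: m_assoc)
  finally show "a \<otimes> b \<in> H <#> K"
    using hk 2 H K by (auto intro: set_multI subgroup.m_closed)
qed

text \<open>The product set \<open>D <#> Y\<close> lies in \<open>T\<close>, so intersecting
  \<open>D\<close> with \<open>Y\<close> costs at most the index of \<open>Y\<close> in
  \<open>T\<close>.\<close>

lemma card_le_mult_card_Int:
  assumes "subgroup D G" "subgroup Y G" "subgroup T G" "D \<subseteq> T" "Y \<subseteq> T" "card T \<le> m * card Y"
  shows "card D \<le> m * card (D \<inter> Y)"
proof -
  have "D <#> Y \<subseteq> T" using assms(3-5) by (auto elim!: set_multE intro: subgroup.m_closed)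
  then have "card (D <#> Y) \<le> card T" using card_mono finite_subgroup assms(3) by blast
  then have "card D * card Y \<le> card T * card (D \<inter> Y)"
    unfolding card_set_mult[OF assms(1,2), symmetric] by (rule mult_le_mono1)
  also have "\<dots> \<le> m * card Y * card (D \<inter> Y)" by (rule mult_le_mono1[OF assms(6)])
  finally have "card D * card Y \<le> m * card (D \<inter> Y) * card Y" by (simp add: ac_simps)
  then show ?thesis using card_subgroup_pos[OF assms(2)] by simp
qed

lemma center_interval_iff:
  "H \<in> center_interval G \<longleftrightarrow> subgroup H G \<and> group_center G \<subseteq> H"
  by (simp add: center_interval_def)

lemma balancedD:
  assumes "balanced G" "subgroup H G" "group_center G \<subseteq> H"
  shows "card H * card (centralizer G H) = order G * card (group_center G)"
  using assms by (auto simp: balanced_def center_interval_iff CD_measure_def)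

text \<open>An arbitrary subgroup \<open>H\<close> is compared with \<open>H Z\<close>, which has
  the same centralizer. Under balance no measure therefore exceeds the common value, and a subgroup
  not containing the center stays strictly below it.\<close>

lemma CD_lattice_eq_center_interval_iff: "CD_lattice G = center_interval G \<longleftrightarrow> balanced G"
proof -
  have Z: "group_center G \<in> center_interval G"
    using subgroup_group_center by (auto simp: center_interval_def)
  have mZ: "CD_measure G (group_center G) = order G * card (group_center G)"
  proof -
    have "centralizer G (group_center G) = carrier G"
      by (auto simp: centralizer_def group_center_def)
    then show ?thesis by (simp add: CD_measure_def order_def)
  qed
  have "balanced G" if eq: "CD_lattice G = center_interval G"
  proof -
    have "CD_measure G H = CD_max G" if "H \<in> center_interval G" for H
      using that eq unfolding CD_lattice_def by auto
    then show "balanced G" using Z mZ unfolding balanced_def by metis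
  qed
  moreover have "CD_lattice G = center_interval G" if bal: "balanced G"
  proof -
    have fin: "finite (CD_measure G ` {H. subgroup H G})"
    proof -
      have "{H. subgroup H G} \<subseteq> Pow (carrier G)" using subgroup.subset by blast
      then show ?thesis using finite_carrier finite_subset by blast
    qed
    have step: "CD_measure G H \<le> order G * card (group_center G) \<and>
        (CD_measure G H = order G * card (group_center G) \<longrightarrow> group_center G \<subseteq> H)"
      if H: "subgroup H G" for H
    proof -
      let ?K = "H <#> group_center G"
      have HcZ: "group_center G \<subseteq> ?K" "H \<subseteq> ?K"
        using subset_set_mult H subgroup_group_center by auto
      have Hc: "H \<subseteq> carrier G" using H subgroup.subset by blast
      have "group_center G <#> H \<subseteq> ?K"
      proof
        fix x assume "x \<in> group_center G <#> H"
        then obtain z h where zh: "z \<in> group_center G" "h \<in> H" "x = z \<otimes> h" by (rule set_multE)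
        then have "x = h \<otimes> z" using Hc by (auto simp: group_center_def)
        then show "x \<in> ?K" using zh by (simp add: set_multI)
      qed
      then have K: "subgroup ?K G"
        using subgroup_set_mult H subgroup_group_center by blast
      have "centralizer G ?K = centralizer G H"
      proof
        show "centralizer G H \<subseteq> centralizer G ?K"
        proof
          fix x assume x: "x \<in> centralizer G H"
          then have "H \<union> group_center G \<subseteq> centralizer G {x}"
            using Hc by (auto simp: centralizer_def group_center_def)
          then have "?K \<subseteq> centralizer G {x}"
            using subgroup.m_closed[OF subgroup_centralizer[of "{x}"]] x
            by (auto elim!: set_multE simp: subset_iff centralizer_def)
          then show "x \<in> centralizer G ?K"
            using x by (auto simp: centralizer_def)
        qed
      qed (rule centralizer_antimono[OF HcZ(2)])
      moreover have "CD_measure G ?K = order G * card (group_center G)"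
        using bal K HcZ by (auto simp: balanced_def center_interval_def)
      ultimately have m: "card ?K * card (centralizer G H) = order G * card (group_center G)"
        by (simp add: CD_measure_def)
      have "card H \<le> card ?K" using card_mono finite_subgroup K HcZ by blast
      then have "CD_measure G H \<le> order G * card (group_center G)"
        unfolding CD_measure_def m[symmetric] by (rule mult_le_mono1)
      moreover have "group_center G \<subseteq> H" if "CD_measure G H = order G * card (group_center G)"
      proof -
        have "card H = card ?K"
          using that m card_subgroup_pos[OF subgroup_centralizer[OF Hc]]
          unfolding CD_measure_def by (metis mult_cancel2 less_irrefl)
        then show ?thesis using HcZ card_subset_eq finite_subgroup K by blast
      qed
      ultimately show ?thesis by blast
    qed
    have max: "CD_max G = order G * card (group_center G)"
      unfolding CD_max_def
    proof (rule Max_eqI[OF fin])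
      show "order G * card (group_center G) \<in> CD_measure G ` {H. subgroup H G}"
        using mZ subgroup_group_center by (metis imageI mem_Collect_eq)
    qed (use step in auto)
    show "CD_lattice G = center_interval G"
      using step bal unfolding CD_lattice_def max balanced_def center_interval_def by auto
  qed
  ultimately show ?thesis by blast
qed

end

section \<open>Permutability and the modular law\<close>

text \<open>In a finite group natural exponents reach all powers of \<open>x\<close>, so when
  \<open>x\<close> commutes with a subgroup \<open>S\<close> this explicit set is the subgroup
  generated by \<open>x\<close> and \<open>S\<close>.\<close>

definition adjoin :: "('a, 'b) monoid_scheme \<Rightarrow> 'a \<Rightarrow> 'a set \<Rightarrow> 'a set" where
  "adjoin G x S = {x [^]\<^bsub>G\<^esub> i \<otimes>\<^bsub>G\<^esub> s | i s. (i::nat) \<in> UNIV \<and> s \<in> S}"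

lemma adjoinI: "s \<in> S \<Longrightarrow> x [^]\<^bsub>G\<^esub> (i::nat) \<otimes>\<^bsub>G\<^esub> s \<in> adjoin G x S"
  by (auto simp: adjoin_def)

lemma adjoinE:
  assumes "y \<in> adjoin G x S"
  obtains i :: nat and s where "s \<in> S" "y = x [^]\<^bsub>G\<^esub> i \<otimes>\<^bsub>G\<^esub> s"
  using assms by (auto simp: adjoin_def)

lemma mem_centralizer_singleton:
  "x \<in> centralizer G {y} \<longleftrightarrow> x \<in> carrier G \<and> x \<otimes>\<^bsub>G\<^esub> y = y \<otimes>\<^bsub>G\<^esub> x"
  by (auto simp: centralizer_def)

context group
begin

lemma commute_mult:
  assumes "x \<in> carrier G" "y \<in> carrier G" "z \<in> carrier G"
    and "x \<otimes> z = z \<otimes> x" "y \<otimes> z = z \<otimes> y"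
  shows "x \<otimes> y \<otimes> z = z \<otimes> (x \<otimes> y)"
  using assms by (metis m_assoc)

lemma subgroup_pow_closed: "subgroup H G \<Longrightarrow> x \<in> H \<Longrightarrow> x [^] (n::nat) \<in> H"
  by (induct n) (auto simp: subgroup.one_closed subgroup.m_closed)

lemma pow_commute:
  assumes "x \<otimes> y = y \<otimes> x" "x \<in> carrier G" "y \<in> carrier G"
  shows "y \<otimes> x [^] (i::nat) = x [^] i \<otimes> y"
  using assms by (metis group_commutes_pow)

lemma centralizer_mult_right:
  assumes "subgroup S G" "S \<subseteq> centralizer G {x}" "x \<in> carrier G" "s \<in> S"
  shows "x [^] (i::nat) \<otimes> s = s \<otimes> x [^] i"
  using assms by (intro group_commutes_pow) (auto simp: mem_centralizer_singleton)

lemma adjoin_subset: "S \<subseteq> carrier G \<Longrightarrow> x \<in> carrier G \<Longrightarrow> adjoin G x S \<subseteq> carrier G"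
  by (auto simp: adjoin_def)

lemma subset_adjoin: "S \<subseteq> carrier G \<Longrightarrow> S \<subseteq> adjoin G x S"
  using adjoinI[of _ S G x 0] by fastforce

lemma mem_adjoin: "\<one> \<in> S \<Longrightarrow> x \<in> carrier G \<Longrightarrow> x \<in> adjoin G x S"
  using adjoinI[of \<one> S G x 1] by simp

lemma centralizer_adjoin:
  assumes "S \<subseteq> carrier G" "x \<in> carrier G" "\<one> \<in> S"
  shows "centralizer G (adjoin G x S) = centralizer G {x} \<inter> centralizer G S"
proof
  show "centralizer G (adjoin G x S) \<subseteq> centralizer G {x} \<inter> centralizer G S"
    using subset_adjoin[OF assms(1), of x] mem_adjoin[OF assms(3,2)]
    by (auto simp: centralizer_def)
  show "centralizer G {x} \<inter> centralizer G S \<subseteq> centralizer G (adjoin G x S)"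
  proof
    fix y assume y: "y \<in> centralizer G {x} \<inter> centralizer G S"
    then have yc: "y \<in> carrier G" by (simp add: centralizer_def)
    have "y \<otimes> u = u \<otimes> y" if "u \<in> adjoin G x S" for u
    proof -
      from that obtain i :: nat and s where u: "s \<in> S" "u = x [^] i \<otimes> s" by (rule adjoinE)
      have s: "s \<in> carrier G" "s \<otimes> y = y \<otimes> s" using u y assms by (auto simp: centralizer_def)
      have "x [^] i \<otimes> y = y \<otimes> x [^] i"
        using y assms(2) yc by (intro group_commutes_pow) (auto simp: mem_centralizer_singleton)
      from commute_mult[OF _ s(1) yc this s(2)] show ?thesis using u assms(2) by simp
    qed
    then show "y \<in> centralizer G (adjoin G x S)" using yc by (auto simp: centralizer_def)
  qed
qed

end

context finite_group
begin

lemma subgroup_adjoin: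
  assumes S: "subgroup S G" and x: "x \<in> carrier G" and c: "S \<subseteq> centralizer G {x}"
  shows "subgroup (adjoin G x S) G"
proof (rule finite_subgroupI)
  note Sc = subgroup.subset[OF S]
  show "adjoin G x S \<subseteq> carrier G" using adjoin_subset Sc x by simp
  show "\<one> \<in> adjoin G x S" using subset_adjoin[OF Sc] subgroup.one_closed[OF S] by auto
  fix a b assume "a \<in> adjoin G x S" "b \<in> adjoin G x S"
  then obtain i j :: nat and s t where st: "s \<in> S" "a = x [^] i \<otimes> s" "t \<in> S" "b = x [^] j \<otimes> t"
    by (metis adjoinE)
  have sc: "s \<in> carrier G" "t \<in> carrier G" using st Sc by auto
  have "a \<otimes> b = x [^] i \<otimes> (s \<otimes> x [^] j) \<otimes> t" using st sc x by (simp add: m_assoc)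
  also have "s \<otimes> x [^] j = x [^] j \<otimes> s" using centralizer_mult_right[OF S c x st(1)] by simp
  also have "x [^] i \<otimes> (x [^] j \<otimes> s) \<otimes> t = x [^] (i + j) \<otimes> (s \<otimes> t)"
    using sc x by (simp add: m_assoc flip: nat_pow_mult)
  finally show "a \<otimes> b \<in> adjoin G x S" using st S by (simp add: adjoinI subgroup.m_closed)
qed

lemma pow_mod_order: "x \<in> carrier G \<Longrightarrow> x [^] (i mod order G) = x [^] (i::nat)"
proof -
  assume x: "x \<in> carrier G"
  have "x [^] i = x [^] (order G * (i div order G) + i mod order G)" by simp
  also have "\<dots> = (x [^] order G) [^] (i div order G) \<otimes> x [^] (i mod order G)"
    using x by (simp only: nat_pow_mult nat_pow_pow nat_pow_closed)
  finally show ?thesis using x by (simp add: pow_order_eq_1)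
qed

text \<open>The exponent \<open>k\<close> is invertible modulo the order of \<open>G\<close>, so
  \<open>g\<close> is itself a power of \<open>g [^] k\<close>.\<close>

lemma mem_of_coprime_pow:
  assumes "subgroup Y G" "g \<in> carrier G" "g [^] k \<in> Y" "coprime k (order G)"
  shows "g \<in> Y"
proof -
  obtain u where u: "[k * u = 1] (mod order G)"
    using cong_solve_coprime_nat[OF assms(4)] by auto
  have "(g [^] k) [^] u = g [^] ((k * u) mod order G)"
    using assms(2) by (simp add: nat_pow_pow pow_mod_order)
  also have "\<dots> = g [^] (1 mod order G)" using u by (simp add: cong_def)
  also have "\<dots> = g" using pow_mod_order[OF assms(2), of 1] assms(2) by simp
  finally show ?thesis using subgroup_pow_closed[OF assms(1,3), of u] by simp
qed

text \<open>\<open>H\<close> and its centralizer both lie above the center; equating their measures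
  and cancelling leaves |H| = |C(C(H))|.\<close>

lemma balanced_centralizer_centralizer:
  assumes bal: "balanced G" and H: "subgroup H G" "group_center G \<subseteq> H"
  shows "centralizer G (centralizer G H) = H"
proof -
  let ?C = "centralizer G H"
  have Hc: "H \<subseteq> carrier G" using H subgroup.subset by blast
  have C: "subgroup ?C G" "group_center G \<subseteq> ?C"
    using subgroup_centralizer[OF Hc] group_center_subset_centralizer[OF Hc] by auto
  have CC: "subgroup (centralizer G ?C) G" by (rule subgroup_centralizer[OF centralizer_subset])
  have "card H * card ?C = card ?C * card (centralizer G ?C)"
    using balancedD[OF bal H] balancedD[OF bal C] by simp
  then have "card H = card (centralizer G ?C)" using card_subgroup_pos[OF C(1)] by simp
  then show ?thesis
    using card_subset_eq[OF finite_subgroup[OF CC] subset_centralizer_centralizer[OF Hc]] by simp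
qed

text \<open>For the join \<open>J\<close>, C(H) C(K) lies in C(H \<inter> K), and C(H) \<inter> C(K)
  = C(J). So |C(H)| |C(K)| \<le> |C(H \<inter> K)| |C(J)|, and balance turns this around into |H
  \<inter> K| |J| \<le> |H| |K|: the product set is as large as \<open>J\<close>.\<close>

lemma balanced_permutable:
  assumes bal: "balanced G"
    and H: "subgroup H G" "group_center G \<subseteq> H" and K: "subgroup K G" "group_center G \<subseteq> K"
  shows "H <#> K = generate G (H \<union> K)"
proof -
  let ?J = "generate G (H \<union> K)" and ?C = "centralizer G" and ?M = "order G * card (group_center G)"
  note Hc = subgroup.subset[OF H(1)] and Kc = subgroup.subset[OF K(1)]
  have J: "subgroup ?J G" using Hc Kc by (intro generate_is_subgroup) auto
  have inJ: "H \<union> K \<subseteq> ?J" by (auto intro: generate.incl)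
  have I: "subgroup (H \<inter> K) G" using subgroups_Inter_pair H K by blast
  have CJ: "?C ?J = ?C H \<inter> ?C K"
    using centralizer_generate[of "H \<union> K"] Hc Kc by (simp add: centralizer_Un)
  have CH: "subgroup (?C H) G" and CK: "subgroup (?C K) G" and CI: "subgroup (?C (H \<inter> K)) G"
    using Hc Kc by (auto intro!: subgroup_centralizer)
  have "?C H <#> ?C K \<subseteq> ?C (H \<inter> K)"
  proof
    fix x assume "x \<in> ?C H <#> ?C K"
    then obtain a b where "a \<in> ?C H" "b \<in> ?C K" "x = a \<otimes> b" by (rule set_multE)
    then show "x \<in> ?C (H \<inter> K)"
      using subgroup.m_closed[OF CI] centralizer_antimono[of "H \<inter> K" H G]
        centralizer_antimono[of "H \<inter> K" K G] by blast
  qed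
  then have "card (?C H <#> ?C K) \<le> card (?C (H \<inter> K))"
    using card_mono finite_subgroup[OF CI] by blast
  then have le: "card (?C H) * card (?C K) \<le> card (?C (H \<inter> K)) * card (?C ?J)"
    unfolding card_set_mult[OF CH CK, symmetric] CJ by (rule mult_le_mono1)
  have a: "card H * card (?C H) = ?M" by (rule balancedD[OF bal H])
  have b: "card K * card (?C K) = ?M" by (rule balancedD[OF bal K])
  have i: "card (H \<inter> K) * card (?C (H \<inter> K)) = ?M" using balancedD[OF bal I] H K by blast
  have j: "card ?J * card (?C ?J) = ?M" using balancedD[OF bal J] H inJ by blast
  have Mpos: "0 < ?M" using order_pos card_subgroup_pos[OF subgroup_group_center] by simp
  have "?M * ?M * (card (H \<inter> K) * card ?J)
      = (card H * card (?C H)) * (card K * card (?C K)) * (card (H \<inter> K) * card ?J)"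
    by (simp only: a b)
  also have "\<dots> = (card H * card K) * (card (H \<inter> K) * card ?J) * (card (?C H) * card (?C K))"
    by (simp only: ac_simps)
  also have "\<dots> \<le> (card H * card K) * (card (H \<inter> K) * card ?J) * (card (?C (H \<inter> K)) * card (?C ?J))"
    by (rule mult_le_mono2[OF le])
  also have "\<dots> = (card H * card K)
      * ((card (H \<inter> K) * card (?C (H \<inter> K))) * (card ?J * card (?C ?J)))"
    by (simp only: ac_simps)
  also have "\<dots> = ?M * ?M * (card H * card K)" by (simp only: i j ac_simps)
  finally have "card (H \<inter> K) * card ?J \<le> card H * card K"
    using Mpos by (simp only: mult_le_cancel1) auto
  also have "\<dots> = card (H <#> K) * card (H \<inter> K)" using card_set_mult[OF H(1) K(1)] by simp
  finally have "card ?J \<le> card (H <#> K)" using card_subgroup_pos[OF I] by simp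
  moreover have "H <#> K \<subseteq> ?J"
    using inJ subgroup.m_closed[OF J] by (auto elim!: set_multE)
  ultimately show ?thesis using card_seteq[OF finite_subgroup[OF J]] by blast
qed

lemma balanced_subgroup_set_mult:
  assumes "balanced G" "subgroup H G" "group_center G \<subseteq> H" "subgroup K G" "group_center G \<subseteq> K"
  shows "subgroup (H <#> K) G"
  unfolding balanced_permutable[OF assms]
  using assms subgroup.subset by (intro generate_is_subgroup) blast

text \<open>Once joins are product sets, the modular law is Dedekind's identity for products of
  subgroups.\<close>

lemma balanced_modular_lattice:
  assumes bal: "balanced G" shows "modular_lattice (inclusion_order (center_interval G))"
proof -
  let ?L = "inclusion_order (center_interval G)"
  interpret L: Lattice.lattice ?L by (rule center_interval_lattice)
  show ?thesis
  proof (unfold_locales)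
    fix H K W assume *: "H \<in> carrier ?L" "K \<in> carrier ?L" "W \<in> carrier ?L" "H \<sqsubseteq>\<^bsub>?L\<^esub> W"
    then have H: "subgroup H G" "group_center G \<subseteq> H" and K: "subgroup K G" "group_center G \<subseteq> K"
      and W: "subgroup W G" "group_center G \<subseteq> W" and HW: "H \<subseteq> W"
      by (auto simp: center_interval_def)
    have KW: "subgroup (K \<inter> W) G" "group_center G \<subseteq> K \<inter> W" using subgroups_Inter_pair K W by auto
    have HK: "subgroup (H <#> K) G" "H \<subseteq> H <#> K"
      using balanced_subgroup_set_mult[OF bal H K] subset_set_mult[OF H(1) K(1)] by auto
    have "H <#> (K \<inter> W) = (H <#> K) \<inter> W"
    proof
      show "H <#> (K \<inter> W) \<subseteq> (H <#> K) \<inter> W"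
        using HW subgroup.m_closed[OF W(1)] by (auto elim!: set_multE intro: set_multI)
      show "(H <#> K) \<inter> W \<subseteq> H <#> (K \<inter> W)"
      proof
        fix x assume x: "x \<in> (H <#> K) \<inter> W"
        then obtain h k where hk: "h \<in> H" "k \<in> K" "x = h \<otimes> k" by (auto elim: set_multE)
        then have c: "h \<in> carrier G" "k \<in> carrier G" using H K subgroup.subset by blast+
        have "inv h \<otimes> x \<in> W"
          using hk HW x subgroup.m_closed[OF W(1)] subgroup.m_inv_closed[OF W(1)] by blast
        then have "k \<in> W" using hk c by simp
        then show "x \<in> H <#> (K \<inter> W)" using hk by (auto intro: set_multI)
      qed
    qed
    moreover have "H <#> (K \<inter> W) \<in> center_interval G" "H <#> K \<in> center_interval G"
      using balanced_subgroup_set_mult[OF bal H KW] subset_set_mult[OF H(1) KW(1)] HK H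
      by (auto simp: center_interval_def)
    ultimately show "H \<squnion>\<^bsub>?L\<^esub> (K \<sqinter>\<^bsub>?L\<^esub> W) = (H \<squnion>\<^bsub>?L\<^esub> K) \<sqinter>\<^bsub>?L\<^esub> W"
      using H K W KW center_interval_join center_interval_meet
        balanced_permutable[OF bal H KW] balanced_permutable[OF bal H K]
      by (simp add: center_interval_def)
  qed
qed

end

section \<open>Groups of prime power order: last powers outside a subgroup, index
  \<open>p\<close>\<close>

locale prime_power_group = group G for G (structure) +
  fixes p n :: nat
  assumes prime_p: "Factorial_Ring.prime p" and order_eq: "order G = p ^ n"
begin

lemma finite_group: "finite_group G"
proof
  show "finite (carrier G)"
    using order_eq prime_gt_0_nat[OF prime_p] order_gt_0_iff_finite by simp
qed

end

sublocale prime_power_group \<subseteq> finite_group by (rule finite_group)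

context prime_power_group
begin

lemma mem_of_coprime_pow_p:
  assumes "subgroup Y G" "g \<in> carrier G" "g [^] k \<in> Y" "\<not> p dvd k"
  shows "g \<in> Y"
  using assms prime_imp_coprime[OF prime_p, of k]
  by (intro mem_of_coprime_pow[of Y g k]) (auto simp: order_eq coprime_commute)

text \<open>The powers \<open>g [^] (p ^ k)\<close> start outside \<open>Y\<close> and end at
  \<open>\<one>\<close>. This is how elements whose \<open>p\<close>-th power lies in a given
  subgroup are produced throughout.\<close>

lemma last_power:
  assumes Y: "subgroup Y G" and g: "g \<in> carrier G" "g \<notin> Y"
  obtains k where "g [^] (p ^ k) \<notin> Y" "g [^] (p ^ Suc k) \<in> Y"
proof -
  have "g [^] (p ^ n) \<in> Y"
    using pow_order_eq_1[OF g(1)] subgroup.one_closed[OF Y] by (simp add: order_eq)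
  moreover have "g [^] (p ^ 0) \<notin> Y" using g by simp
  ultimately have "\<exists>k<n. (\<forall>i\<le>k. g [^] (p ^ i) \<notin> Y) \<and> g [^] (p ^ Suc k) \<in> Y"
    by (intro ex_least_nat_less) auto
  then show thesis using that by blast
qed

text \<open>If \<open>g^i Y\<close> and \<open>g^j Y\<close> met for \<open>i < j < p\<close>, then
  \<open>Y\<close> would contain \<open>g^(j-i)\<close>, whose exponent is prime to
  \<open>p\<close>, and hence \<open>g\<close>.\<close>

lemma inj_on_cosets:
  assumes Y: "subgroup Y G" and g: "g \<in> carrier G" "g \<notin> Y"
  shows "inj_on (\<lambda>(i, y). g [^] i \<otimes> y) ({..<p} \<times> Y)"
proof -
  have *: "i = j \<and> y = z"
    if "i \<le> j" "j < p" "y \<in> Y" "z \<in> Y" "g [^] i \<otimes> y = g [^] j \<otimes> z" for i j :: nat and y z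
  proof -
    have c: "y \<in> carrier G" "z \<in> carrier G" using that Y subgroup.subset by blast+
    have "g [^] i \<otimes> y = g [^] i \<otimes> (g [^] (j - i) \<otimes> z)"
      using that c g by (simp add: nat_pow_mult flip: m_assoc)
    then have y: "y = g [^] (j - i) \<otimes> z" using c g by simp
    then have "g [^] (j - i) = y \<otimes> inv z" using c g by (simp add: inv_solve_right)
    then have "g [^] (j - i) \<in> Y" using that Y by (simp add: subgroup.m_closed subgroup.m_inv_closed)
    then have "p dvd j - i" using mem_of_coprime_pow_p[OF Y g(1)] g(2) by blast
    then have "i = j" using that by (metis dvd_imp_le less_imp_diff_less le_antisym not_le zero_less_diff)
    then show ?thesis using y c by simp
  qed
  show ?thesis
    unfolding inj_on_def by (auto, metis * nat_le_linear, metis * nat_le_linear)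
qed

lemma card_le_of_not_mem:
  assumes Y: "subgroup Y G" and W: "subgroup W G" "Y \<subseteq> W" and g: "g \<in> W" "g \<notin> Y"
  shows "p * card Y \<le> card W"
    and "card W \<le> p * card Y \<Longrightarrow> W = (\<lambda>(i, y). g [^] i \<otimes> y) ` ({..<p} \<times> Y)"
proof -
  let ?f = "\<lambda>(i::nat, y). g [^] i \<otimes> y"
  have gc: "g \<in> carrier G" using g W subgroup.subset by blast
  have c: "card (?f ` ({..<p} \<times> Y)) = p * card Y"
    using card_image[OF inj_on_cosets[OF Y gc g(2)]] by (simp add: card_cartesian_product)
  have s: "?f ` ({..<p} \<times> Y) \<subseteq> W"
    using W g by (auto intro!: subgroup.m_closed subgroup_pow_closed)
  show "p * card Y \<le> card W" using card_mono[OF finite_subgroup[OF W(1)] s] c by simp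
  show "W = ?f ` ({..<p} \<times> Y)" if "card W \<le> p * card Y"
    using card_seteq[OF finite_subgroup[OF W(1)] s] c that by simp
qed

text \<open>The cosets \<open>g^i Y\<close> with \<open>i < p\<close> fill \<open>W\<close>, so one
  contains \<open>g^p\<close>; a positive \<open>i\<close> would put \<open>g^(p-i)\<close> and
  hence \<open>g\<close> into \<open>Y\<close>. The lemma is applied to centralizers, whose
  normality in \<open>W\<close> is not known.\<close>

lemma prime_index:
  assumes Y: "subgroup Y G" and W: "subgroup W G" "Y \<subseteq> W" and g: "g \<in> W" "g \<notin> Y"
    and le: "card W \<le> p * card Y"
  shows "g [^] p \<in> Y" and "\<And>w. w \<in> W \<Longrightarrow> \<exists>i::nat. \<exists>y\<in>Y. w = g [^] i \<otimes> y"
proof -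
  note W_eq = card_le_of_not_mem(2)[OF Y W g le]
  have gc: "g \<in> carrier G" using g W subgroup.subset by blast
  show "\<And>w. w \<in> W \<Longrightarrow> \<exists>i::nat. \<exists>y\<in>Y. w = g [^] i \<otimes> y" unfolding W_eq by auto
  have "g [^] p \<in> W" using subgroup_pow_closed W g by blast
  then obtain i :: nat and y where i: "i < p" "y \<in> Y" "g [^] p = g [^] i \<otimes> y" unfolding W_eq by auto
  have yc: "y \<in> carrier G" using i Y subgroup.subset by blast
  have "g [^] i \<otimes> g [^] (p - i) = g [^] i \<otimes> y" using i gc by (simp add: nat_pow_mult)
  then have "g [^] (p - i) = y" using gc yc by simp
  then have "p dvd p - i" using mem_of_coprime_pow_p[OF Y gc] i g(2) by blast
  then have "i = 0" using i(1) by (metis diff_is_0_eq' diff_less dvd_imp_le le_less_trans not_gr_zero not_le less_irrefl prime_gt_0_nat prime_p zero_less_diff)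
  then show "g [^] p \<in> Y" using i yc by simp
qed

end

section \<open>Commutators in balanced groups of prime power order\<close>

text \<open>In other words, \<open>g\<close> lies in the centralizer of \<open>b^p\<close> but not
  in that of \<open>b\<close>; in a balanced group of prime power order the latter has index
  \<open>p\<close> in the former.\<close>

definition linked :: "('a, 'b) monoid_scheme \<Rightarrow> nat \<Rightarrow> 'a \<Rightarrow> 'a \<Rightarrow> bool" where
  "linked G p b g \<longleftrightarrow> b \<in> carrier G \<and> g \<in> carrier G \<and> b \<otimes>\<^bsub>G\<^esub> g \<noteq> g \<otimes>\<^bsub>G\<^esub> b
     \<and> b [^]\<^bsub>G\<^esub> p \<otimes>\<^bsub>G\<^esub> g = g \<otimes>\<^bsub>G\<^esub> b [^]\<^bsub>G\<^esub> p"

context group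
begin

lemma conj_mult:
  assumes "g \<in> carrier G" "a \<in> carrier G" "b \<in> carrier G"
  shows "g \<otimes> (a \<otimes> b) \<otimes> inv g = (g \<otimes> a \<otimes> inv g) \<otimes> (g \<otimes> b \<otimes> inv g)"
  using assms by (simp add: m_assoc)

lemma conj_pow:
  assumes "g \<in> carrier G" "b \<in> carrier G"
  shows "(g \<otimes> b \<otimes> inv g) [^] (k::nat) = g \<otimes> b [^] k \<otimes> inv g"
  using assms by (induct k) (simp_all add: conj_mult)

lemma conj_eq_iff:
  assumes "g \<in> carrier G" "b \<in> carrier G"
  shows "g \<otimes> b \<otimes> inv g = b \<longleftrightarrow> g \<otimes> b = b \<otimes> g"
  using assms by (simp add: inv_solve_right')

lemma conj_commuting:
  assumes "g \<in> carrier G" "b \<in> carrier G" "g \<otimes> b = b \<otimes> g"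
  shows "g \<otimes> b \<otimes> inv g = b"
  using conj_eq_iff[OF assms(1,2)] assms(3) by blast

lemma conj_conj:
  assumes "g \<in> carrier G" "h \<in> carrier G" "b \<in> carrier G"
  shows "(g \<otimes> h) \<otimes> b \<otimes> inv (g \<otimes> h) = g \<otimes> (h \<otimes> b \<otimes> inv h) \<otimes> inv g"
  using assms by (simp add: m_assoc inv_mult_group)

lemma conj_pow_of_commuting:
  assumes "g \<in> carrier G" "b \<in> carrier G" "c \<in> carrier G"
    and "g \<otimes> b \<otimes> inv g = c \<otimes> b" "g \<otimes> c = c \<otimes> g"
  shows "g [^] (i::nat) \<otimes> b \<otimes> inv (g [^] i) = c [^] i \<otimes> b"
proof (induct i)
  case (Suc i)
  have c: "g \<otimes> c [^] i \<otimes> inv g = c [^] i"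
    using assms by (subst conj_eq_iff) (auto simp: pow_commute)
  have "g [^] Suc i \<otimes> b \<otimes> inv (g [^] Suc i) = g \<otimes> (g [^] i \<otimes> b \<otimes> inv (g [^] i)) \<otimes> inv g"
    using assms(1,2) by (simp only: nat_pow_Suc2 conj_conj nat_pow_closed)
  also have "\<dots> = c [^] i \<otimes> (c \<otimes> b)"
    using Suc assms c by (simp add: conj_mult)
  finally show ?case using assms by (simp add: m_assoc)
qed (use assms in simp)

lemma commutator_mult_right:
  assumes "x \<in> carrier G" "y \<in> carrier G" "z \<in> carrier G"
  shows "commutator G x (y \<otimes> z) = commutator G x y \<otimes> (y \<otimes> commutator G x z \<otimes> inv y)"
  using assms by (simp add: commutator_def m_assoc inv_mult_group)

text \<open>If \<open>a\<close> lies in \<open>B\<close> and \<open>b\<close> in \<open>A\<close>,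
  then \<open>a b\<close> avoids both.\<close>

lemma not_covered_by_two_subgroups:
  assumes "subgroup A G" "subgroup B G" "a \<in> carrier G" "a \<notin> A" "b \<in> carrier G" "b \<notin> B"
  obtains g where "g \<in> carrier G" "g \<notin> A" "g \<notin> B"
proof (cases "a \<in> B \<and> b \<in> A")
  case True
  have "a \<otimes> b \<notin> A"
  proof
    assume "a \<otimes> b \<in> A"
    then have "a \<otimes> b \<otimes> inv b \<in> A"
      using True assms(1) by (simp add: subgroup.m_closed subgroup.m_inv_closed)
    then show False using assms by (simp add: m_assoc)
  qed
  moreover have "a \<otimes> b \<notin> B"
  proof
    assume "a \<otimes> b \<in> B"
    then have "inv a \<otimes> (a \<otimes> b) \<in> B"
      using True assms(2) by (simp add: subgroup.m_closed subgroup.m_inv_closed)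
    then show False using assms by simp
  qed
  ultimately show thesis using that[of "a \<otimes> b"] assms by simp
qed (use assms that in blast)

lemma centralizer_center: "centralizer G (group_center G) = carrier G"
  by (auto simp: centralizer_def group_center_def)

lemma center_commute: "z \<in> group_center G \<Longrightarrow> x \<in> carrier G \<Longrightarrow> z \<otimes> x = x \<otimes> z"
  by (simp add: group_center_def)

end

context prime_power_group
begin

abbreviation "Z \<equiv> group_center G"
abbreviation "C x \<equiv> centralizer G {x}"

lemma subgroup_C: "x \<in> carrier G \<Longrightarrow> subgroup (C x) G"
  by (simp add: subgroup_centralizer)

lemma center_subset_C: "x \<in> carrier G \<Longrightarrow> Z \<subseteq> C x"
  by (simp add: group_center_subset_centralizer)

lemma C_pow: "x \<in> carrier G \<Longrightarrow> C x \<subseteq> C (x [^] (i::nat))"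
  by (auto simp: mem_centralizer_singleton pow_commute)

text \<open>\<open>adjoin G x Z\<close> is the member of the interval that represents
  \<open>x\<close>; through it balance applies to centralizers of single elements.\<close>

lemma adjoin_center:
  assumes "x \<in> carrier G"
  shows "subgroup (adjoin G x Z) G" "Z \<subseteq> adjoin G x Z" "centralizer G (adjoin G x Z) = C x"
proof -
  show "subgroup (adjoin G x Z) G"
    using assms subgroup_adjoin[OF subgroup_group_center] center_subset_C by blast
  show "Z \<subseteq> adjoin G x Z" by (rule subset_adjoin[OF subgroup.subset[OF subgroup_group_center]])
  show "centralizer G (adjoin G x Z) = C x"
    using centralizer_adjoin[OF subgroup.subset[OF subgroup_group_center] assms]
      subgroup.one_closed[OF subgroup_group_center] centralizer_subset[of G "{x}"]
    by (auto simp: centralizer_center)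
qed

text \<open>Let \<open>g^(p^k)\<close> be the last such power outside \<open>S\<close>. Raising
  \<open>g = g^(p i) z\<close> to the power \<open>p^k\<close> would write it as a product of
  elements of \<open>S\<close>.\<close>

lemma not_mem_adjoin_pow:
  assumes S: "subgroup S G" "S \<subseteq> C g" and g: "g \<in> carrier G" "g \<notin> S"
  shows "g \<notin> adjoin G (g [^] p) S"
proof
  assume "g \<in> adjoin G (g [^] p) S"
  then obtain i :: nat and z where z: "z \<in> S" "g = (g [^] p) [^] i \<otimes> z" by (rule adjoinE)
  obtain k where k: "g [^] (p ^ k) \<notin> S" "g [^] (p ^ Suc k) \<in> S"
    using last_power[OF S(1) g] by blast
  have zc: "z \<in> carrier G" by (rule subgroup.mem_carrier[OF S(1) z(1)])
  have "((g [^] p) [^] i) \<otimes> z = z \<otimes> ((g [^] p) [^] i)"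
    using centralizer_mult_right[OF S g(1) z(1), of "p * i"]
    by (simp only: nat_pow_pow[OF g(1)])
  then have "((g [^] p) [^] i \<otimes> z) [^] (p ^ k) = ((g [^] p) [^] i) [^] (p ^ k) \<otimes> z [^] (p ^ k)"
    using g zc by (intro pow_mult_distrib) auto
  also have "((g [^] p) [^] i) [^] (p ^ k) = (g [^] (p ^ Suc k)) [^] i"
    using g by (simp add: nat_pow_pow ac_simps)
  finally have "g [^] (p ^ k) = (g [^] (p ^ Suc k)) [^] i \<otimes> z [^] (p ^ k)"
    by (rule trans[OF arg_cong[OF z(2), of "\<lambda>x. x [^] (p ^ k)"]])
  then show False
    using k z subgroup_pow_closed[OF S(1)] subgroup.m_closed[OF S(1)] by metis
qed

context
  assumes bal: "balanced G"
begin

lemma centralizer_C: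
  assumes "x \<in> carrier G" shows "centralizer G (C x) = adjoin G x Z"
  using balanced_centralizer_centralizer[OF bal adjoin_center(1,2)[OF assms]]
  by (simp add: adjoin_center(3)[OF assms])

text \<open>Modulo \<open>adjoin G (b [^] p) Z\<close> only the exponents of \<open>b\<close> below
  \<open>p\<close> matter, so adjoining \<open>b\<close> instead of \<open>b^p\<close> multiplies
  the order by at most \<open>p\<close>. Balance converts this into the bound for the
  centralizers.\<close>

lemma card_C_pow_le:
  assumes b: "b \<in> carrier G" shows "card (C (b [^] p)) \<le> p * card (C b)"
proof -
  let ?H = "adjoin G b Z" and ?K = "adjoin G (b [^] p) Z"
  have bp: "b [^] p \<in> carrier G" using b by simp
  have "?H \<subseteq> (\<lambda>(i, y). b [^] i \<otimes> y) ` ({..<p} \<times> ?K)"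
  proof
    fix x assume "x \<in> ?H"
    then obtain m :: nat and z where z: "z \<in> Z" "x = b [^] m \<otimes> z" by (rule adjoinE)
    then have zc: "z \<in> carrier G" by (simp add: group_center_def)
    have "b [^] m = b [^] (m mod p + p * (m div p))" by simp
    also have "\<dots> = b [^] (m mod p) \<otimes> (b [^] p) [^] (m div p)"
      using b by (simp only: nat_pow_mult nat_pow_pow)
    finally have "x = b [^] (m mod p) \<otimes> ((b [^] p) [^] (m div p) \<otimes> z)"
      using b z zc by (simp add: m_assoc)
    moreover have "m mod p < p" using prime_gt_0_nat[OF prime_p] by simp
    ultimately show "x \<in> (\<lambda>(i, y). b [^] i \<otimes> y) ` ({..<p} \<times> ?K)"
      using adjoinI[OF z(1), where x = "b [^] p"] by force
  qed
  moreover have "finite ({..<p} \<times> ?K)" using finite_subgroup adjoin_center(1)[OF bp] by blast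
  ultimately have "card ?H \<le> p * card ?K"
    by (metis card_cartesian_product card_image_le card_lessThan card_mono finite_imageI le_trans)
  moreover have "card ?H * card (C b) = card ?K * card (C (b [^] p))"
    using balancedD[OF bal adjoin_center(1,2)[OF b]] balancedD[OF bal adjoin_center(1,2)[OF bp]]
    by (simp only: adjoin_center(3)[OF b] adjoin_center(3)[OF bp])
  ultimately have "card ?K * card (C (b [^] p)) \<le> card ?K * (p * card (C b))"
    by (metis (no_types, lifting) mult.assoc mult.commute mult_le_mono1)
  then show ?thesis using card_subgroup_pos[OF adjoin_center(1)[OF bp]] by simp
qed

text \<open>If some conjugate of \<^term>\<open>C b\<close> under \<open>g\<close> differed from it, their product would be all of
  \<^term>\<open>C (b [^] p)\<close>, but a group is never the product of a proper subgroup and a conjugate of it.\<close>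

lemma commutator_commutes:
  assumes b: "b \<in> carrier G" and g: "g \<in> carrier G" and gb: "b [^] p \<otimes> g = g \<otimes> b [^] p"
  shows "commutator G g b \<otimes> b = b \<otimes> commutator G g b"
proof -
  let ?d = "g \<otimes> b \<otimes> inv g"
  have d: "?d \<in> carrier G" using b g by simp
  have "?d \<otimes> b = b \<otimes> ?d"
  proof (rule ccontr)
    assume nd: "?d \<otimes> b \<noteq> b \<otimes> ?d"
    let ?P = "C ?d <#> C b"
    have dp: "?d [^] p = b [^] p" using b g gb by (simp add: conj_pow conj_eq_iff)
    have P: "subgroup ?P G"
      using b d by (intro balanced_subgroup_set_mult[OF bal] subgroup_C center_subset_C)
    have sub: "C ?d \<subseteq> ?P" "C b \<subseteq> ?P" using subset_set_mult subgroup_C b d by auto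
    have W: "subgroup (C (b [^] p)) G" using b by (simp add: subgroup_C)
    have PW: "?P \<subseteq> C (b [^] p)"
      using C_pow[OF b, of p] C_pow[OF d, of p] subgroup.m_closed[OF W]
      unfolding dp by (auto elim!: set_multE)
    \<comment> \<open>\<open>?d\<close> shows that \<open>?P\<close> properly contains
      \<open>C b\<close>; then \<open>?P\<close> has at least \<open>p * card (C b)\<close>
      elements, which is already the upper bound for \<open>C (b [^] p)\<close>.\<close>
    have "?d \<in> C ?d" "?d \<notin> C b" using d nd by (auto simp: mem_centralizer_singleton)
    then have "p * card (C b) \<le> card ?P"
      using card_le_of_not_mem(1)[OF subgroup_C[OF b] P sub(2)] sub(1) by blast
    then have "?P = C (b [^] p)"
      using card_C_pow_le[OF b] card_seteq[OF finite_subgroup[OF W] PW] by simp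
    then have "g \<in> ?P" using g gb by (simp add: mem_centralizer_singleton)
    then obtain u y where uy: "u \<in> C ?d" "y \<in> C b" "g = u \<otimes> y" by (rule set_multE)
    then have c: "u \<in> carrier G" "y \<in> carrier G" by (auto simp: mem_centralizer_singleton)
    have "y \<otimes> b \<otimes> inv y = b" using uy c b by (intro conj_commuting) (auto simp: mem_centralizer_singleton)
    then have "?d = u \<otimes> b \<otimes> inv u" using uy(3) c b by (simp add: conj_conj)
    moreover have "u \<otimes> ?d \<otimes> inv u = ?d" using uy c d by (intro conj_commuting) (auto simp: mem_centralizer_singleton)
    ultimately have "u \<otimes> ?d \<otimes> inv u = u \<otimes> b \<otimes> inv u" by simp
    then have "?d = b" using c b d by simp
    then show False using nd by simp
  qed
  moreover have "commutator G g b = ?d \<otimes> inv b" by (simp add: commutator_def)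
  ultimately show ?thesis
    using b d by (metis cancel_left_inv inv_closed l_inv m_assoc r_one r_inv)
qed

text \<open>\<open>C b\<close> has index at most \<open>p\<close> in \<open>C (b [^] p)\<close>, so
  \<open>prime_index\<close> puts the \<open>p\<close>-th power of \<open>g\<close> into
  \<open>C b\<close>.\<close>

lemma linked_sym:
  assumes "linked G p b g" shows "linked G p g b"
proof -
  have *: "b \<in> carrier G" "g \<in> carrier G" "g \<in> C (b [^] p)" "g \<notin> C b"
    using assms by (auto simp: linked_def mem_centralizer_singleton)
  have "g [^] p \<in> C b"
    using * by (intro prime_index(1)[OF subgroup_C _ C_pow _ _ card_C_pow_le] subgroup_C) auto
  then show ?thesis using assms by (auto simp: linked_def mem_centralizer_singleton)
qed

text \<open>By symmetry \<open>c = [g, b]\<close> commutes with both entries, whence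
  \<open>b^p = (g b g^-1)^p = (c b)^p = c^p b^p\<close>. For the last claim, powers of
  \<open>g\<close> represent all cosets of \<open>C b\<close> in \<open>C (b [^] p)\<close>, and
  \<open>[g^i y, b] = c^i\<close> for \<open>y\<close> in \<open>C b\<close>.\<close>

lemma linked_commutator:
  assumes l: "linked G p b g"
  shows "commutator G g b \<otimes> b = b \<otimes> commutator G g b"
    and "commutator G g b \<otimes> g = g \<otimes> commutator G g b"
    and "commutator G g b [^] p = \<one>"
    and "g' \<in> carrier G \<Longrightarrow> b [^] p \<otimes> g' = g' \<otimes> b [^] p
      \<Longrightarrow> \<exists>i::nat. commutator G g' b = commutator G g b [^] i"
proof -
  let ?c = "commutator G g b"
  have b: "b \<in> carrier G" and g: "g \<in> carrier G" and gb: "b [^] p \<otimes> g = g \<otimes> b [^] p"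
    and ne: "g \<notin> C b"
    using l by (auto simp: linked_def mem_centralizer_singleton)
  have c: "?c \<in> carrier G" using b g by simp
  show cb: "?c \<otimes> b = b \<otimes> ?c" by (rule commutator_commutes[OF b g gb])
  have "inv ?c \<otimes> g = g \<otimes> inv ?c"
    using commutator_commutes[OF g b] linked_sym[OF l] b g by (simp add: inv_commutator linked_def)
  then show cg: "?c \<otimes> g = g \<otimes> ?c"
    using c g by (metis inv_solve_left inv_solve_right m_assoc m_closed inv_closed)
  have "b [^] p = (g \<otimes> b \<otimes> inv g) [^] p" using b g gb by (simp add: conj_pow conj_commuting)
  also have "\<dots> = (?c \<otimes> b) [^] p" using b g by (simp only: conj_eq_commutator)
  also have "\<dots> = ?c [^] p \<otimes> b [^] p" using pow_mult_distrib[OF cb c b] .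
  finally show "?c [^] p = \<one>" using b c by (metis l_cancel_one' nat_pow_closed r_cancel_one')
  show "\<exists>i::nat. commutator G g' b = ?c [^] i"
    if g': "g' \<in> carrier G" "b [^] p \<otimes> g' = g' \<otimes> b [^] p"
  proof -
    have "g \<in> C (b [^] p)" "g' \<in> C (b [^] p)" using g gb g' by (auto simp: mem_centralizer_singleton)
    then obtain i :: nat and y where y: "y \<in> C b" "g' = g [^] i \<otimes> y"
      using prime_index(2)[OF subgroup_C[OF b] _ C_pow[OF b] _ ne card_C_pow_le[OF b]] b subgroup_C
      by (metis nat_pow_closed)
    have yc: "y \<in> carrier G" "y \<otimes> b \<otimes> inv y = b"
      using y b conj_commuting[of y b] by (auto simp only: mem_centralizer_singleton)
    have "g' \<otimes> b \<otimes> inv g' = g [^] i \<otimes> b \<otimes> inv (g [^] i)"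
      unfolding y(2) using yc b g by (simp only: conj_conj nat_pow_closed)
    also have "\<dots> = ?c [^] i \<otimes> b"
      by (rule conj_pow_of_commuting[OF g b c conj_eq_commutator[OF g b] cg[symmetric]])
    finally have "g' \<otimes> b \<otimes> inv g' = ?c [^] i \<otimes> b" .
    then have "commutator G g' b \<otimes> b = ?c [^] i \<otimes> b" using conj_eq_commutator g' b by simp
    then show ?thesis using b c g' by auto
  qed
qed

text \<open>\<open>w\<close> is the last noncentral power of some \<open>u\<close> that does not
  commute with the last noncentral power of \<open>g\<close>. It will be joined to \<open>g\<close>
  by a path of two links.\<close>

lemma exists_linking_element:
  assumes g: "g \<in> carrier G" "g \<notin> Z"
  obtains w where "w \<in> carrier G" "w \<notin> Z" "w [^] p \<in> Z" "w \<notin> adjoin G (g [^] p) Z"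
proof -
  note Zs = subgroup_group_center
  obtain k where k: "g [^] (p ^ k) \<notin> Z" "g [^] (p ^ Suc k) \<in> Z"
    using last_power[OF Zs g] by blast
  obtain u where u: "u \<in> carrier G" "u \<notin> C (g [^] (p ^ k))"
    using k(1) g by (auto simp: group_center_def mem_centralizer_singleton)
  have "u \<notin> Z" using u center_subset_C[of "g [^] (p ^ k)"] g by auto
  then obtain l where l: "u [^] (p ^ l) \<notin> Z" "u [^] (p ^ Suc l) \<in> Z"
    using last_power[OF Zs u(1)] by blast
  let ?w = "u [^] (p ^ l)"
  have "?w \<notin> adjoin G (g [^] p) Z"
  proof
    assume "?w \<in> adjoin G (g [^] p) Z"
    then obtain i :: nat and z where z: "z \<in> Z" "?w = (g [^] p) [^] i \<otimes> z" by (rule adjoinE)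
    define j where "j = p * i"
    have zc: "z \<in> carrier G" using z by (simp add: group_center_def)
    have w: "?w = g [^] j \<otimes> z" using z g by (simp add: j_def nat_pow_pow)
    have gj: "g [^] j = ?w \<otimes> inv z" using w g zc by (simp add: inv_solve_right)
    have jZ: "g [^] j \<notin> Z" using w l(1) z(1) subgroup.m_closed[OF Zs] by metis
    then have "j \<noteq> 0" using subgroup.one_closed[OF Zs] by (metis nat_pow_0)
    \<comment> \<open>With \<open>j = p^s j'\<close>, whether \<open>g^j\<close> lies in a subgroup
      depends on \<open>p^s\<close> only. Since \<open>g^j\<close> is noncentral with central
      \<open>p\<close>-th power, \<open>s = k\<close>; since \<open>?w\<close> commutes with
      \<open>u\<close>, so does \<open>g^(p^k)\<close>, against the choice of
      \<open>u\<close>.\<close>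
    then obtain s j' where j': "j = p ^ s * j'" "\<not> p dvd j'"
      using prime_power_canonical[OF prime_p, of j] by (metis mult.commute not_gr_zero)
    have "?w [^] p \<otimes> inv (z [^] p) \<in> Z"
      using l(2) z(1) u subgroup_pow_closed[OF Zs] subgroup.m_closed[OF Zs] subgroup.m_inv_closed[OF Zs]
      by (simp add: nat_pow_pow mult.commute)
    moreover have "?w [^] p = g [^] (j * p) \<otimes> z [^] p"
      using w g zc center_commute[OF z(1)] pow_mult_distrib[of "g [^] j" z p] by (simp add: nat_pow_pow)
    ultimately have "g [^] (j * p) \<in> Z" using g zc by (simp add: m_assoc)
    then have "(g [^] (p ^ Suc s)) [^] j' \<in> Z" using g j' by (simp add: nat_pow_pow ac_simps)
    then have s1: "g [^] (p ^ Suc s) \<in> Z" using mem_of_coprime_pow_p[OF Zs _ _ j'(2)] g by simp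
    have s2: "g [^] (p ^ s) \<notin> Z"
    proof
      assume "g [^] (p ^ s) \<in> Z"
      then have "(g [^] (p ^ s)) [^] j' \<in> Z" using subgroup_pow_closed[OF Zs] by blast
      then show False using jZ g j' by (simp add: nat_pow_pow)
    qed
    have mono: "g [^] (p ^ b) \<in> Z" if "g [^] (p ^ a) \<in> Z" "a \<le> b" for a b
    proof -
      have "(g [^] (p ^ a)) [^] (p ^ (b - a)) \<in> Z" using that subgroup_pow_closed[OF Zs] by blast
      then show ?thesis using that g by (simp add: nat_pow_pow flip: power_add)
    qed
    have "s = k" using k s1 s2 mono by (metis Suc_leI linorder_neqE_nat)
    then have "g [^] j = (g [^] (p ^ k)) [^] j'" using g j' by (simp add: nat_pow_pow)
    moreover have "?w \<otimes> inv z \<in> C u"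
    proof (rule subgroup.m_closed[OF subgroup_C[OF u(1)]])
      show "?w \<in> C u" using u(1) by (simp add: mem_centralizer_singleton group_commutes_pow)
      show "inv z \<in> C u" using subgroup.m_inv_closed[OF Zs z(1)] center_subset_C[OF u(1)] by blast
    qed
    ultimately have "(g [^] (p ^ k)) [^] j' \<in> C u" using gj by simp
    then have "g [^] (p ^ k) \<in> C u" using mem_of_coprime_pow_p[OF subgroup_C[OF u(1)] _ _ j'(2)] g by simp
    then show False using u by (auto simp: mem_centralizer_singleton)
  qed
  then show thesis using that[of ?w] u l by (simp add: nat_pow_pow mult.commute)
qed

text \<open>If everything linked to \<open>g\<close> commuted with \<open>w\<close>, then so would
  all of \<open>C (g [^] p)\<close>, and the double centralizer property would put \<open>w\<close>
  into \<open>adjoin G (g [^] p) Z\<close>.\<close>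

lemma exists_link_avoiding:
  assumes g: "g \<in> carrier G" "g \<notin> Z" and w: "w \<in> carrier G" "w \<notin> adjoin G (g [^] p) Z"
  obtains b where "linked G p g b" "b \<otimes> w \<noteq> w \<otimes> b"
proof (rule ccontr)
  assume nt: "\<not> thesis"
  have contra: "b \<otimes> w = w \<otimes> b" if "linked G p g b" for b
    using nt \<open>\<And>b. \<lbrakk>linked G p g b; b \<otimes> w \<noteq> w \<otimes> b\<rbrakk> \<Longrightarrow> thesis\<close> that by blast
  have no: "b \<in> C w" if "b \<in> C (g [^] p)" "b \<notin> C g" for b
    using contra[of b] that g w by (auto simp: linked_def mem_centralizer_singleton)
  have gp: "g [^] p \<in> carrier G" using g by simp
  \<comment> \<open>Equality of the two centralizers would, after centralizing once more, put
    \<open>g\<close> into \<open>adjoin G (g [^] p) Z\<close>.\<close>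
  have "\<exists>b. b \<in> C (g [^] p) \<and> b \<notin> C g"
  proof (rule ccontr)
    assume "\<nexists>b. b \<in> C (g [^] p) \<and> b \<notin> C g"
    then have "C (g [^] p) \<subseteq> C g" by blast
    then have "centralizer G (C g) \<subseteq> centralizer G (C (g [^] p))" by (rule centralizer_antimono)
    then show False
      using not_mem_adjoin_pow[OF subgroup_group_center center_subset_C[OF g(1)] g] mem_adjoin[OF subgroup.one_closed[OF subgroup_group_center] g(1)]
      by (auto simp: centralizer_C[OF g(1)] centralizer_C[OF gp])
  qed
  then obtain b where b: "b \<in> C (g [^] p)" "b \<notin> C g" by blast
  have "x \<in> C w" if x: "x \<in> C (g [^] p)" for x
  proof (cases "x \<in> C g")
    case True
    have xc: "x \<in> carrier G" "b \<in> carrier G" using x b by (auto simp: mem_centralizer_singleton)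
    \<comment> \<open>The elements outside \<open>C g\<close> generate: \<open>x\<close> is the
      quotient of \<open>b x\<close> and \<open>b\<close>, both outside.\<close>
    have "b \<otimes> x \<notin> C g"
    proof
      assume "b \<otimes> x \<in> C g"
      then have "b \<otimes> x \<otimes> inv x \<in> C g"
        using True subgroup.m_closed[OF subgroup_C[OF g(1)]] subgroup.m_inv_closed[OF subgroup_C[OF g(1)]]
        by blast
      then show False using b xc by (simp add: m_assoc)
    qed
    moreover have "b \<otimes> x \<in> C (g [^] p)" using b x subgroup.m_closed[OF subgroup_C[OF gp]] by blast
    ultimately have "b \<otimes> x \<in> C w" "b \<in> C w" using no b by auto
    then have "inv b \<otimes> (b \<otimes> x) \<in> C w"
      using subgroup.m_closed[OF subgroup_C[OF w(1)]] subgroup.m_inv_closed[OF subgroup_C[OF w(1)]] by blast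
    then show ?thesis using xc by simp
  qed (use x no in blast)
  then have "w \<in> centralizer G (C (g [^] p))" using w by (auto simp: centralizer_def)
  then show False using w by (simp add: centralizer_C[OF gp])
qed

text \<open>Everything that does not commute with a noncentral \<open>e\<close> whose
  \<open>p\<close>-th power is central is linked to \<open>e\<close>; \<open>c\<close> is one of its
  commutators. A vertex is \<open>good\<close> if its commutators along links are in the group of
  \<open>c\<close>. One such link suffices, goodness passes along links, and every noncentral
  element is connected to \<open>e\<close>.\<close>

theorem exists_central_commutator:
  assumes na: "Z \<noteq> carrier G"
  obtains c x y where "x \<in> carrier G" "y \<in> carrier G" "c = commutator G x y" "c \<in> Z" "c \<noteq> \<one>" "c [^] p = \<one>"
    "\<And>b g. b \<in> carrier G \<Longrightarrow> g \<in> carrier G \<Longrightarrow> b [^] p \<otimes> g = g \<otimes> b [^] p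
       \<Longrightarrow> commutator G g b \<in> generate G {c}"
proof -
  note Zs = subgroup_group_center
  obtain x where x: "x \<in> carrier G" "x \<notin> Z" using na subgroup.subset[OF Zs] by blast
  obtain k where k: "x [^] (p ^ k) \<notin> Z" "x [^] (p ^ Suc k) \<in> Z" using last_power[OF Zs x] by blast
  define e where "e = x [^] (p ^ k)"
  have e: "e \<in> carrier G" "e \<notin> Z" "e [^] p \<in> Z"
    using k x by (auto simp: e_def nat_pow_pow mult.commute)
  have link_e: "linked G p e' g"
    if "e' \<in> carrier G" "e' [^] p \<in> Z" "g \<in> carrier G" "e' \<otimes> g \<noteq> g \<otimes> e'" for e' g
    using that center_commute by (simp add: linked_def)
  obtain y where y: "y \<in> carrier G" "e \<otimes> y \<noteq> y \<otimes> e" using e by (auto simp: group_center_def)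
  define c where "c = commutator G y e"
  have cc: "c \<in> carrier G" using e y by (simp add: c_def)
  note ly = link_e[OF e(1,3) y]
  have c1: "c \<noteq> \<one>" using commutator_eq_one_iff[OF y(1) e(1)] y by (simp add: c_def)
  \<comment> \<open>The commutator \<open>c\<close> is also a power of \<open>[h, e]\<close>, and
    the latter commutes with \<open>h\<close>.\<close>
  have c_comm: "c \<otimes> h = h \<otimes> c" if h: "h \<in> carrier G" "e \<otimes> h \<noteq> h \<otimes> e" for h
  proof -
    note lh = link_e[OF e(1,3) h]
    obtain i :: nat where "c = commutator G h e [^] i"
      using linked_commutator(4)[OF lh y(1)] ly by (auto simp: linked_def c_def)
    then show ?thesis using group_commutes_pow[OF linked_commutator(2)[OF lh]] e h by simp
  qed
  have cZ: "c \<in> Z"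
  proof -
    have "h \<in> C c" if h: "h \<in> carrier G" for h
    proof (cases "e \<otimes> h = h \<otimes> e")
      case True
      \<comment> \<open>For \<open>h\<close> in \<open>C e\<close> the product \<open>y h\<close>
        lies outside, where \<open>c_comm\<close> applies.\<close>
      have "e \<otimes> (y \<otimes> h) \<noteq> y \<otimes> h \<otimes> e"
      proof
        assume "e \<otimes> (y \<otimes> h) = y \<otimes> h \<otimes> e"
        then have "e \<otimes> y \<otimes> h = y \<otimes> e \<otimes> h" using e y h True by (simp add: m_assoc)
        then show False using e y h by simp
      qed
      then have "y \<otimes> h \<in> C c" "y \<in> C c" using c_comm y h by (auto simp: mem_centralizer_singleton)
      then have "inv y \<otimes> (y \<otimes> h) \<in> C c"
        using subgroup.m_closed[OF subgroup_C[OF cc]] subgroup.m_inv_closed[OF subgroup_C[OF cc]] by blast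
      then show ?thesis using y h by simp
    qed (use c_comm h in \<open>auto simp: mem_centralizer_singleton\<close>)
    then show ?thesis using cc by (auto simp: group_center_def mem_centralizer_singleton)
  qed
  let ?P = "generate G {c}"
  have P: "subgroup ?P G" using cc by (intro generate_is_subgroup) auto
  have cP: "c \<in> ?P" by (simp add: generate.incl)
  define good where "good b \<longleftrightarrow> (\<forall>g. linked G p b g \<longrightarrow> commutator G g b \<in> ?P)" for b
  have goodI: "good b" if l: "linked G p b g" and cm: "commutator G g b \<in> ?P" for b g
    unfolding good_def
  proof (intro allI impI)
    fix g' assume "linked G p b g'"
    then obtain i :: nat where "commutator G g' b = commutator G g b [^] i"
      using linked_commutator(4)[OF l, of g'] by (auto simp: linked_def)
    then show "commutator G g' b \<in> ?P" using cm subgroup_pow_closed[OF P] by simp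
  qed
  have good_link: "good g" if "linked G p b g" "good b" for b g
  proof (rule goodI[OF linked_sym[OF that(1)]])
    have "commutator G g b \<in> ?P" using that by (simp add: good_def)
    then have "inv (commutator G g b) \<in> ?P" using subgroup.m_inv_closed[OF P] by blast
    then show "commutator G b g \<in> ?P" using that(1) by (simp add: inv_commutator linked_def)
  qed
  have good_e: "good e" using goodI[OF ly] cP by (simp add: c_def)
  \<comment> \<open>Some \<open>g\<close> avoids both proper subgroups \<open>C e\<close> and
    \<open>C e'\<close>, hence is linked to \<open>e\<close> and to \<open>e'\<close>.\<close>
  have good_E: "good e'" if e': "e' \<in> carrier G" "e' \<notin> Z" "e' [^] p \<in> Z" for e'
  proof -
    obtain y' where y': "y' \<in> carrier G" "y' \<notin> C e'"
      using e' by (auto simp: group_center_def mem_centralizer_singleton)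
    obtain g where "g \<in> carrier G" "g \<notin> C e" "g \<notin> C e'"
      using not_covered_by_two_subgroups[OF subgroup_C[OF e(1)] subgroup_C[OF e'(1)] y(1) _ y'] y
      by (auto simp: mem_centralizer_singleton)
    then have l: "linked G p e g" "linked G p e' g"
      using link_e e e' by (auto simp: mem_centralizer_singleton)
    show ?thesis using good_link[OF linked_sym[OF l(2)] good_link[OF l(1) good_e]] .
  qed
  \<comment> \<open>The path is \<open>g\<close>, \<open>b\<close>, \<open>w\<close>: as
    \<open>w\<close> has a central \<open>p\<close>-th power, any \<open>b\<close> not commuting
    with \<open>w\<close> is linked to it.\<close>
  have good_all: "good g" if g: "g \<in> carrier G" "g \<notin> Z" for g
  proof -
    obtain w where w: "w \<in> carrier G" "w \<notin> Z" "w [^] p \<in> Z" "w \<notin> adjoin G (g [^] p) Z"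
      using exists_linking_element[OF g] by blast
    obtain b where b: "linked G p g b" "b \<otimes> w \<noteq> w \<otimes> b" using exists_link_avoiding[OF g w(1,4)] by blast
    have "linked G p w b" using link_e[OF w(1,3)] b by (auto simp: linked_def)
    then have "good b" using good_link good_E[OF w(1-3)] by blast
    then show "good g" using good_link[OF linked_sym[OF b(1)]] by blast
  qed
  have "commutator G g b \<in> ?P"
    if bg: "b \<in> carrier G" "g \<in> carrier G" "b [^] p \<otimes> g = g \<otimes> b [^] p" for b g
  proof (cases "b \<otimes> g = g \<otimes> b")
    case True
    then show ?thesis using bg commutator_eq_one_iff[of g b] subgroup.one_closed[OF P] by simp
  next
    case False
    then have "linked G p b g" "b \<notin> Z" using bg center_commute by (auto simp: linked_def)
    then show ?thesis using good_all bg by (simp add: good_def)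
  qed
  moreover have "c [^] p = \<one>" using linked_commutator(3)[OF ly] by (simp add: c_def)
  ultimately show thesis using that[of y e c] y e cZ c1 by (simp add: c_def)
qed

end

end

section \<open>Central quotients and chains of subgroups\<close>

context group
begin

lemma pow_mod_of_pow_eq_one:
  "c \<in> carrier G \<Longrightarrow> c [^] (m::nat) = \<one> \<Longrightarrow> c [^] (a mod m) = c [^] a"
proof -
  assume c: "c \<in> carrier G" "c [^] m = \<one>"
  have "c [^] a = c [^] (m * (a div m) + a mod m)" by simp
  also have "\<dots> = (c [^] m) [^] (a div m) \<otimes> c [^] (a mod m)"
    using c(1) by (simp only: nat_pow_mult nat_pow_pow nat_pow_closed)
  finally show ?thesis using c by simp
qed

lemma pow_eq_of_cong:
  assumes "c \<in> carrier G" "c [^] (m::nat) = \<one>" "[a = b] (mod m)"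
  shows "c [^] a = c [^] b"
  using pow_mod_of_pow_eq_one[OF assms(1,2), of a] pow_mod_of_pow_eq_one[OF assms(1,2), of b] assms(3)
  by (simp add: cong_def)

lemma commute_iff_commutator_hom:
  assumes "group_hom G Q f" "x \<in> carrier G" "y \<in> carrier G"
  shows "f x \<otimes>\<^bsub>Q\<^esub> f y = f y \<otimes>\<^bsub>Q\<^esub> f x \<longleftrightarrow> f (commutator G x y) = \<one>\<^bsub>Q\<^esub>"
proof -
  interpret f: group_hom G Q f by fact
  have "f (commutator G x y) = commutator Q (f x) (f y)"
    using assms(2,3) by (simp add: commutator_def)
  then show ?thesis using f.H.commutator_eq_one_iff[of "f x" "f y"] assms(2,3) by simp
qed

end

lemma (in group_hom) hom_commutator:
  "x \<in> carrier G \<Longrightarrow> y \<in> carrier G \<Longrightarrow> h (commutator G x y) = commutator H (h x) (h y)"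
  by (simp add: commutator_def)

context finite_group
begin

lemma mem_generate_singleton:
  "a \<in> carrier G \<Longrightarrow> x \<in> generate G {a} \<longleftrightarrow> (\<exists>i::nat. x = a [^] i)"
  using generate_pow_on_finite_carrier[OF finite_carrier] by auto

text \<open>The quotient is realised on a set of coset representatives, so that it lives on the
  same type as \<open>G\<close> and the order of the group can be used for an induction.\<close>

lemma exists_quotient:
  assumes P: "subgroup P G" and PZ: "P \<subseteq> group_center G"
  obtains Q :: "('a, 'b) monoid_scheme" and f where "group_hom G Q f" "f ` carrier G = carrier Q"
    "\<And>x. x \<in> carrier G \<Longrightarrow> f x = \<one>\<^bsub>Q\<^esub> \<longleftrightarrow> x \<in> P"
proof -
  have Pc: "P \<subseteq> carrier G" by (rule subgroup.subset[OF P])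
  have Pn: "P \<lhd> G"
  proof (rule normal_invI[OF P])
    fix x h assume x: "x \<in> carrier G" and h: "h \<in> P"
    have "h \<in> carrier G" "x \<otimes> h = h \<otimes> x" using x h PZ Pc by (auto simp: group_center_def)
    then show "x \<otimes> h \<otimes> inv x \<in> P" using conj_commuting[OF x] h by simp
  qed
  interpret P: normal P G by (rule Pn)
  define f where "f x = (SOME y. y \<in> P #> x)" for x
  have fin: "f x \<in> P #> x" if "x \<in> carrier G" for x
    unfolding f_def using rcos_self[OF that P] by (rule someI)
  have fc: "f x \<in> carrier G" if "x \<in> carrier G" for x
    using fin[OF that] r_coset_subset_G[OF Pc that] by blast
  have coset: "P #> f x = P #> x" if "x \<in> carrier G" for x
    using repr_independence[OF fin[OF that] that P] by simp
  have f_eq: "f x = f y \<longleftrightarrow> P #> x = P #> y" if "x \<in> carrier G" "y \<in> carrier G" for x y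
    using coset that unfolding f_def by metis
  define Q where "Q = G\<lparr>carrier := f ` carrier G, monoid.mult := \<lambda>x y. f (x \<otimes> y), one := f \<one>\<rparr>"
  have hom: "f (f x \<otimes> f y) = f (x \<otimes> y)" if "x \<in> carrier G" "y \<in> carrier G" for x y
    using that fc coset by (subst f_eq) (auto simp flip: P.rcos_sum)
  have grp: "group Q"
  proof (rule groupI)
    fix x y assume "x \<in> carrier Q" "y \<in> carrier Q"
    then show "x \<otimes>\<^bsub>Q\<^esub> y \<in> carrier Q" using fc by (auto simp: Q_def)
  next
    fix x y z assume "x \<in> carrier Q" "y \<in> carrier Q" "z \<in> carrier Q"
    then obtain a b c where "a \<in> carrier G" "b \<in> carrier G" "c \<in> carrier G" "x = f a" "y = f b" "z = f c"
      by (auto simp: Q_def)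
    then show "(x \<otimes>\<^bsub>Q\<^esub> y) \<otimes>\<^bsub>Q\<^esub> z = x \<otimes>\<^bsub>Q\<^esub> (y \<otimes>\<^bsub>Q\<^esub> z)"
      by (simp add: Q_def hom m_assoc)
  next
    fix x assume "x \<in> carrier Q"
    then obtain a where a: "a \<in> carrier G" "x = f a" by (auto simp: Q_def)
    then show "\<one>\<^bsub>Q\<^esub> \<otimes>\<^bsub>Q\<^esub> x = x" by (simp add: Q_def hom)
    have "f (inv a) \<otimes>\<^bsub>Q\<^esub> x = \<one>\<^bsub>Q\<^esub>" using a by (simp add: Q_def hom)
    then show "\<exists>y\<in>carrier Q. y \<otimes>\<^bsub>Q\<^esub> x = \<one>\<^bsub>Q\<^esub>" using a by (force simp: Q_def)
  qed (simp add: Q_def)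
  have gh: "group_hom G Q f"
    by (intro group_hom.intro group_hom_axioms.intro is_group grp) (auto simp: hom_def Q_def hom)
  have "f x = \<one>\<^bsub>Q\<^esub> \<longleftrightarrow> x \<in> P" if x: "x \<in> carrier G" for x
  proof -
    have "f x = \<one>\<^bsub>Q\<^esub> \<longleftrightarrow> P #> x = P #> \<one>" using f_eq[OF x one_closed] by (simp add: Q_def)
    also have "\<dots> \<longleftrightarrow> P #> x = P" using Pc by simp
    also have "\<dots> \<longleftrightarrow> x \<in> P" using x P coset_join1 coset_join2 rcos_self by metis
    finally show ?thesis .
  qed
  with gh show thesis using that by (simp add: Q_def)
qed

lemma card_preimage:
  assumes f: "group_hom G Q f" and img: "f ` carrier G = carrier Q"
    and ker: "\<And>x. x \<in> carrier G \<Longrightarrow> f x = \<one>\<^bsub>Q\<^esub> \<longleftrightarrow> x \<in> P" and P: "P \<subseteq> carrier G"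
    and B: "B \<subseteq> carrier Q"
  shows "card {x \<in> carrier G. f x \<in> B} = card P * card B"
proof -
  interpret f: group_hom G Q f by fact
  let ?A = "{x \<in> carrier G. f x \<in> B}"
  have fib: "card {x \<in> ?A. f x = b} = card P" if b: "b \<in> B" for b
  proof -
    obtain a where a: "a \<in> carrier G" "f a = b" using b B img by (metis imageE subsetD)
    have "{x \<in> ?A. f x = b} = (\<lambda>u. u \<otimes> a) ` P"
    proof
      show "(\<lambda>u. u \<otimes> a) ` P \<subseteq> {x \<in> ?A. f x = b}"
      proof
        fix x assume "x \<in> (\<lambda>u. u \<otimes> a) ` P"
        then obtain u where u: "u \<in> P" "x = u \<otimes> a" by blast
        then have "u \<in> carrier G" "f u = \<one>\<^bsub>Q\<^esub>" using P ker[of u] by auto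
        then have "f x = b" using u a f.hom_closed[of a] by simp
        then show "x \<in> {x \<in> ?A. f x = b}" using u a b P by auto
      qed
      show "{x \<in> ?A. f x = b} \<subseteq> (\<lambda>u. u \<otimes> a) ` P"
      proof
        fix x assume "x \<in> {x \<in> ?A. f x = b}"
        then have x: "x \<in> carrier G" "f x = f a" using a by auto
        then have "f (x \<otimes> inv a) = \<one>\<^bsub>Q\<^esub>" using a f.hom_closed[of a] by simp
        then have "x \<otimes> inv a \<in> P" using ker[THEN iffD1, of "x \<otimes> inv a"] x a by blast
        moreover have "x = (x \<otimes> inv a) \<otimes> a" using x a by (simp add: m_assoc)
        ultimately show "x \<in> (\<lambda>u. u \<otimes> a) ` P" by blast
      qed
    qed
    moreover have "inj_on (\<lambda>u. u \<otimes> a) P" using a P by (auto simp: inj_on_def subset_iff)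
    ultimately show ?thesis by (simp add: card_image)
  qed
  have "f ` ?A = B" using B img by auto
  then have "(\<Sum>x\<in>?A. 1) = (\<Sum>b\<in>B. \<Sum>x\<in>{x \<in> ?A. f x = b}. (1::nat))"
    using sum.image_gen[of ?A "\<lambda>_. 1::nat" f] finite_carrier by simp
  also have "\<dots> = (\<Sum>b\<in>B. card P)" by (rule sum.cong) (use fib in auto)
  finally show ?thesis by simp
qed

text \<open>\<open>R H\<close> is the preimage of the centralizer of the image of \<open>H\<close>,
  and \<open>R (carrier G)\<close> is that of the center of \<open>Q\<close>. So \<open>rel\<close>
  is balance of \<open>Q\<close> pulled back to \<open>G\<close>, with both sides multiplied by the
  square of |P|.\<close>

lemma balanced_quotient:
  assumes f: "group_hom G Q f" and img: "f ` carrier G = carrier Q"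
    and ker: "\<And>x. x \<in> carrier G \<Longrightarrow> f x = \<one>\<^bsub>Q\<^esub> \<longleftrightarrow> x \<in> P" and P: "subgroup P G"
    and R_def: "\<And>H. R H = {x \<in> carrier G. \<forall>h\<in>H. commutator G x h \<in> P}"
    and rel: "\<And>H. subgroup H G \<Longrightarrow> R (carrier G) \<subseteq> H
      \<Longrightarrow> card H * card (R H) = order G * card (R (carrier G))"
  shows "balanced Q"
  unfolding balanced_def
proof
  interpret f: group_hom G Q f by fact
  note Pc = subgroup.subset[OF P]
  have cp: "card {x \<in> carrier G. f x \<in> B} = card P * card B" if "B \<subseteq> carrier Q" for B
    by (rule card_preimage[OF f img ker Pc that])
  fix H assume "H \<in> center_interval Q"
  then have H: "subgroup H Q" "group_center Q \<subseteq> H" by (auto simp: center_interval_def)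
  have Hc: "H \<subseteq> carrier Q" by (rule subgroup.subset[OF H(1)])
  have comm: "f x \<otimes>\<^bsub>Q\<^esub> f y = f y \<otimes>\<^bsub>Q\<^esub> f x \<longleftrightarrow> commutator G x y \<in> P"
    if "x \<in> carrier G" "y \<in> carrier G" for x y
    using commute_iff_commutator_hom[OF f that] ker that by simp
  let ?H = "{x \<in> carrier G. f x \<in> H}"
  have sub: "subgroup ?H G"
    using H(1) by (intro finite_subgroupI) (auto simp: subgroup.one_closed subgroup.m_closed)
  have R: "R {x \<in> carrier G. f x \<in> B} = {x \<in> carrier G. f x \<in> centralizer Q B}" if "B \<subseteq> carrier Q" for B
  proof -
    have "(\<forall>h\<in>{x \<in> carrier G. f x \<in> B}. commutator G x h \<in> P) \<longleftrightarrow> (\<forall>b\<in>B. f x \<otimes>\<^bsub>Q\<^esub> b = b \<otimes>\<^bsub>Q\<^esub> f x)"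
      if x: "x \<in> carrier G" for x
    proof -
      have "(\<forall>h\<in>{x \<in> carrier G. f x \<in> B}. commutator G x h \<in> P)
          \<longleftrightarrow> (\<forall>h\<in>{x \<in> carrier G. f x \<in> B}. f x \<otimes>\<^bsub>Q\<^esub> f h = f h \<otimes>\<^bsub>Q\<^esub> f x)"
        using comm x by auto
      also have "\<dots> \<longleftrightarrow> (\<forall>b\<in>f ` {x \<in> carrier G. f x \<in> B}. f x \<otimes>\<^bsub>Q\<^esub> b = b \<otimes>\<^bsub>Q\<^esub> f x)" by blast
      also have "f ` {x \<in> carrier G. f x \<in> B} = B" using \<open>B \<subseteq> carrier Q\<close> img by auto
      finally show ?thesis .
    qed
    then show ?thesis unfolding R_def by (auto simp: centralizer_def)
  qed
  have RG: "R (carrier G) = {x \<in> carrier G. f x \<in> group_center Q}"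
  proof -
    have "carrier G = {x \<in> carrier G. f x \<in> carrier Q}" by auto
    then have "R (carrier G) = R {x \<in> carrier G. f x \<in> carrier Q}" by simp
    also have "\<dots> = {x \<in> carrier G. f x \<in> centralizer Q (carrier Q)}" by (rule R) simp
    finally show ?thesis by (simp add: group_center_eq)
  qed
  have oG: "order G = card P * order Q"
  proof -
    have "{x \<in> carrier G. f x \<in> carrier Q} = carrier G" by auto
    then show ?thesis using cp[of "carrier Q"] by (simp add: order_def)
  qed
  have "card ?H * card (R ?H) = order G * card (R (carrier G))"
    by (rule rel[OF sub]) (use H RG in auto)
  then have "(card P * card H) * (card P * card (centralizer Q H))
      = (card P * order Q) * (card P * card (group_center Q))"
    unfolding R[OF Hc] RG oG
    using cp[OF Hc] cp[OF centralizer_subset] cp[OF subgroup.subset[OF f.H.subgroup_group_center]]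
    by simp
  then have "(card P * card P) * (card H * card (centralizer Q H))
      = (card P * card P) * (order Q * card (group_center Q))"
    by (simp only: ac_simps)
  then show "CD_measure Q H = order Q * card (group_center Q)"
    using card_subgroup_pos[OF P] by (simp add: CD_measure_def)
qed

end

context prime_power_group
begin

text \<open>Adjoining the last power of an element outside \<open>K\<close> multiplies |K| by at
  least \<open>p\<close>, while \<open>step\<close> divides \<open>f\<close> by at most
  \<open>p\<close>. With \<open>f\<close> the order of the centralizer the product is the measure;
  \<open>E\<close> is the bottom of the interval.\<close>

lemma chain_mono:
  fixes f :: "'a set \<Rightarrow> nat"
  assumes step: "\<And>K h. subgroup K G \<Longrightarrow> E \<subseteq> K \<Longrightarrow> h \<in> carrier G \<Longrightarrow> h \<notin> K \<Longrightarrow> h [^] p \<in> K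
      \<Longrightarrow> f K \<le> p * f (generate G (insert h K))"
    and "subgroup K G" "E \<subseteq> K" "K \<subseteq> H" and H: "subgroup H G"
  shows "f K * card K \<le> f H * card H"
  using assms(2-4)
proof (induct "card H - card K" arbitrary: K rule: less_induct)
  case less
  show ?case
  proof (cases "K = H")
    case False
    note Hc = subgroup.subset[OF H]
    obtain h0 where h0: "h0 \<in> H" "h0 \<notin> K" using False less.prems by blast
    then obtain k where k: "h0 [^] (p ^ k) \<notin> K" "h0 [^] (p ^ Suc k) \<in> K"
      using last_power[OF less.prems(1)] Hc by blast
    define h where "h = h0 [^] (p ^ k)"
    have h: "h \<in> H" "h \<notin> K" "h [^] p \<in> K"
      using k h0 Hc subgroup_pow_closed[OF H] by (auto simp: h_def nat_pow_pow mult.commute subset_iff)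
    let ?K = "generate G (insert h K)"
    have KH: "?K \<subseteq> H" using h less.prems by (intro generate_subgroup_incl H) auto
    have sK: "subgroup ?K G" using h Hc less.prems by (intro generate_is_subgroup) auto
    have KK: "K \<subseteq> ?K" "h \<in> ?K" by (auto intro: generate.incl)
    have c: "p * card K \<le> card ?K" by (rule card_le_of_not_mem(1)[OF less.prems(1) sK KK h(2)])
    have "K \<subset> ?K" using KK h by blast
    then have "card K < card ?K" using psubset_card_mono finite_subgroup[OF sK] by blast
    moreover have "card ?K \<le> card H" using card_mono[OF finite_subgroup[OF H] KH] .
    ultimately have "f ?K * card ?K \<le> f H * card H"
      using less.hyps[OF _ sK _ KH] KK less.prems by auto
    moreover have "f K * card K \<le> f ?K * card ?K"
    proof -
      have "f K * card K \<le> (p * f ?K) * card K"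
        using step[OF less.prems(1,2) _ h(2,3)] h(1) Hc by (intro mult_le_mono1) blast
      also have "\<dots> = f ?K * (p * card K)" by simp
      also have "\<dots> \<le> f ?K * card ?K" by (rule mult_le_mono2[OF c])
      finally show ?thesis .
    qed
    ultimately show ?thesis by linarith
  qed simp
qed

text \<open>Modulo \<open>P\<close>, conjugation by \<open>y\<close> raises \<open>t\<close> to the
  power \<open>r\<close>. After \<open>p^n\<close> rounds it is the identity, and
  \<open>disj\<close> kills the factor from \<open>P\<close>, so \<open>r^(p^n)\<close> is 1 modulo
  \<open>ord t\<close>, hence modulo \<open>p\<close>. By Fermat it is also \<open>r\<close> modulo
  \<open>p\<close>.\<close>

lemma conj_exponent_cong:
  assumes P: "subgroup P G" "P \<subseteq> Z" and disj: "P \<inter> generate G {t} = {\<one>}"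
    and y: "y \<in> carrier G" and t: "t \<in> carrier G" "t \<noteq> \<one>"
    and conj: "y \<otimes> t \<otimes> inv y = t [^] (r::nat) \<otimes> z" and z: "z \<in> P"
  shows "[r = 1] (mod p)"
proof -
  have Pc: "P \<subseteq> carrier G" by (rule subgroup.subset[OF P(1)])
  have zc: "z \<in> carrier G" using z Pc by blast
  have ex: "\<exists>u\<in>P. y [^] j \<otimes> t \<otimes> inv (y [^] j) = t [^] (r ^ j) \<otimes> u" for j :: nat
  proof (induct j)
    case 0
    show ?case using t subgroup.one_closed[OF P(1)] by (intro bexI[of _ \<one>]) auto
  next
    case (Suc j)
    then obtain u where u: "u \<in> P" "y [^] j \<otimes> t \<otimes> inv (y [^] j) = t [^] (r ^ j) \<otimes> u" by blast
    have uc: "u \<in> carrier G" "y \<otimes> u = u \<otimes> y" using u P Pc y by (auto simp: group_center_def)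
    have tz: "t [^] r \<otimes> z = z \<otimes> t [^] r" using z P center_commute[of z "t [^] r"] t by auto
    have "y [^] Suc j \<otimes> t \<otimes> inv (y [^] Suc j) = y \<otimes> (t [^] (r ^ j) \<otimes> u) \<otimes> inv y"
      using y t u(2) by (simp only: nat_pow_Suc2 conj_conj nat_pow_closed)
    also have "\<dots> = (y \<otimes> t [^] (r ^ j) \<otimes> inv y) \<otimes> u"
      using conj_commuting[OF y uc] y t uc by (simp add: conj_mult)
    also have "y \<otimes> t [^] (r ^ j) \<otimes> inv y = (t [^] r \<otimes> z) [^] (r ^ j)"
      using conj_pow[OF y t(1)] conj by simp
    also have "\<dots> = t [^] (r ^ Suc j) \<otimes> z [^] (r ^ j)"
      using pow_mult_distrib[OF tz] t zc by (simp add: nat_pow_pow)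
    finally have "y [^] Suc j \<otimes> t \<otimes> inv (y [^] Suc j) = t [^] (r ^ Suc j) \<otimes> (z [^] (r ^ j) \<otimes> u)"
      using t zc uc by (simp add: m_assoc)
    moreover have "z [^] (r ^ j) \<otimes> u \<in> P"
      using z u subgroup_pow_closed[OF P(1)] subgroup.m_closed[OF P(1)] by blast
    ultimately show ?case by blast
  qed
  obtain u where u: "u \<in> P" "t = t [^] (r ^ (p ^ n)) \<otimes> u"
    using ex[of "p ^ n"] pow_order_eq_1[OF y] t y by (auto simp: order_eq)
  have T: "subgroup (generate G {t}) G" using t by (intro generate_is_subgroup) auto
  have uc: "u \<in> carrier G" using u Pc by blast
  have "u = inv (t [^] (r ^ (p ^ n))) \<otimes> t" using u(2) uc t by (metis inv_solve_left nat_pow_closed)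
  moreover have "t \<in> generate G {t}" by (simp add: generate.incl)
  ultimately have "u \<in> generate G {t}"
    using subgroup_pow_closed[OF T] subgroup.m_closed[OF T] subgroup.m_inv_closed[OF T] by metis
  then have "u = \<one>" using u disj by blast
  then have "t [^] (r ^ (p ^ n)) = t" using u t by simp
  then have "t [^] (int (r ^ (p ^ n))) = t [^] (1::int)" using t by (simp only: int_pow_int int_pow_1)
  then have "int (ord t) dvd 1 - int (r ^ (p ^ n))" using int_pow_eq[OF t(1)] by blast
  moreover have "p dvd ord t"
  proof -
    have "ord t dvd p ^ n" using ord_dvd_group_order[OF t(1)] by (simp add: order_eq)
    moreover have "ord t \<noteq> 1" using ord_eq_1[OF t(1)] t by simp
    ultimately show ?thesis using divides_primepow_nat[OF prime_p] by (metis dvd_power gr0I power_0)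
  qed
  ultimately have "int p dvd 1 - int (r ^ (p ^ n))" by (metis dvd_trans int_dvd_int_iff)
  then have "[int 1 = int (r ^ (p ^ n))] (mod int p)" by (simp add: cong_iff_dvd_diff)
  then have 1: "[r ^ (p ^ n) = 1] (mod p)" by (metis cong_int_iff cong_sym)
  have "[r ^ p = r] (mod p)"
  proof (cases "p dvd r")
    case True
    then have "p dvd r ^ p" using prime_gt_0_nat[OF prime_p] by (simp add: dvd_power_iff dvd_trans[OF True])
    then show ?thesis using True by (simp add: cong_def mod_eq_0_iff_dvd)
  next
    case False
    have "[r * r ^ (p - 1) = r * 1] (mod p)"
      using fermat_theorem[OF prime_p False] by (rule cong_scalar_left)
    then show ?thesis using prime_gt_0_nat[OF prime_p] by (simp add: power_eq_if[of r p])
  qed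
  then have "[r ^ (p ^ k) = r] (mod p)" for k
  proof (induct k)
    case (Suc k)
    have "r ^ (p ^ Suc k) = (r ^ (p ^ k)) ^ p" by (simp add: mult.commute flip: power_mult)
    then show ?case using cong_pow[OF Suc(1)[OF Suc(2)], of p] Suc(2) cong_trans by metis
  qed simp
  then show ?thesis using 1 cong_trans cong_sym by blast
qed

end

section \<open>Cyclicity of the derived subgroup\<close>

context prime_power_group
begin

text \<open>As \<open>P\<close> is central, \<open>[x, a b] = [x, a] [x, b]\<close> whenever
  \<open>[x, b]\<close> lies in \<open>P\<close>.\<close>

lemma subgroup_commutator_mem:
  assumes c: "subgroup P G" "P \<subseteq> Z" and x: "x \<in> carrier G"
  shows "subgroup {h \<in> carrier G. commutator G x h \<in> P} G"
proof (rule finite_subgroupI)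
  show "\<one> \<in> {h \<in> carrier G. commutator G x h \<in> P}"
    using commutator_eq_one_iff[OF x, of \<one>] x subgroup.one_closed[OF c(1)] by simp
  fix a b assume a: "a \<in> {h \<in> carrier G. commutator G x h \<in> P}"
    and b: "b \<in> {h \<in> carrier G. commutator G x h \<in> P}"
  then have "a \<otimes> commutator G x b \<otimes> inv a = commutator G x b"
    using x c by (intro conj_commuting) (auto simp: group_center_def)
  then show "a \<otimes> b \<in> {h \<in> carrier G. commutator G x h \<in> P}"
    using a b x subgroup.m_closed[OF c(1)] by (auto simp: commutator_mult_right)
qed auto

section \<open>Passing to the quotient by the central subgroup \<open>P\<close> generated by
  \<open>c\<close>\<close>

context
  fixes c P
  assumes bal: "balanced G" and cZ: "c \<in> Z" and cp: "c [^] p = \<one>" and P_def: "P = generate G {c}"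
    and absorb: "\<And>b g. b \<in> carrier G \<Longrightarrow> g \<in> carrier G \<Longrightarrow> b [^] p \<otimes> g = g \<otimes> b [^] p
       \<Longrightarrow> commutator G g b \<in> P"
begin

lemma c_closed: "c \<in> carrier G"
  using cZ by (simp add: group_center_def)

lemma subgroup_P: "subgroup P G"
  using c_closed unfolding P_def by (intro generate_is_subgroup) auto

lemma P_central: "P \<subseteq> Z"
  using cZ unfolding P_def by (intro generate_subgroup_incl subgroup_group_center) auto

lemma mem_P: "x \<in> P \<longleftrightarrow> (\<exists>i::nat. x = c [^] i)"
  using mem_generate_singleton[OF c_closed] by (simp add: P_def)

lemma P_exponent: "x \<in> P \<Longrightarrow> x [^] p = \<one>"
  using c_closed cp by (auto simp: mem_P nat_pow_pow) (metis mult.commute nat_pow_one nat_pow_pow)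

text \<open>If \<open>[x, h]\<close> lies in \<open>P\<close>, it is central with trivial
  \<open>p\<close>-th power, so \<open>x h^p x^-1 = ([x, h] h)^p = h^p\<close>; the converse is
  \<open>absorb\<close>.\<close>

lemma commutator_mem_iff:
  assumes x: "x \<in> carrier G" and h: "h \<in> carrier G"
  shows "commutator G x h \<in> P \<longleftrightarrow> x \<otimes> h [^] p = h [^] p \<otimes> x"
proof
  assume m: "commutator G x h \<in> P"
  have "x \<otimes> h [^] p \<otimes> inv x = (commutator G x h \<otimes> h) [^] p"
    using x h by (simp only: conj_pow[symmetric] conj_eq_commutator)
  also have "\<dots> = commutator G x h [^] p \<otimes> h [^] p"
    using m P_central center_commute[of _ h] x h by (intro pow_mult_distrib) auto
  also have "\<dots> = h [^] p" using P_exponent[OF m] h by simp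
  finally show "x \<otimes> h [^] p = h [^] p \<otimes> x" using conj_eq_iff[OF x, of "h [^] p"] h by simp
qed (use absorb[OF h x] in simp)

text \<open>The chain argument for centralizers modulo \<open>P\<close>, from
  \<open>E = R (carrier G)\<close> up to \<open>G\<close>. As \<open>R E = G\<close>, both ends give
  |G| |E|.\<close>

lemma relatively_balanced:
  assumes R_def: "\<And>H. R H = {x \<in> carrier G. \<forall>h\<in>H. commutator G x h \<in> P}"
    and H: "subgroup H G" "R (carrier G) \<subseteq> H"
  shows "card H * card (R H) = order G * card (R (carrier G))"
proof -
  let ?E = "R (carrier G)"
  have R_eq: "R H = centralizer G ((\<lambda>h. h [^] p) ` H)" if "H \<subseteq> carrier G" for H
    using that commutator_mem_iff unfolding R_def centralizer_def by (auto simp: subset_iff)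
  have R_sub: "subgroup (R H) G" if "H \<subseteq> carrier G" for H
    unfolding R_eq[OF that] using that by (intro subgroup_centralizer) auto
  have E: "subgroup ?E G" by (rule R_sub) simp
  have step: "card (R K) \<le> p * card (R (generate G (insert h K)))"
    if K: "subgroup K G" and h: "h \<in> carrier G" "h [^] p \<in> K" for K h
  proof -
    have Kc: "K \<subseteq> carrier G" by (rule subgroup.subset[OF K])
    have hp: "h [^] p \<in> carrier G" using h by simp
    have "R K \<inter> C (h [^] p) \<subseteq> R (generate G (insert h K))"
    proof
      fix x assume x: "x \<in> R K \<inter> C (h [^] p)"
      then have xc: "x \<in> carrier G" by (simp add: mem_centralizer_singleton)
      have "insert h K \<subseteq> {h \<in> carrier G. commutator G x h \<in> P}"
        using x xc Kc h commutator_mem_iff[OF xc h(1)] by (auto simp: R_def mem_centralizer_singleton)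
      then have "generate G (insert h K) \<subseteq> {h \<in> carrier G. commutator G x h \<in> P}"
        by (intro generate_subgroup_incl subgroup_commutator_mem subgroup_P P_central xc)
      then show "x \<in> R (generate G (insert h K))" using xc by (auto simp: R_def)
    qed
    moreover have "subgroup (R (generate G (insert h K))) G"
      using Kc h by (intro R_sub generate_incl) auto
    ultimately have "card (R K \<inter> C (h [^] p)) \<le> card (R (generate G (insert h K)))"
      using card_mono finite_subgroup by blast
    \<comment> \<open>Since \<open>h [^] p\<close> lies in \<open>K\<close>, its own
      \<open>p\<close>-th power is centralized by \<open>R K\<close>. So \<open>R K\<close> lies in
      a centralizer in which \<open>C (h [^] p)\<close> has index at most \<open>p\<close>.\<close>
    moreover have "card (R K) \<le> p * card (R K \<inter> C (h [^] p))"
    proof (rule card_le_mult_card_Int[OF R_sub[OF Kc] subgroup_C[OF hp]])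
      show "subgroup (C ((h [^] p) [^] p)) G" using hp by (simp add: subgroup_C)
      show "R K \<subseteq> C ((h [^] p) [^] p)"
        unfolding R_eq[OF Kc] using h by (auto simp: centralizer_def)
    qed (use C_pow[OF hp] card_C_pow_le[OF bal hp] in auto)
    ultimately show ?thesis by (meson le_trans mult_le_mono2)
  qed
  have mono: "card (R K) * card K \<le> card (R L) * card L"
    if "subgroup K G" "?E \<subseteq> K" "K \<subseteq> L" "subgroup L G" for K L
    by (rule chain_mono[where E = ?E and f = "\<lambda>H. card (R H)"]) (use step that in auto)
  have RE: "R ?E = carrier G"
  proof -
    have "commutator G x e \<in> P" if "x \<in> carrier G" "e \<in> ?E" for x e
    proof -
      have "commutator G e x \<in> P" "e \<in> carrier G" using that by (auto simp: R_def)
      then show ?thesis using subgroup.m_inv_closed[OF subgroup_P, of "commutator G e x"] that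
        by (simp add: inv_commutator)
    qed
    then show ?thesis by (auto simp: R_def[of ?E])
  qed
  have "card (R ?E) * card ?E \<le> card (R H) * card H" using mono[OF E _ H(2,1)] by simp
  moreover have "card (R H) * card H \<le> card ?E * card (carrier G)"
    using mono[OF H subgroup.subset[OF H(1)] subgroup_self] by simp
  ultimately show ?thesis unfolding RE order_def by (simp add: mult.commute)
qed

text \<open>If \<open>c\<close> were outside \<open>T = generate G {t}\<close>, then
  \<open>P\<close> and \<open>T\<close> would meet trivially, and by \<open>not_normalizing\<close>
  no \<open>a\<close> with a nontrivial commutator \<open>[a, b]\<close> in \<open>T\<close> could
  normalize \<open>T\<close>. So \<open>y\<close> moves \<open>T\<close>, contributing a factor
  \<open>c^w\<close> with \<open>w\<close> prime to \<open>p\<close>; this allows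
  \<open>g y^j\<close> to normalize \<open>T\<close> for some \<open>j\<close>, although
  \<open>[g y^j, y] = t\<close>.\<close>

lemma commutators_cyclic_lift:
  assumes g: "g \<in> carrier G" and y: "y \<in> carrier G" and t_def: "t = commutator G g y"
    and all: "\<And>u v. u \<in> carrier G \<Longrightarrow> v \<in> carrier G
       \<Longrightarrow> \<exists>(i::nat) (j::nat). commutator G u v = t [^] i \<otimes> c [^] j"
    and t1: "t \<noteq> \<one>"
  shows "c \<in> generate G {t}"
proof (rule ccontr)
  assume cT: "c \<notin> generate G {t}"
  let ?T = "generate G {t}"
  have tc: "t \<in> carrier G" using g y by (simp add: t_def)
  have T: "subgroup ?T G" using tc by (intro generate_is_subgroup) auto
  have tT: "t \<in> ?T" by (simp add: generate.incl)
  have cpow: "c [^] a = c [^] b" if "[a = b] (mod p)" for a b :: nat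
    by (rule pow_eq_of_cong[OF c_closed cp that])
  have c_comm: "c [^] (a::nat) \<otimes> x = x \<otimes> c [^] a" if "x \<in> carrier G" for a x
    using group_commutes_pow[OF center_commute[OF cZ that] c_closed that] .
  have cjT: "p dvd j" if "c [^] (j::nat) \<in> ?T" for j
    using mem_of_coprime_pow_p[OF T c_closed that] cT by blast
  have disj: "P \<inter> ?T = {\<one>}"
  proof -
    have "x = \<one>" if x: "x \<in> P" "x \<in> ?T" for x
    proof -
      obtain j :: nat where j: "x = c [^] j" using x(1) mem_P by blast
      then have "[j = 0] (mod p)" using cjT x(2) by (simp add: cong_0_iff)
      then show ?thesis using cpow[of j 0] j by simp
    qed
    then show ?thesis using subgroup.one_closed[OF subgroup_P] subgroup.one_closed[OF T] by blast
  qed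
  \<comment> \<open>All \<open>[a^m, b]\<close> stay in \<open>T\<close>; at the last power of
    \<open>a\<close> outside \<open>C b\<close> the commutator also lies in \<open>P\<close> by
    \<open>absorb\<close>, so it is trivial.\<close>
  have not_normalizing: False
    if a: "a \<in> carrier G" and b: "b \<in> carrier G" and ab: "commutator G a b \<in> ?T" "a \<otimes> b \<noteq> b \<otimes> a"
      and norm: "a \<otimes> t \<otimes> inv a \<in> ?T" for a b
  proof -
    have normT: "a \<otimes> s \<otimes> inv a \<in> ?T" if s: "s \<in> ?T" for s
    proof -
      obtain i :: nat where "s = t [^] i" using s mem_generate_singleton[OF tc] by blast
      then show ?thesis using norm subgroup_pow_closed[OF T] conj_pow[OF a tc, of i] by metis
    qed
    have pow: "commutator G (a [^] m) b \<in> ?T" for m :: nat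
    proof (induct m)
      case 0
      show ?case using b subgroup.one_closed[OF T] by (simp add: commutator_def)
    next
      case (Suc m)
      let ?s = "commutator G (a [^] m) b"
      have sc: "?s \<in> carrier G" using a b by simp
      have "a [^] Suc m \<otimes> b \<otimes> inv (a [^] Suc m) = a \<otimes> (a [^] m \<otimes> b \<otimes> inv (a [^] m)) \<otimes> inv a"
        using a b by (simp only: nat_pow_Suc2 conj_conj nat_pow_closed)
      also have "a [^] m \<otimes> b \<otimes> inv (a [^] m) = ?s \<otimes> b" using a b by (simp only: conj_eq_commutator nat_pow_closed)
      also have "a \<otimes> (?s \<otimes> b) \<otimes> inv a = (a \<otimes> ?s \<otimes> inv a) \<otimes> (a \<otimes> b \<otimes> inv a)"
        using a b sc by (simp only: conj_mult)
      also have "\<dots> = (a \<otimes> ?s \<otimes> inv a) \<otimes> commutator G a b \<otimes> b"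
        unfolding conj_eq_commutator[OF a b] using a b sc by (simp add: m_assoc)
      finally have "commutator G (a [^] Suc m) b = (a \<otimes> ?s \<otimes> inv a) \<otimes> commutator G a b"
        using a b sc conj_eq_commutator[of "a [^] Suc m" b] right_cancel by (metis commutator_closed inv_closed m_closed nat_pow_closed)
      then show ?case using normT[OF Suc] ab(1) subgroup.m_closed[OF T] by simp
    qed
    have "a \<notin> C b" using ab by (simp add: mem_centralizer_singleton)
    then obtain k where k: "a [^] (p ^ k) \<notin> C b" "a [^] (p ^ Suc k) \<in> C b"
      using last_power[OF subgroup_C[OF b] a] by blast
    let ?d = "a [^] (p ^ k)"
    have d: "?d \<in> carrier G" "?d [^] p \<otimes> b = b \<otimes> ?d [^] p"
      using k a by (auto simp: mem_centralizer_singleton nat_pow_pow mult.commute)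
    have "inv (commutator G b ?d) \<in> P"
      using absorb[OF d(1) b d(2)] subgroup.m_inv_closed[OF subgroup_P] by blast
    then have "commutator G ?d b \<in> P" using b d by (simp add: inv_commutator)
    then have "commutator G ?d b = \<one>" using pow[of "p ^ k"] disj by blast
    then show False using k(1) commutator_eq_one_iff[OF d(1) b] d(1) by (simp add: mem_centralizer_singleton)
  qed
  have gy: "g \<otimes> y \<noteq> y \<otimes> g" using t1 commutator_eq_one_iff[OF g y] by (simp add: t_def)
  have conj_t: "\<exists>(i::nat) (j::nat). u \<otimes> t \<otimes> inv u = t [^] i \<otimes> c [^] j" if u: "u \<in> carrier G" for u
  proof -
    obtain i j :: nat where "commutator G u t = t [^] i \<otimes> c [^] j" using all[OF u tc] by blast
    then have "u \<otimes> t \<otimes> inv u = t [^] i \<otimes> (c [^] j \<otimes> t)"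
      using conj_eq_commutator[OF u tc] tc c_closed by (simp add: m_assoc)
    also have "\<dots> = t [^] Suc i \<otimes> c [^] j" using c_comm[OF tc] tc c_closed by (simp add: m_assoc)
    finally show ?thesis by blast
  qed
  obtain r w :: nat where rw: "y \<otimes> t \<otimes> inv y = t [^] r \<otimes> c [^] w" using conj_t[OF y] by blast
  have yT: "y \<otimes> t \<otimes> inv y \<notin> ?T"
  proof
    assume "y \<otimes> t \<otimes> inv y \<in> ?T"
    moreover have "commutator G y g \<in> ?T"
      using subgroup.m_inv_closed[OF T tT] g y by (simp add: t_def inv_commutator)
    ultimately show False using not_normalizing[OF y g] gy by metis
  qed
  have pw: "\<not> p dvd w"
  proof
    assume "p dvd w"
    then have "c [^] w = \<one>" using cpow[of w 0] by (simp add: cong_0_iff)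
    then show False using yT rw tc tT subgroup_pow_closed[OF T tT] by simp
  qed
  have r1: "[r = 1] (mod p)"
    by (rule conj_exponent_cong[OF subgroup_P P_central disj y tc t1 rw]) (auto simp: mem_P)
  \<comment> \<open>Only exponents modulo \<open>p\<close> matter for \<open>c\<close>, so the
    factors \<open>r^j\<close> disappear there.\<close>
  have rj: "[a * r ^ j = a] (mod p)" for a j :: nat
    using cong_scalar_left[OF cong_pow[OF r1, of j], of a] by simp
  have powr: "(t [^] i \<otimes> c [^] a) [^] m = t [^] (i * m) \<otimes> c [^] (a * m)" for i a m :: nat
    using pow_mult_distrib[of "t [^] i" "c [^] a" m] c_comm[of "t [^] i" a] tc c_closed
    by (simp add: nat_pow_pow)
  have yj: "y [^] j \<otimes> t \<otimes> inv (y [^] j) = t [^] (r ^ j) \<otimes> c [^] (w * j)" for j :: nat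
  proof (induct j)
    case (Suc j)
    have "y [^] Suc j \<otimes> t \<otimes> inv (y [^] Suc j) = y \<otimes> (t [^] (r ^ j) \<otimes> c [^] (w * j)) \<otimes> inv y"
      using y tc Suc by (simp only: nat_pow_Suc2 conj_conj nat_pow_closed)
    also have "\<dots> = (y \<otimes> t \<otimes> inv y) [^] (r ^ j) \<otimes> c [^] (w * j)"
      using y tc c_closed conj_commuting[OF y, of "c [^] (w * j)"] c_comm[OF y]
      by (simp add: conj_mult conj_pow)
    also have "\<dots> = t [^] (r * r ^ j) \<otimes> c [^] (w * r ^ j) \<otimes> c [^] (w * j)"
      unfolding rw powr ..
    also have "c [^] (w * r ^ j) = c [^] w" by (rule cpow[OF rj])
    finally show ?case using tc c_closed by (simp add: m_assoc nat_pow_mult)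
  qed (use tc in simp)
  obtain s v :: nat where sv: "g \<otimes> t \<otimes> inv g = t [^] s \<otimes> c [^] v" using conj_t[OF g] by blast
  have "coprime w p" using pw prime_p by (simp add: coprime_commute prime_imp_coprime)
  then obtain x where x: "[w * x = 1] (mod p)" using cong_solve_coprime_nat by auto
  \<comment> \<open>\<open>x\<close> inverts \<open>w\<close> modulo \<open>p\<close>, and
    \<open>(p - 1) * v\<close> stands for \<open>-v\<close> in the natural numbers. So
    \<open>v + w j\<close> is 0 modulo \<open>p\<close>, and the power of \<open>c\<close> in the
    conjugate of \<open>t\<close> under \<open>g y^j\<close> cancels.\<close>
  define j where "j = x * ((p - 1) * v)"
  have "[v + w * x * ((p - 1) * v) = v + 1 * ((p - 1) * v)] (mod p)"
    by (intro cong_add cong_mult x cong_refl)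
  also have "v + 1 * ((p - 1) * v) = p * v"
    using prime_gt_0_nat[OF prime_p] by (metis add_mult_distrib mult_1 le_add_diff_inverse Suc_leI One_nat_def)
  finally have j0: "[v + w * j = 0] (mod p)" by (simp add: j_def cong_def ac_simps)
  let ?a = "g \<otimes> y [^] j"
  have a: "?a \<in> carrier G" using g y by simp
  have "?a \<otimes> t \<otimes> inv ?a = g \<otimes> (t [^] (r ^ j) \<otimes> c [^] (w * j)) \<otimes> inv g"
    using g y tc yj by (simp only: conj_conj nat_pow_closed)
  also have "\<dots> = (g \<otimes> t \<otimes> inv g) [^] (r ^ j) \<otimes> c [^] (w * j)"
    using g tc c_closed conj_commuting[OF g, of "c [^] (w * j)"] c_comm[OF g]
    by (simp add: conj_mult conj_pow)
  also have "\<dots> = t [^] (s * r ^ j) \<otimes> c [^] (v * r ^ j) \<otimes> c [^] (w * j)"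
    unfolding sv powr ..
  also have "\<dots> = t [^] (s * r ^ j) \<otimes> c [^] (v + w * j)"
    using tc c_closed cpow[OF rj, of v j] by (simp add: m_assoc nat_pow_mult)
  also have "\<dots> = t [^] (s * r ^ j)" using cpow[OF j0] tc by simp
  finally have norm: "?a \<otimes> t \<otimes> inv ?a \<in> ?T" using subgroup_pow_closed[OF T tT] by simp
  have "y [^] j \<otimes> y \<otimes> inv (y [^] j) = y" using y by (intro conj_commuting) (auto simp: group_commutes_pow)
  then have "?a \<otimes> y \<otimes> inv ?a = g \<otimes> y \<otimes> inv g" using g y by (simp only: conj_conj nat_pow_closed)
  then have at: "commutator G ?a y = t" by (simp add: commutator_def t_def)
  then have "?a \<otimes> y \<noteq> y \<otimes> ?a" using t1 commutator_eq_one_iff[OF a y] by simp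
  then show False using not_normalizing[OF a y _ _ norm] at tT by simp
qed

end

text \<open>Every commutator is a power of \<open>t\<close> times a power of \<open>c\<close>, where
  \<open>t\<close> lifts the commutator found in the quotient; the lifting lemma absorbs
  \<open>c\<close> into the group of \<open>t\<close>. The hypothesis \<open>IH\<close> stays within
  one type, which fits \<open>exists_quotient\<close>.\<close>

lemma commutators_cyclic_step:
  assumes bal: "balanced G"
    and IH: "\<And>m (Q :: ('a, 'b) monoid_scheme). m < n \<Longrightarrow> prime_power_group Q p m \<Longrightarrow> balanced Q \<Longrightarrow>
      \<exists>x\<in>carrier Q. \<exists>y\<in>carrier Q. \<forall>u\<in>carrier Q. \<forall>v\<in>carrier Q.
        commutator Q u v \<in> generate Q {commutator Q x y}"
  shows "\<exists>x\<in>carrier G. \<exists>y\<in>carrier G. \<forall>u\<in>carrier G. \<forall>v\<in>carrier G.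
    commutator G u v \<in> generate G {commutator G x y}"
proof (cases "Z = carrier G")
  case True
  have "commutator G u v = \<one>" if "u \<in> carrier G" "v \<in> carrier G" for u v
    using that True center_commute[of u v] commutator_eq_one_iff[of u v] by simp
  then show ?thesis using generate.one by (metis one_closed)
next
  case False
  obtain c x0 y0 where c: "x0 \<in> carrier G" "y0 \<in> carrier G" "c = commutator G x0 y0" "c \<in> Z" "c \<noteq> \<one>"
    "c [^] p = \<one>" and absorb: "\<And>b g. b \<in> carrier G \<Longrightarrow> g \<in> carrier G
      \<Longrightarrow> b [^] p \<otimes> g = g \<otimes> b [^] p \<Longrightarrow> commutator G g b \<in> generate G {c}"
    using exists_central_commutator[OF bal False] by metis
  let ?P = "generate G {c}"
  note ctx = bal c(4,6) refl absorb
  have P: "subgroup ?P G" by (rule subgroup_P[OF ctx])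
  have PZ: "?P \<subseteq> Z" by (rule P_central[OF ctx])
  obtain Q :: "('a, 'b) monoid_scheme" and f where Q: "group_hom G Q f" "f ` carrier G = carrier Q"
    "\<And>x. x \<in> carrier G \<Longrightarrow> f x = \<one>\<^bsub>Q\<^esub> \<longleftrightarrow> x \<in> ?P"
    using exists_quotient[OF P PZ] by metis
  interpret f: group_hom G Q f by (rule Q(1))
  have balQ: "balanced Q"
    by (rule balanced_quotient[OF Q P refl relatively_balanced[OF ctx refl]])
  have "ord c = p"
  proof -
    have "ord c dvd p" using c(4,6) pow_eq_id[of c p] by (simp add: group_center_def)
    moreover have "ord c \<noteq> 1" using ord_eq_1[of c] c(4,5) by (simp add: group_center_def)
    ultimately show ?thesis using prime_p by (metis prime_nat_iff)
  qed
  then have cardP: "card ?P = p" using generate_pow_card[of c] c(4) by (simp add: group_center_def)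
  have "{x \<in> carrier G. f x \<in> carrier Q} = carrier G" by auto
  then have oQ: "p ^ n = p * order Q"
    using card_preimage[OF Q subgroup.subset[OF P], of "carrier Q"] cardP
    by (simp add: order_def flip: order_eq)
  have "n \<noteq> 0"
    using oQ prime_gt_1_nat[OF prime_p] by (metis nat_mult_eq_1_iff power_0 less_irrefl)
  then obtain m where m: "n = Suc m" using not0_implies_Suc by blast
  then have "order Q = p ^ m" using oQ prime_gt_0_nat[OF prime_p] by simp
  then have "prime_power_group Q p m"
    by (intro prime_power_group.intro prime_power_group_axioms.intro f.H.is_group prime_p)
  then have "\<exists>x\<in>carrier Q. \<exists>y\<in>carrier Q. \<forall>u\<in>carrier Q. \<forall>v\<in>carrier Q.
      commutator Q u v \<in> generate Q {commutator Q x y}"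
    using IH[OF _ _ balQ] m by blast
  then obtain g y where gy: "g \<in> carrier G" "y \<in> carrier G"
    and gen: "\<And>u v. u \<in> carrier G \<Longrightarrow> v \<in> carrier G
      \<Longrightarrow> commutator Q (f u) (f v) \<in> generate Q {commutator Q (f g) (f y)}"
    unfolding Q(2)[symmetric] by blast
  define t where "t = commutator G g y"
  have tc: "t \<in> carrier G" and cc: "c \<in> carrier G" using gy c by (auto simp: t_def)
  have all: "\<exists>(i::nat) (j::nat). commutator G u v = t [^] i \<otimes> c [^] j"
    if uv: "u \<in> carrier G" "v \<in> carrier G" for u v
  proof -
    have "f (commutator G u v) \<in> generate Q (f ` {t})"
      using gen[OF uv] uv gy by (simp add: t_def f.hom_commutator)
    also have "generate Q (f ` {t}) = f ` generate G {t}" using tc by (intro f.generate_img) auto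
    finally obtain s where s: "s \<in> generate G {t}" "f (commutator G u v) = f s" by blast
    then obtain i :: nat where i: "s = t [^] i" using mem_generate_singleton[OF tc] by blast
    have sc: "s \<in> carrier G" using i tc by simp
    have "f (inv s \<otimes> commutator G u v) = \<one>\<^bsub>Q\<^esub>" using s(2) sc uv by simp
    then have "inv s \<otimes> commutator G u v \<in> ?P"
      using Q(3)[THEN iffD1, of "inv s \<otimes> commutator G u v"] sc uv by simp
    then obtain j :: nat where "inv s \<otimes> commutator G u v = c [^] j"
      using mem_generate_singleton[OF cc] by blast
    then have "commutator G u v = s \<otimes> c [^] j" using sc uv by (metis cancel_left_inv commutator_closed)
    then show ?thesis using i by blast
  qed
  show ?thesis
  proof (cases "t = \<one>")
    \<comment> \<open>Now all commutators lie in \<open>P\<close>, and \<open>c\<close>, the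
      commutator of \<open>x0\<close> and \<open>y0\<close>, replaces \<open>t\<close>.\<close>
    case True
    then have "commutator G u v \<in> generate G {commutator G x0 y0}"
      if "u \<in> carrier G" "v \<in> carrier G" for u v
      using all[OF that] cc mem_generate_singleton[OF cc] by (auto simp flip: c(3))
    then show ?thesis using c(1,2) by blast
  next
    case t1: False
    have T: "subgroup (generate G {t}) G" using tc by (intro generate_is_subgroup) auto
    have "c \<in> generate G {t}" by (rule commutators_cyclic_lift[OF ctx gy t_def all t1])
    moreover have "t \<in> generate G {t}" by (simp add: generate.incl)
    ultimately have "t [^] i \<otimes> c [^] j \<in> generate G {t}" for i j :: nat
      using subgroup_pow_closed[OF T] subgroup.m_closed[OF T] by blast
    then have "commutator G u v \<in> generate G {commutator G g y}"
      if "u \<in> carrier G" "v \<in> carrier G" for u v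
      using all[OF that] by (auto simp flip: t_def)
    then show ?thesis using gy by blast
  qed
qed

end

theorem balanced_commutators_cyclic:
  fixes G :: "('a, 'b) monoid_scheme"
  assumes "prime_power_group G p n" "balanced G"
  shows "\<exists>x\<in>carrier G. \<exists>y\<in>carrier G. \<forall>u\<in>carrier G. \<forall>v\<in>carrier G.
    commutator G u v \<in> generate G {commutator G x y}"
  using assms
proof (induct n arbitrary: G rule: less_induct)
  case (less n G)
  show ?case
    by (rule prime_power_group.commutators_cyclic_step[OF less.prems less.hyps])
qed

section \<open>The modular law and cyclic commutators imply balance\<close>

text \<open>With \<open>r = 1 + p b\<close>, the power \<open>r^i\<close> is
  \<open>1 + i p b\<close> modulo the square of \<open>p\<close>, and the \<open>i\<close> below
  \<open>p\<close> add up to \<open>p (p - 1) / 2\<close>, a multiple of \<open>p\<close> because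
  \<open>p\<close> is odd. For \<open>p = 2\<close> and \<open>r = 3\<close> the sum is 4, which is
  not 2 modulo 4.\<close>

lemma geometric_sum_cong:
  fixes p r :: nat
  assumes p: "odd p" and r: "[r = 1] (mod p)" "r \<ge> 1"
  shows "[(\<Sum>i<p. r ^ i) = p] (mod p\<^sup>2)"
proof -
  obtain b where b: "r = 1 + p * b"
    using r by (metis cong_to_1_nat dvdE le_add_diff_inverse)
  have pow: "[r ^ i = 1 + i * (p * b)] (mod p\<^sup>2)" for i
  proof (induct i)
    case (Suc i)
    have "[r * r ^ i = r * (1 + i * (p * b))] (mod p\<^sup>2)" by (rule cong_scalar_left[OF Suc])
    also have "r * (1 + i * (p * b)) = 1 + Suc i * (p * b) + p\<^sup>2 * (i * b\<^sup>2)"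
      by (simp add: b algebra_simps power2_eq_square)
    also have "[\<dots> = 1 + Suc i * (p * b)] (mod p\<^sup>2)" by (simp add: cong_def)
    finally show ?case by simp
  qed simp
  have "[(\<Sum>i<p. r ^ i) = (\<Sum>i<p. 1 + i * (p * b))] (mod p\<^sup>2)" by (rule cong_sum[OF pow])
  also have "(\<Sum>i<p. 1 + i * (p * b)) = p + (\<Sum>i<p. i) * (p * b)"
    by (simp only: sum.distrib sum_distrib_right) simp
  also have "(\<Sum>i<p. i) = p * ((p - 1) div 2)"
  proof -
    obtain m where "p = 2 * m + 1" using p by (rule oddE)
    moreover have "(\<Sum>i<2 * m + 1. i) = (2 * m + 1) * m" by (induct m) auto
    ultimately show ?thesis by simp
  qed
  also have "p + p * ((p - 1) div 2) * (p * b) = p + p\<^sup>2 * ((p - 1) div 2 * b)"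
    by (simp add: power2_eq_square)
  also have "[\<dots> = p] (mod p\<^sup>2)" by (simp add: cong_def)
  finally show ?thesis .
qed

context finite_group
begin

text \<open>With \<open>m = ord t div gcd (ord t) p\<close>, the elements in question are powers of
  \<open>t [^] m\<close>, whose exponents count only modulo \<open>p\<close>.\<close>

lemma card_exponent_le:
  assumes t: "t \<in> carrier G" and p: "Factorial_Ring.prime p"
  shows "card {x \<in> generate G {t}. x [^] (p::nat) = \<one>} \<le> p"
proof -
  let ?A = "{x \<in> generate G {t}. x [^] p = \<one>}"
  have p0: "0 < p" by (rule prime_gt_0_nat[OF p])
  define g m q0 where "g = gcd (ord t) p" and "m = ord t div g" and "q0 = p div g"
  have g: "0 < g" "ord t = m * g" "p = q0 * g" using p0 by (auto simp: g_def m_def q0_def)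
  have cop: "coprime m q0" unfolding m_def q0_def g_def using p0 by (intro div_gcd_coprime) simp
  have "?A \<subseteq> (\<lambda>j. t [^] (m * j)) ` {..<p}"
  proof
    fix x assume x: "x \<in> ?A"
    then obtain i :: nat where i: "x = t [^] i" using mem_generate_singleton[OF t] by auto
    have "t [^] (i * p) = \<one>" using x i t by (simp add: nat_pow_pow)
    then have "ord t dvd i * p" using pow_eq_id[OF t] by simp
    then have "m * g dvd (i * q0) * g" using g by (simp add: mult.assoc)
    then have "m dvd i * q0" using g(1) by simp
    then have "m dvd i" using cop by (simp add: coprime_dvd_mult_left_iff)
    then obtain q where q: "i = m * q" by blast
    have "ord t dvd m * p" unfolding g(2) g(3) by (simp add: mult.assoc mult.left_commute)
    then have "(t [^] m) [^] p = \<one>" using t pow_eq_id[OF t] by (simp add: nat_pow_pow)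
    then have "(t [^] m) [^] (q mod p) = (t [^] m) [^] q" using t by (intro pow_mod_of_pow_eq_one) auto
    then have "x = t [^] (m * (q mod p))" using i q t by (simp add: nat_pow_pow)
    then show "x \<in> (\<lambda>j. t [^] (m * j)) ` {..<p}" using p0 by simp
  qed
  from surj_card_le[OF finite_lessThan this] show ?thesis by simp
qed

text \<open>The union of \<open>T\<close> and \<open>h^-1 T\<close>, an explicit form of the
  subgroup generated by \<open>h\<close> and \<open>T\<close>.\<close>

lemma subgroup_two_cosets:
  assumes T: "subgroup T G" and h: "h \<in> carrier G" "h \<otimes> h \<in> T"
    and norm: "\<And>u. u \<in> T \<Longrightarrow> h \<otimes> u \<otimes> inv h \<in> T"
  shows "subgroup {x \<in> carrier G. x \<in> T \<or> h \<otimes> x \<in> T} G"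
proof (rule finite_subgroupI)
  note Tc = subgroup.mem_carrier[OF T] and Tm = subgroup.m_closed[OF T] and Ti = subgroup.m_inv_closed[OF T]
  have norm': "inv h \<otimes> u \<otimes> h \<in> T" if "u \<in> T" for u
  proof -
    have "inv h \<otimes> u \<otimes> h = inv (h \<otimes> h) \<otimes> (h \<otimes> u \<otimes> inv h) \<otimes> (h \<otimes> h)"
      using h(1) Tc[OF that] by (simp add: m_assoc inv_mult_group)
    then show ?thesis using norm[OF that] h(2) Tm Ti by simp
  qed
  fix x y assume xy: "x \<in> {x \<in> carrier G. x \<in> T \<or> h \<otimes> x \<in> T}" "y \<in> {x \<in> carrier G. x \<in> T \<or> h \<otimes> x \<in> T}"
  then have c: "x \<in> carrier G" "y \<in> carrier G" by auto
  consider "x \<in> T" "y \<in> T" | "x \<in> T" "h \<otimes> y \<in> T" | "h \<otimes> x \<in> T" "y \<in> T" | "h \<otimes> x \<in> T" "h \<otimes> y \<in> T"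
    using xy by blast
  then have "x \<otimes> y \<in> T \<or> h \<otimes> (x \<otimes> y) \<in> T"
  proof cases
    case 1
    then show ?thesis using Tm by blast
  next
    case 2
    have "h \<otimes> (x \<otimes> y) = (h \<otimes> x \<otimes> inv h) \<otimes> (h \<otimes> y)" using h c by (simp add: m_assoc)
    then show ?thesis using norm[OF 2(1)] 2(2) Tm by simp
  next
    case 3
    have "h \<otimes> (x \<otimes> y) = (h \<otimes> x) \<otimes> y" using h c by (simp add: m_assoc)
    then show ?thesis using 3 Tm by simp
  next
    case 4
    have "x \<otimes> y = (inv h \<otimes> (h \<otimes> x) \<otimes> h) \<otimes> inv (h \<otimes> h) \<otimes> (h \<otimes> y)"
      using h c by (simp add: m_assoc inv_mult_group)
    then show ?thesis using norm'[OF 4(1)] 4(2) h(2) Tm Ti by simp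
  qed
  then show "x \<otimes> y \<in> {x \<in> carrier G. x \<in> T \<or> h \<otimes> x \<in> T}" using c by simp
qed (use subgroup.one_closed[OF T] in auto)

end

context prime_power_group
begin

text \<open>Modulo \<open>S\<close>, the elements \<open>h\<close> and \<open>k\<close> are involutions generating a dihedral \<open>2\<close>-group with
  rotation \<open>h \<otimes> k\<close>. If the rotation had order at least \<open>4\<close>, the subgroups generated by \<open>h\<close>, by
  \<open>k\<close>, and by \<open>h\<close> and the square of the rotation would violate the modular law.\<close>

lemma modular_dihedral:
  assumes modl: "modular_lattice (inclusion_order (center_interval G))" and p2: "p = 2"
    and S: "subgroup S G" "Z \<subseteq> S" and h: "h \<in> carrier G" "S \<subseteq> C h" "h \<otimes> h \<in> S"
    and k: "k \<in> carrier G" "S \<subseteq> C k" "k \<otimes> k \<in> S"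
  shows "(h \<otimes> k) \<otimes> (h \<otimes> k) \<in> S"
proof -
  let ?L = "inclusion_order (center_interval G)"
  interpret L: modular_lattice ?L by (rule modl)
  let ?r = "h \<otimes> k"
  \<comment> \<open>The squared rotation is written as a \<open>p\<close>-th power so that
    \<open>not_mem_adjoin_pow\<close> applies.\<close>
  let ?T = "adjoin G (?r [^] p) S"
  note Sc = subgroup.mem_carrier[OF S(1)] and Sm = subgroup.m_closed[OF S(1)]
    and Si = subgroup.m_inv_closed[OF S(1)]
  have sh: "s \<otimes> h = h \<otimes> s" and sk: "s \<otimes> k = k \<otimes> s" if "s \<in> S" for s
    using that h(2) k(2) by (auto simp: mem_centralizer_singleton)
  have r: "?r \<in> carrier G" and rp: "?r [^] p = ?r \<otimes> ?r" using h k by (simp_all add: p2 numeral_2_eq_2)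
  have SCr: "S \<subseteq> C ?r"
    using sh sk Sc h(1) k(1) commute_mult[of h k] by (auto simp: mem_centralizer_singleton)
  have commuting: "?r \<otimes> ?r \<in> S" if "h \<otimes> k = k \<otimes> h"
  proof -
    have "?r \<otimes> ?r = h \<otimes> (k \<otimes> h) \<otimes> k" using h k by (simp add: m_assoc)
    also have "k \<otimes> h = h \<otimes> k" using that by simp
    also have "h \<otimes> (h \<otimes> k) \<otimes> k = (h \<otimes> h) \<otimes> (k \<otimes> k)" using h k by (simp add: m_assoc)
    finally show ?thesis using h k Sm by simp
  qed
  have T: "subgroup ?T G" "S \<subseteq> ?T"
    using subgroup_adjoin[OF S(1), of "?r [^] p"] SCr C_pow[OF r, of p] r Sc subset_adjoin[of S]
    by (auto simp: mem_centralizer_singleton subset_iff pow_commute)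
  note Tm = subgroup.m_closed[OF T(1)] and Ti = subgroup.m_inv_closed[OF T(1)]
  have rT: "?r \<otimes> ?r \<in> ?T"
    using mem_adjoin[OF subgroup.one_closed[OF S(1)], of "?r [^] p"] r rp by simp
  have TCr: "?T \<subseteq> C ?r"
  proof
    fix x assume "x \<in> ?T"
    then obtain i :: nat and s where "s \<in> S" "x = (?r [^] p) [^] i \<otimes> s" by (rule adjoinE)
    moreover have "?r [^] p \<in> C ?r" using r by (simp add: mem_centralizer_singleton group_commutes_pow)
    ultimately show "x \<in> C ?r"
      using SCr subgroup.m_closed[OF subgroup_C[OF r]] subgroup_pow_closed[OF subgroup_C[OF r]] by blast
  qed
  have norm: "h \<otimes> u \<otimes> inv h \<in> ?T" if uT: "u \<in> ?T" for u
  proof -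
    obtain i :: nat and s where u: "s \<in> S" "u = (?r [^] p) [^] i \<otimes> s" using uT by (rule adjoinE)
    let ?a = "h \<otimes> h \<otimes> (k \<otimes> k)"
    have a: "?a \<in> S" using h k Sm by blast
    \<comment> \<open>Up to the factor \<open>?a\<close> from \<open>S\<close>, \<open>h\<close>
      inverts the rotation; hence it normalizes \<open>?T\<close>.\<close>
    have "h \<otimes> ?r \<otimes> inv h = ?a \<otimes> inv ?r"
      using h k by (simp add: m_assoc inv_mult_group)
    then have "h \<otimes> (?r \<otimes> ?r) \<otimes> inv h = (?a \<otimes> inv ?r) \<otimes> (?a \<otimes> inv ?r)"
      using conj_mult[OF h(1) r r] by simp
    also have "\<dots> = ?a \<otimes> (inv ?r \<otimes> ?a) \<otimes> inv ?r" using r Sc[OF a] by (simp add: m_assoc)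
    also have "inv ?r \<otimes> ?a = ?a \<otimes> inv ?r"
    proof -
      have "?r \<in> C ?a" using SCr a r by (auto simp: mem_centralizer_singleton)
      then have "inv ?r \<in> C ?a" using subgroup.m_inv_closed[OF subgroup_C[OF Sc[OF a]]] by blast
      then show ?thesis by (simp only: mem_centralizer_singleton)
    qed
    also have "?a \<otimes> (?a \<otimes> inv ?r) \<otimes> inv ?r = ?a \<otimes> ?a \<otimes> inv (?r \<otimes> ?r)"
      using r Sc[OF a] by (simp add: m_assoc inv_mult_group[OF r r])
    finally have "h \<otimes> (?r [^] p) \<otimes> inv h \<in> ?T"
      using a T(2) rT Tm Ti rp by auto
    then have "(h \<otimes> (?r [^] p) \<otimes> inv h) [^] i \<in> ?T" by (rule subgroup_pow_closed[OF T(1)])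
    moreover have "h \<otimes> u \<otimes> inv h = (h \<otimes> (?r [^] p) \<otimes> inv h) [^] i \<otimes> s"
      using u r h sh[OF u(1)] Sc[OF u(1)] conj_commuting[OF h(1), of s] by (simp add: conj_mult conj_pow)
    ultimately show ?thesis using Tm u T(2) by auto
  qed
  let ?H = "{x \<in> carrier G. x \<in> S \<or> h \<otimes> x \<in> S}" and ?K = "{x \<in> carrier G. x \<in> S \<or> k \<otimes> x \<in> S}"
    and ?W = "{x \<in> carrier G. x \<in> ?T \<or> h \<otimes> x \<in> ?T}"
  have "h \<otimes> u \<otimes> inv h = u" "k \<otimes> u \<otimes> inv k = u" if "u \<in> S" for u
    using conj_commuting h(1) k(1) Sc[OF that] sh[OF that] sk[OF that] by metis+
  then have H: "subgroup ?H G" and K: "subgroup ?K G"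
    using subgroup_two_cosets[OF S(1) h(1,3)] subgroup_two_cosets[OF S(1) k(1,3)] by auto
  have W: "subgroup ?W G"
    by (rule subgroup_two_cosets[OF T(1) h(1) _ norm]) (use h T in auto)
  have int: "?H \<in> center_interval G" "?K \<in> center_interval G" "?W \<in> center_interval G"
    using H K W S(2) T(2) Sc by (auto simp: center_interval_def)
  show ?thesis
  proof (cases "k \<in> ?W")
    \<comment> \<open>Here \<open>?K \<inter> ?W\<close> collapses to \<open>S\<close>, so by the
      modular law the join of \<open>?H\<close> and \<open>?K\<close> meets \<open>?W\<close> in
      \<open>?H\<close> only; but the squared rotation lies in that intersection.\<close>
    case False
    have KW: "?K \<inter> ?W \<in> center_interval G"
      using subgroups_Inter_pair[OF K W] int by (auto simp: center_interval_def)
    have "x \<in> S" if x: "x \<in> ?K" "x \<in> ?W" for x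
    proof (rule ccontr)
      assume "x \<notin> S"
      then have "k \<otimes> x \<in> S" using x by blast
      then have "k \<otimes> x \<in> ?W" using T(2) Sc by blast
      then have "(k \<otimes> x) \<otimes> inv x \<in> ?W"
        using x subgroup.m_closed[OF W] subgroup.m_inv_closed[OF W] by blast
      moreover have "(k \<otimes> x) \<otimes> inv x = k" using x k by (simp add: m_assoc)
      ultimately show False using False by simp
    qed
    then have "?K \<inter> ?W \<subseteq> ?H" by blast
    then have "generate G (?H \<union> (?K \<inter> ?W)) \<subseteq> ?H" by (intro generate_subgroup_incl H) auto
    moreover have "generate G (?H \<union> (?K \<inter> ?W)) = generate G (?H \<union> ?K) \<inter> ?W"
    proof -
      have "generate G (?H \<union> ?K) \<in> center_interval G"
        using int generate_is_subgroup[of "?H \<union> ?K"] generate.incl[of _ "?H \<union> ?K"]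
        by (auto simp: center_interval_def)
      moreover have "?H \<subseteq> ?W" using T(2) by blast
      then have "?H \<squnion>\<^bsub>?L\<^esub> (?K \<sqinter>\<^bsub>?L\<^esub> ?W) = (?H \<squnion>\<^bsub>?L\<^esub> ?K) \<sqinter>\<^bsub>?L\<^esub> ?W"
        by (intro L.modular_law) (use int in simp_all)
      ultimately show ?thesis
        by (simp only: center_interval_join[OF int(1) KW] center_interval_join[OF int(1,2)]
            center_interval_meet[OF int(2,3)] center_interval_meet[OF _ int(3)])
    qed
    moreover have "?r \<otimes> ?r \<in> generate G (?H \<union> ?K)"
    proof -
      have "h \<in> ?H" "k \<in> ?K" using h k by auto
      then show ?thesis by (intro generate.eng generate.incl) auto
    qed
    moreover have "?r \<otimes> ?r \<in> ?W" using rT r by auto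
    ultimately consider "?r \<otimes> ?r \<in> S" | "h \<otimes> (?r \<otimes> ?r) \<in> S" by blast
    then show ?thesis
    proof cases
      case 2
      \<comment> \<open>\<open>?s\<close> equals \<open>k h k\<close>; as an element of
        \<open>S\<close> it commutes with \<open>k\<close>, and then so does
        \<open>h\<close>.\<close>
      let ?s = "inv (h \<otimes> h) \<otimes> (h \<otimes> (?r \<otimes> ?r))"
      have s: "?s \<in> S" using 2 h Sm Si by blast
      have seq: "?s = k \<otimes> h \<otimes> k" using h k by (simp add: m_assoc inv_mult_group)
      have "k \<otimes> (h \<otimes> k \<otimes> k) = k \<otimes> (k \<otimes> h \<otimes> k)"
        using sk[OF s] h k unfolding seq by (simp add: m_assoc)
      then have "h \<otimes> k = k \<otimes> h" using h k by simp
      then show ?thesis by (rule commuting)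
    qed
  next
    case True
    then consider "k \<in> ?T" | "?r \<in> ?T" by blast
    then show ?thesis
    proof cases
      case 1
      then have "k \<otimes> (h \<otimes> k) = h \<otimes> k \<otimes> k" using TCr by (auto simp: mem_centralizer_singleton)
      then have "k \<otimes> h \<otimes> k = h \<otimes> k \<otimes> k" using h k by (simp add: m_assoc)
      then show ?thesis using h k by (intro commuting) simp
    next
      case 2
      then have "?r \<in> S" using not_mem_adjoin_pow[OF S(1) SCr r] by blast
      then show ?thesis using Sm by blast
    qed
  qed
qed

text \<open>As \<open>h^2\<close> commutes with \<open>d\<close>, \<open>h\<close> inverts
  \<open>c\<close>. The dihedral lemma for \<open>h\<close> and \<open>d h d^-1\<close>, with
  product \<open>c h^2\<close>, makes \<open>c^2\<close> commute with \<open>h\<close>, which also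
  inverts it. If \<open>c\<close> commutes with \<open>d\<close>, the same lemma for
  \<open>h\<close> and \<open>h d\<close> makes \<open>d^2\<close> commute with \<open>h\<close>,
  and \<open>(c d)^2 = d^2\<close> gives the last claim.\<close>

lemma commutator_involution_of_square:
  assumes modl: "modular_lattice (inclusion_order (center_interval G))" and p2: "p = 2"
    and h: "h \<in> carrier G" and d: "d \<in> carrier G" and hh: "(h \<otimes> h) \<otimes> d = d \<otimes> (h \<otimes> h)"
  defines "c \<equiv> commutator G h d"
  shows "h \<otimes> c \<otimes> inv h = inv c" and "c \<otimes> c \<otimes> (c \<otimes> c) = \<one>"
    and "c \<otimes> d = d \<otimes> c \<Longrightarrow> c \<otimes> c = \<one>"
proof -
  let ?S = "centralizer G {h, d}"
  have c: "c \<in> carrier G" using h d by (simp add: c_def)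
  have hd: "h \<otimes> d \<otimes> inv h = c \<otimes> d" using conj_eq_commutator[OF h d] by (simp add: c_def)
  have S: "subgroup ?S G" "Z \<subseteq> ?S" "?S \<subseteq> C h" "?S \<subseteq> C d"
    using subgroup_centralizer[of "{h, d}"] group_center_subset_centralizer[of "{h, d}"] h d
    by (auto simp: centralizer_def)
  note Sm = subgroup.m_closed[OF S(1)] and Si = subgroup.m_inv_closed[OF S(1)]
  have memS: "x \<in> ?S \<longleftrightarrow> x \<in> carrier G \<and> x \<otimes> h = h \<otimes> x \<and> x \<otimes> d = d \<otimes> x" for x
    by (auto simp: centralizer_def)
  have S_commute: "?S \<subseteq> C x" if "x \<in> carrier G" "x \<in> generate G {h, d}" for x
  proof -
    have "centralizer G {h, d} = centralizer G (generate G {h, d})"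
      using centralizer_generate[of "{h, d}"] h d by simp
    then show ?thesis using centralizer_antimono[of "{x}"] that by blast
  qed
  have gen: "h \<in> generate G {h, d}" "d \<in> generate G {h, d}" "inv d \<in> generate G {h, d}"
    by (auto intro: generate.incl generate.inv)
  have hS: "h \<otimes> h \<in> ?S" using h hh by (simp add: memS m_assoc)
  have "d = (h \<otimes> h) \<otimes> d \<otimes> inv (h \<otimes> h)" using conj_commuting[of "h \<otimes> h" d] h d hh by simp
  also have "\<dots> = h \<otimes> (c \<otimes> d) \<otimes> inv h" using conj_conj[OF h h d] hd by simp
  also have "\<dots> = (h \<otimes> c \<otimes> inv h) \<otimes> c \<otimes> d"
    using conj_mult[OF h c d] hd h c d by (simp add: m_assoc)
  finally have "(h \<otimes> c \<otimes> inv h) \<otimes> c = \<one>" using h c d by (metis inv_closed l_cancel_one' m_closed r_cancel_one')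
  then show hc: "h \<otimes> c \<otimes> inv h = inv c"
    using h c by (metis inv_closed inv_equality m_closed)
  have hcc: "h \<otimes> (c \<otimes> c) \<otimes> inv h = inv (c \<otimes> c)"
    using conj_mult[OF h c c] hc c by (simp add: inv_mult_group)
  show "c \<otimes> c \<otimes> (c \<otimes> c) = \<one>"
  proof -
    let ?k = "d \<otimes> h \<otimes> inv d"
    have kc: "?k = inv c \<otimes> h"
      using conj_eq_commutator[OF d h] inv_commutator[OF h d] by (simp add: c_def)
    have k: "?k \<in> carrier G" using h d by simp
    have "?k \<in> generate G {h, d}" using gen by (intro generate.eng)
    then have "?S \<subseteq> C ?k" using S_commute k by blast
    moreover have "?k \<otimes> ?k \<in> ?S"
    proof -
      have "?k \<otimes> ?k = d \<otimes> (h \<otimes> h) \<otimes> inv d" using conj_mult[OF d h h] by simp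
      also have "\<dots> = h \<otimes> h" using conj_commuting[OF d, of "h \<otimes> h"] h hh by simp
      finally show ?thesis using hS by simp
    qed
    ultimately have "(h \<otimes> ?k) \<otimes> (h \<otimes> ?k) \<in> ?S"
      by (intro modular_dihedral[OF modl p2 S(1,2) h S(3) hS k])
    moreover have "h \<otimes> ?k = c \<otimes> (h \<otimes> h)"
    proof -
      have "h \<otimes> ?k = (h \<otimes> inv c \<otimes> inv h) \<otimes> (h \<otimes> h)" unfolding kc using h c by (simp add: m_assoc)
      also have "h \<otimes> inv c \<otimes> inv h = inv (h \<otimes> c \<otimes> inv h)" using h c by (simp add: m_assoc inv_mult_group)
      also have "\<dots> = c" using hc c by simp
      finally show ?thesis .
    qed
    ultimately have "c \<otimes> (h \<otimes> h) \<otimes> (c \<otimes> (h \<otimes> h)) \<in> ?S" by simp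
    moreover have "c \<in> generate G {h, d}"
      unfolding c_def commutator_def by (intro generate.eng generate.incl generate.inv) auto
    then have "(h \<otimes> h) \<otimes> c = c \<otimes> (h \<otimes> h)"
      using S_commute[OF c] hS by (auto simp: mem_centralizer_singleton)
    then have "c \<otimes> (h \<otimes> h) \<otimes> (c \<otimes> (h \<otimes> h)) = c \<otimes> (c \<otimes> (h \<otimes> h)) \<otimes> (h \<otimes> h)"
      using h c by (metis m_assoc m_closed)
    then have "c \<otimes> (h \<otimes> h) \<otimes> (c \<otimes> (h \<otimes> h)) = c \<otimes> c \<otimes> ((h \<otimes> h) \<otimes> (h \<otimes> h))"
      using h c by (simp add: m_assoc)
    ultimately have "c \<otimes> c \<otimes> ((h \<otimes> h) \<otimes> (h \<otimes> h)) \<otimes> inv ((h \<otimes> h) \<otimes> (h \<otimes> h)) \<in> ?S"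
      using Sm Si hS by metis
    then have "c \<otimes> c \<in> ?S" using h c by (simp add: m_assoc)
    then have "h \<otimes> (c \<otimes> c) \<otimes> inv h = c \<otimes> c" using h c by (intro conj_commuting) (auto simp: memS)
    then have "inv (c \<otimes> c) = c \<otimes> c" using hcc by simp
    then show ?thesis using c by (metis m_closed l_inv)
  qed
  show "c \<otimes> c = \<one>" if cd: "c \<otimes> d = d \<otimes> c"
  proof -
    let ?k = "h \<otimes> d"
    have k: "?k \<in> carrier G" using h d by simp
    have k_alt: "?k = c \<otimes> (d \<otimes> h)" using commutator_mult[OF h d] h d c by (simp add: c_def m_assoc)
    have "?S \<subseteq> C ?k" using S_commute[OF k] gen by (auto intro: generate.eng)
    moreover have kk: "?k \<otimes> ?k = (c \<otimes> (d \<otimes> d)) \<otimes> (h \<otimes> h)"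
    proof -
      have "?k \<otimes> ?k = c \<otimes> (d \<otimes> ((h \<otimes> h) \<otimes> d))"
        by (subst k_alt) (use h d c in \<open>simp add: m_assoc\<close>)
      also have "\<dots> = (c \<otimes> (d \<otimes> d)) \<otimes> (h \<otimes> h)" unfolding hh using h d c by (simp add: m_assoc)
      finally show ?thesis .
    qed
    have "?k \<otimes> ?k \<in> ?S"
    proof -
      have "(c \<otimes> (d \<otimes> d)) \<otimes> d = d \<otimes> (c \<otimes> (d \<otimes> d))"
        using cd c d by (intro commute_mult) (auto simp: m_assoc)
      moreover have "h \<otimes> (c \<otimes> (d \<otimes> d)) \<otimes> inv h = c \<otimes> (d \<otimes> d)"
      proof -
        have "h \<otimes> (c \<otimes> (d \<otimes> d)) \<otimes> inv h = inv c \<otimes> ((c \<otimes> d) \<otimes> (c \<otimes> d))"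
          using conj_mult[OF h] hc hd c d by simp
        also have "\<dots> = d \<otimes> c \<otimes> d" using c d by (simp add: m_assoc)
        also have "\<dots> = c \<otimes> (d \<otimes> d)" using cd[symmetric] c d by (simp add: m_assoc)
        finally show ?thesis .
      qed
      ultimately have "c \<otimes> (d \<otimes> d) \<in> ?S"
        using conj_eq_iff[OF h, of "c \<otimes> (d \<otimes> d)"] c d by (simp add: memS)
      then show ?thesis unfolding kk using Sm hS by blast
    qed
    ultimately have "(h \<otimes> ?k) \<otimes> (h \<otimes> ?k) \<in> ?S"
      by (intro modular_dihedral[OF modl p2 S(1,2) h S(3) hS k])
    moreover have "(h \<otimes> ?k) \<otimes> (h \<otimes> ?k) = ((h \<otimes> h) \<otimes> (h \<otimes> h)) \<otimes> (d \<otimes> d)"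
    proof -
      have "(h \<otimes> ?k) \<otimes> (h \<otimes> ?k) = (h \<otimes> h) \<otimes> (d \<otimes> (h \<otimes> h)) \<otimes> d" using h d by (simp add: m_assoc)
      also have "\<dots> = (h \<otimes> h) \<otimes> ((h \<otimes> h) \<otimes> d) \<otimes> d" unfolding hh ..
      finally show ?thesis using h d by (simp add: m_assoc)
    qed
    ultimately have "inv ((h \<otimes> h) \<otimes> (h \<otimes> h)) \<otimes> (((h \<otimes> h) \<otimes> (h \<otimes> h)) \<otimes> (d \<otimes> d)) \<in> ?S"
      using Sm Si hS by metis
    then have "d \<otimes> d \<in> ?S" using h d by simp
    then have "h \<otimes> (d \<otimes> d) \<otimes> inv h = d \<otimes> d" using h d by (intro conj_commuting) (auto simp: memS)
    then have "(c \<otimes> d) \<otimes> (c \<otimes> d) = d \<otimes> d" using conj_mult[OF h d d] hd by simp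
    moreover have "(c \<otimes> d) \<otimes> (c \<otimes> d) = (c \<otimes> c) \<otimes> (d \<otimes> d)"
      using cd c d by (metis m_assoc m_closed)
    ultimately show "c \<otimes> c = \<one>" using c d by simp
  qed
qed

text \<open>Let \<open>c = [h, d]\<close>, raised by \<open>h\<close> to the power \<open>r\<close>.
  For odd \<open>p\<close>, conjugating \<open>d\<close> by \<open>h^p\<close> multiplies it by
  \<open>c^s\<close> with \<open>s\<close> the sum of the \<open>r^i\<close>, so
  \<open>ord c\<close> divides \<open>s\<close>; as \<open>s\<close> is \<open>p\<close> modulo the
  square of \<open>p\<close>, the prime power \<open>ord c\<close> divides \<open>p\<close>. For
  \<open>p = 2\<close> the modular law gives \<open>c^4 = 1\<close>, and the action of
  \<open>d\<close> on \<open>c\<close> decides the rest.\<close>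

lemma commutator_exponent_of_power:
  assumes modl: "modular_lattice (inclusion_order (center_interval G))"
    and t: "t \<in> carrier G"
    and all: "\<And>u v. u \<in> carrier G \<Longrightarrow> v \<in> carrier G \<Longrightarrow> commutator G u v \<in> generate G {t}"
    and h: "h \<in> carrier G" and d: "d \<in> carrier G" and hp: "h [^] p \<otimes> d = d \<otimes> h [^] p"
  shows "commutator G h d [^] p = \<one>"
proof -
  have T: "subgroup (generate G {t}) G" using t by (intro generate_is_subgroup) auto
  have conj_T: "\<exists>j::nat. u \<otimes> x \<otimes> inv u = x [^] j" if u: "u \<in> carrier G" and x: "x \<in> generate G {t}" for u x
  proof -
    have "u \<otimes> t \<otimes> inv u \<in> generate G {t}"
      using conj_eq_commutator[OF u t] all[OF u t] subgroup.m_closed[OF T]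
      by (simp add: generate.incl)
    then obtain j :: nat where j: "u \<otimes> t \<otimes> inv u = t [^] j" using mem_generate_singleton[OF t] by blast
    obtain i :: nat where i: "x = t [^] i" using x mem_generate_singleton[OF t] by blast
    have "u \<otimes> x \<otimes> inv u = (t [^] j) [^] i" using conj_pow[OF u t, of i] i j by simp
    also have "\<dots> = x [^] j" using i t by (simp add: nat_pow_pow mult.commute)
    finally show ?thesis by blast
  qed
  let ?c = "commutator G h d"
  have c: "?c \<in> carrier G" "?c \<in> generate G {t}" using h d all by auto
  show ?thesis
  proof (cases "p = 2")
    case True
    have sq: "x [^] p = x \<otimes> x" if "x \<in> carrier G" for x using that True by (simp add: numeral_2_eq_2)
    have hh: "(h \<otimes> h) \<otimes> d = d \<otimes> (h \<otimes> h)" using hp h by (simp add: sq)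
    note inv2 = commutator_involution_of_square[OF modl True h d hh]
    obtain j :: nat where j: "d \<otimes> ?c \<otimes> inv d = ?c [^] j" using conj_T[OF d c(2)] by blast
    have c4: "?c [^] (4::nat) = \<one>" using inv2(2) c(1) by (simp add: numeral_eq_Suc m_assoc)
    have jm: "?c [^] (j mod 4) = ?c [^] j" by (rule pow_mod_of_pow_eq_one[OF c(1) c4])
    have "?c \<otimes> ?c = \<one>"
    \<comment> \<open>Only \<open>j\<close> modulo 4 counts. An even \<open>j\<close> sends
      \<open>c^2\<close> to \<open>\<one>\<close>, the value 1 is the commuting case, and 3 is
      reduced to it by replacing \<open>d\<close> with \<open>h d\<close>.\<close>
    proof (cases "even j")
      case even: True
      have "d \<otimes> (?c \<otimes> ?c) \<otimes> inv d = ?c [^] (2 * j)"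
        using conj_mult[OF d c(1) c(1)] j c(1) by (simp add: nat_pow_mult mult_2)
      also have "2 * j = 4 * (j div 2)" using even by simp
      also have "?c [^] (4 * (j div 2)) = \<one>"
        using c4 c(1) nat_pow_pow[OF c(1), of 4 "j div 2"] by simp
      finally have "d \<otimes> (?c \<otimes> ?c) = d" using d c(1) by (simp add: inv_solve_right')
      then show ?thesis using d c(1) by simp
    next
      case False
      have "j mod 4 = 1 \<or> j mod 4 = 3" using False by presburger
      then consider "?c [^] j = ?c" | "?c [^] j = inv ?c"
      proof
        assume "j mod 4 = 1"
        then show thesis using jm c(1) that by simp
      next
        assume j3: "j mod 4 = 3"
        have "?c [^] (3::nat) \<otimes> ?c = \<one>" using c4 by (simp add: numeral_eq_Suc)
        then have "inv ?c = ?c [^] (3::nat)" using c(1) by (intro inv_equality) auto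
        then show thesis using jm j3 that by simp
      qed
      then show ?thesis
      proof cases
        case 1
        then have "?c \<otimes> d = d \<otimes> ?c" using j conj_eq_iff[OF d c(1)] by simp
        then show ?thesis by (rule inv2(3))
      next
        case 2
        \<comment> \<open>Both \<open>h\<close> and \<open>d\<close> invert \<open>c\<close>, so
          \<open>h d\<close> commutes with \<open>c\<close>, and
          \<open>[h, h d] = c^-1\<close>.\<close>
        let ?d = "h \<otimes> d"
        have d': "?d \<in> carrier G" using h d by simp
        have hh': "(h \<otimes> h) \<otimes> ?d = ?d \<otimes> (h \<otimes> h)"
        proof -
          have "(h \<otimes> h) \<otimes> ?d = h \<otimes> ((h \<otimes> h) \<otimes> d)" using h d by (simp add: m_assoc)
          then show ?thesis unfolding hh using h d by (simp add: m_assoc)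
        qed
        have c': "commutator G h ?d = inv ?c"
        proof -
          have "commutator G h ?d = h \<otimes> ?c \<otimes> inv h" using h d by (simp add: commutator_def m_assoc inv_mult_group)
          then show ?thesis using inv2(1) by simp
        qed
        have "?d \<otimes> ?c \<otimes> inv ?d = h \<otimes> inv ?c \<otimes> inv h" using conj_conj[OF h d c(1)] j 2 by simp
        also have "\<dots> = inv (h \<otimes> ?c \<otimes> inv h)" using h c(1) by (simp add: m_assoc inv_mult_group)
        also have "\<dots> = ?c" using inv2(1) c(1) by simp
        finally have "?d \<in> C ?c" using conj_eq_iff[OF d' c(1)] d' by (simp add: mem_centralizer_singleton)
        then have "?c \<in> C ?d" using c(1) by (simp add: mem_centralizer_singleton)
        then have "inv ?c \<in> C ?d" using subgroup.m_inv_closed[OF subgroup_C[OF d']] by blast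
        then have "commutator G h ?d \<otimes> ?d = ?d \<otimes> commutator G h ?d"
          unfolding c' by (simp add: mem_centralizer_singleton)
        from commutator_involution_of_square(3)[OF modl True h d' hh' this]
        have "inv (?c \<otimes> ?c) = \<one>" unfolding c' using c(1) by (simp add: inv_mult_group)
        then show ?thesis using c(1) by simp
      qed
    qed
    then show ?thesis using sq[OF c(1)] by simp
  next
    case False
    then have podd: "odd p" using prime_p prime_odd_nat by (metis prime_ge_2_nat le_neq_implies_less)
    show ?thesis
    proof (cases "?c = \<one>")
      case c1: False
      obtain r :: nat where r: "h \<otimes> ?c \<otimes> inv h = ?c [^] r" using conj_T[OF h c(2)] by blast
      have r1: "[r = 1] (mod p)"
        by (rule conj_exponent_cong[where P = "{\<one>}" and z = \<one>, OF triv_subgroup _ _ h c(1) c1])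
          (use r c(1) subgroup.one_closed[OF subgroup_group_center] generate.one in auto)
      have "r \<noteq> 0" using r1 prime_gt_1_nat[OF prime_p] by (cases "r = 0") (auto simp: cong_def)
      have sum: "h [^] m \<otimes> d \<otimes> inv (h [^] m) = ?c [^] (\<Sum>i<m. r ^ i) \<otimes> d" for m
      proof (induct m)
        case (Suc m)
        have "h [^] Suc m \<otimes> d \<otimes> inv (h [^] Suc m) = h \<otimes> (?c [^] (\<Sum>i<m. r ^ i) \<otimes> d) \<otimes> inv h"
          using h d Suc by (simp only: nat_pow_Suc2 conj_conj nat_pow_closed)
        also have "\<dots> = (h \<otimes> ?c [^] (\<Sum>i<m. r ^ i) \<otimes> inv h) \<otimes> (h \<otimes> d \<otimes> inv h)"
          using h d c(1) by (intro conj_mult) auto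
        also have "\<dots> = (?c [^] r) [^] (\<Sum>i<m. r ^ i) \<otimes> (?c \<otimes> d)"
          by (simp only: conj_pow[OF h c(1), symmetric] r conj_eq_commutator[OF h d])
        also have "\<dots> = ?c [^] (r * (\<Sum>i<m. r ^ i) + 1) \<otimes> d"
          using c(1) d by (simp add: nat_pow_pow m_assoc)
        also have "r * (\<Sum>i<m. r ^ i) + 1 = (\<Sum>i<Suc m. r ^ i)"
          by (simp add: sum_distrib_left sum.lessThan_Suc_shift del: sum.lessThan_Suc)
        finally show ?case .
      qed (use d in simp)
      let ?S = "\<Sum>i<p. r ^ i"
      have "d = ?c [^] ?S \<otimes> d" using sum[of p] conj_commuting[OF _ d hp] h by simp
      then have "?c [^] ?S = \<one>" using c(1) d by (metis l_cancel_one' nat_pow_closed r_cancel_one')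
      then have dS: "ord ?c dvd ?S" using pow_eq_id[OF c(1)] by simp
      have "ord ?c dvd p ^ n" using ord_dvd_group_order[OF c(1)] by (simp add: order_eq)
      then obtain k where k: "ord ?c = p ^ k" using divides_primepow_nat[OF prime_p] by blast
      have "k \<le> 1"
      proof (rule ccontr)
        assume "\<not> k \<le> 1"
        then have "p\<^sup>2 dvd ord ?c" using k le_imp_power_dvd[of 2 k p] by simp
        then have "p\<^sup>2 dvd ?S" using dS dvd_trans by blast
        then have "p\<^sup>2 dvd p"
          using geometric_sum_cong[OF podd r1] \<open>r \<noteq> 0\<close> cong_dvd_iff by (metis One_nat_def Suc_leI gr0I cong_sym cong_dvd_modulus_nat dvd_refl)
        then show False using prime_gt_1_nat[OF prime_p] by (simp add: power2_eq_square)
      qed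
      then have "ord ?c dvd p" using k le_imp_power_dvd[of k 1 p] by simp
      then show ?thesis using pow_eq_id[OF c(1)] by simp
    qed simp
  qed
qed

theorem balanced_of_modular_cyclic:
  assumes modl: "modular_lattice (inclusion_order (center_interval G))"
    and t: "t \<in> carrier G"
    and all: "\<And>u v. u \<in> carrier G \<Longrightarrow> v \<in> carrier G \<Longrightarrow> commutator G u v \<in> generate G {t}"
  shows "balanced G"
proof -
  let ?A = "{x \<in> generate G {t}. x [^] p = \<one>}"
  have T: "subgroup (generate G {t}) G" using t by (intro generate_is_subgroup) auto
  have finA: "finite ?A" using finite_subgroup[OF T] by simp
  have step: "card (centralizer G K) \<le> p * card (centralizer G (generate G (insert h K)))"
    if K: "subgroup K G" and h: "h \<in> carrier G" "h [^] p \<in> K" for K h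
  proof -
    have Kc: "K \<subseteq> carrier G" by (rule subgroup.subset[OF K])
    let ?D = "centralizer G K"
    have D: "subgroup ?D G" by (rule subgroup_centralizer[OF Kc])
    have DI: "subgroup (?D \<inter> C h) G" using subgroups_Inter_pair D subgroup_C h by blast
    have gen: "centralizer G (generate G (insert h K)) = ?D \<inter> C h"
      using centralizer_generate[of "insert h K"] centralizer_Un[of G "{h}" K] Kc h by auto
    have D_fib: "?D = (\<Union>a\<in>?A. {d \<in> ?D. commutator G h d = a})"
    proof -
      have "commutator G h d \<in> ?A" if "d \<in> ?D" for d
      proof -
        have d: "d \<in> carrier G" "h [^] p \<otimes> d = d \<otimes> h [^] p" using that h by (auto simp: centralizer_def)
        then show ?thesis using commutator_exponent_of_power[OF modl t all h(1) d] all[OF h(1) d(1)] by simp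
      qed
      then show ?thesis by blast
    qed
    \<comment> \<open>Elements with the same commutator with \<open>h\<close> differ by a right
      factor commuting with \<open>h\<close>, so each fibre fits into one coset of
      \<open>?D \<inter> C h\<close>.\<close>
    have fib: "card {d \<in> ?D. commutator G h d = a} \<le> card (?D \<inter> C h)" for a
    proof (cases "{d \<in> ?D. commutator G h d = a} = {}")
      case False
      then obtain e where e: "e \<in> ?D" "commutator G h e = a" by blast
      have ec: "e \<in> carrier G" using e by (simp add: centralizer_def)
      have "{d \<in> ?D. commutator G h d = a} \<subseteq> (\<lambda>x. e \<otimes> x) ` (?D \<inter> C h)"
      proof
        fix d assume d: "d \<in> {d \<in> ?D. commutator G h d = a}"
        then have dc: "d \<in> carrier G" by (simp add: centralizer_def)
        have x: "inv e \<otimes> d \<in> ?D"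
          using d e subgroup.m_closed[OF D] subgroup.m_inv_closed[OF D] by blast
        have "h \<otimes> (inv e \<otimes> d) \<otimes> inv h = inv (h \<otimes> e \<otimes> inv h) \<otimes> (h \<otimes> d \<otimes> inv h)"
          using h ec dc by (simp add: m_assoc inv_mult_group)
        also have "\<dots> = inv (a \<otimes> e) \<otimes> (a \<otimes> d)" using conj_eq_commutator h ec dc e d by auto
        also have "\<dots> = inv e \<otimes> d" using e d ec dc h by (auto simp: inv_mult_group m_assoc)
        finally have "inv e \<otimes> d \<in> C h"
          using conj_eq_iff[OF h(1), of "inv e \<otimes> d"] ec dc by (simp add: mem_centralizer_singleton)
        moreover have "d = e \<otimes> (inv e \<otimes> d)" using ec dc by simp
        ultimately show "d \<in> (\<lambda>x. e \<otimes> x) ` (?D \<inter> C h)" using x by blast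
      qed
      from surj_card_le[OF finite_subgroup[OF DI] this] show ?thesis .
    next
      case True
      show ?thesis unfolding True by simp
    qed
    have "card ?D \<le> (\<Sum>a\<in>?A. card {d \<in> ?D. commutator G h d = a})"
      by (subst D_fib) (rule card_UN_le[OF finA])
    also have "\<dots> \<le> card ?A * card (?D \<inter> C h)" using sum_bounded_above[of ?A, OF fib] by simp
    also have "\<dots> \<le> p * card (?D \<inter> C h)" by (rule mult_le_mono1[OF card_exponent_le[OF t prime_p]])
    finally show ?thesis unfolding gen .
  qed
  have mono: "card (centralizer G K) * card K \<le> card (centralizer G L) * card L"
    if "subgroup K G" "Z \<subseteq> K" "K \<subseteq> L" "subgroup L G" for K L
    by (rule chain_mono[where E = Z and f = "\<lambda>H. card (centralizer G H)"]) (use step that in auto)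
  show ?thesis
    unfolding balanced_def
  proof
    fix H assume "H \<in> center_interval G"
    then have H: "subgroup H G" "Z \<subseteq> H" by (auto simp: center_interval_def)
    have "order G * card Z \<le> card (centralizer G H) * card H"
      using mono[OF subgroup_group_center _ H(2,1)] by (simp add: centralizer_center order_def)
    moreover have "card (centralizer G H) * card H \<le> card Z * order G"
      using mono[OF H subgroup.subset[OF H(1)] subgroup_self] by (simp add: group_center_eq order_def)
    ultimately show "CD_measure G H = order G * card Z" by (simp add: CD_measure_def mult.commute)
  qed
qed

end

section \<open>Restriction to factors and coprime products\<close>

context group
begin

lemma centralizer_restrict:
  assumes "S \<subseteq> carrier G" shows "centralizer (G\<lparr>carrier := S\<rparr>) H = S \<inter> centralizer G H"
  using assms by (auto simp: centralizer_def)

text \<open>Expresses balance of a factor through centralizers in \<open>G\<close>, so that several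
  factors can be handled in one ambient group.\<close>

lemma balanced_restrict_iff:
  assumes S: "subgroup S G"
  shows "balanced (G\<lparr>carrier := S\<rparr>) \<longleftrightarrow>
    (\<forall>H. subgroup H G \<longrightarrow> S \<inter> centralizer G S \<subseteq> H \<longrightarrow> H \<subseteq> S \<longrightarrow>
      card H * card (S \<inter> centralizer G H) = card S * card (S \<inter> centralizer G S))"
proof -
  have sub: "subgroup H (G\<lparr>carrier := S\<rparr>) \<longleftrightarrow> subgroup H G \<and> H \<subseteq> S" for H
    using incl_subgroup[OF S] subgroup_incl[OF _ S] subgroup.subset[of H "G\<lparr>carrier := S\<rparr>"] by auto
  show ?thesis
    using sub
    by (auto simp: balanced_def center_interval_def CD_measure_def group_center_eq order_def
        centralizer_restrict[OF subgroup.subset[OF S]])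
qed

lemma commutator_restrict:
  assumes "subgroup S G" "x \<in> S" "y \<in> S"
  shows "commutator (G\<lparr>carrier := S\<rparr>) x y = commutator G x y"
  using assms by (simp add: commutator_def)

lemma cyclic_subgroup_iff:
  assumes D: "subgroup D G"
  shows "cyclic_group (G\<lparr>carrier := D\<rparr>) \<longleftrightarrow> (\<exists>t\<in>D. D = generate G {t})"
proof -
  interpret D: group "G\<lparr>carrier := D\<rparr>" by (rule subgroup_imp_group[OF D])
  have "range (\<lambda>n::int. x [^]\<^bsub>G\<lparr>carrier := D\<rparr>\<^esub> n) = generate G {x}" if "x \<in> D" for x
    using that generate_pow[of x] subgroup.mem_carrier[OF D that] int_pow_consistent[OF D that] by auto
  then show ?thesis by (simp add: D.cyclic_group)
qed

lemma commutator_mem_derived: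
  "u \<in> S \<Longrightarrow> v \<in> S \<Longrightarrow> commutator G u v \<in> derived G S"
  unfolding derived_def commutator_def by (intro generate.incl) auto

lemma commutators_in_cyclic_of_cyclic_derived:
  assumes S: "subgroup S G" and cyc: "cyclic_group (G\<lparr>carrier := derived G S\<rparr>)"
  shows "\<exists>t\<in>S. \<forall>u\<in>S. \<forall>v\<in>S. commutator G u v \<in> generate G {t}"
  using cyc cyclic_subgroup_iff[OF derived_is_subgroup[OF subgroup.subset[OF S]]]
    commutator_mem_derived derived_incl[OF subset_refl S] by blast

lemma cyclic_derivedI:
  assumes S: "subgroup S G" and x: "x \<in> S" "y \<in> S"
    and all: "\<And>u v. u \<in> S \<Longrightarrow> v \<in> S \<Longrightarrow> commutator G u v \<in> generate G {commutator G x y}"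
  shows "cyclic_group (G\<lparr>carrier := derived G S\<rparr>)"
proof -
  note Sc = subgroup.subset[OF S]
  have D: "subgroup (derived G S) G" by (rule derived_is_subgroup[OF Sc])
  have c: "commutator G x y \<in> carrier G" using x Sc by (auto intro!: commutator_closed)
  have "derived G S \<subseteq> generate G {commutator G x y}"
    unfolding derived_def
    using all c by (intro generate_subgroup_incl generate_is_subgroup) (auto simp: commutator_def)
  moreover have "generate G {commutator G x y} \<subseteq> derived G S"
    using commutator_mem_derived[OF x] by (intro generate_subgroup_incl D) auto
  ultimately show ?thesis using commutator_mem_derived[OF x] cyclic_subgroup_iff[OF D] by blast
qed

lemma subgroup_Int_centralizer:
  "subgroup U G \<Longrightarrow> A \<subseteq> carrier G \<Longrightarrow> subgroup (U \<inter> centralizer G A) G"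
  using subgroups_Inter_pair subgroup_centralizer by blast

text \<open>\<open>V\<close> centralizes \<open>A\<close> and \<open>U\<close> centralizes
  \<open>B\<close>, so the condition on \<open>u v\<close> splits into one on \<open>u\<close> and
  one on \<open>v\<close>. The units put \<open>A\<close> and \<open>B\<close> inside the product
  set.\<close>

lemma centralizer_set_mult:
  assumes U: "subgroup U G" and V: "subgroup V G" and UV: "V \<subseteq> centralizer G U"
    and A: "A \<subseteq> U" "\<one> \<in> A" and B: "B \<subseteq> V" "\<one> \<in> B"
  shows "(U <#> V) \<inter> centralizer G (A <#> B) = (U \<inter> centralizer G A) <#> (V \<inter> centralizer G B)"
proof -
  note Uc = subgroup.subset[OF U] and Vc = subgroup.subset[OF V]
  have Ac: "A \<subseteq> carrier G" and Bc: "B \<subseteq> carrier G" using A B Uc Vc by auto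
  have VU: "u \<in> centralizer G V" if "u \<in> U" for u using UV that Uc by (fastforce simp: centralizer_def)
  have cA: "subgroup (centralizer G A) G" and cB: "subgroup (centralizer G B) G"
    using Ac Bc by (auto intro: subgroup_centralizer)
  have VA: "v \<in> centralizer G A" if "v \<in> V" for v using UV that A by (auto simp: centralizer_def)
  have UB: "u \<in> centralizer G B" if "u \<in> U" for u using VU[OF that] B by (auto simp: centralizer_def)
  show ?thesis
  proof
    show "(U <#> V) \<inter> centralizer G (A <#> B) \<subseteq> (U \<inter> centralizer G A) <#> (V \<inter> centralizer G B)"
    proof
      fix x assume x: "x \<in> (U <#> V) \<inter> centralizer G (A <#> B)"
      then obtain u v where uv: "u \<in> U" "v \<in> V" "x = u \<otimes> v" by (auto elim: set_multE)
      have c: "u \<in> carrier G" "v \<in> carrier G" using uv Uc Vc by auto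
      have "a \<in> A <#> B" if "a \<in> A" for a
        using set_multI[OF that B(2), of G] subsetD[OF Ac that] by simp
      moreover have "b \<in> A <#> B" if "b \<in> B" for b
        using set_multI[OF A(2) that, of G] subsetD[OF Bc that] by simp
      ultimately have xAB: "x \<in> centralizer G A" "x \<in> centralizer G B" using x by (auto simp: centralizer_def)
      have "x \<otimes> inv v \<in> centralizer G A" "inv u \<otimes> x \<in> centralizer G B"
        using xAB VA[OF uv(2)] UB[OF uv(1)] cA cB by (auto intro: subgroup.m_closed subgroup.m_inv_closed)
      then have "u \<in> centralizer G A" "v \<in> centralizer G B" using uv c by (auto simp: m_assoc)
      then show "x \<in> (U \<inter> centralizer G A) <#> (V \<inter> centralizer G B)"
        using uv by (auto intro: set_multI)
    qed
    show "(U \<inter> centralizer G A) <#> (V \<inter> centralizer G B) \<subseteq> (U <#> V) \<inter> centralizer G (A <#> B)"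
    proof
      fix x assume "x \<in> (U \<inter> centralizer G A) <#> (V \<inter> centralizer G B)"
      then obtain u v where uv: "u \<in> U" "u \<in> centralizer G A" "v \<in> V" "v \<in> centralizer G B" "x = u \<otimes> v"
        by (auto elim!: set_multE)
      have x: "x \<in> centralizer G A" "x \<in> centralizer G B"
        using uv VA UB cA cB by (auto intro: subgroup.m_closed)
      then have xc: "x \<in> carrier G" by (simp add: centralizer_def)
      have "A \<subseteq> centralizer G {x}" "B \<subseteq> centralizer G {x}"
        using x Ac Bc by (auto simp: centralizer_def)
      then have "A <#> B \<subseteq> centralizer G {x}"
        using subgroup.m_closed[OF subgroup_centralizer[of "{x}"]] xc by (auto elim!: set_multE)
      then show "x \<in> (U <#> V) \<inter> centralizer G (A <#> B)"
        using uv xc by (auto simp: centralizer_def intro: set_multI)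
    qed
  qed
qed

end

context finite_group
begin

lemma card_set_mult_disjoint:
  assumes "subgroup A G" "subgroup B G" "A \<inter> B \<subseteq> {\<one>}"
  shows "card (A <#> B) = card A * card B"
proof -
  have "A \<inter> B = {\<one>}" using assms subgroup.one_closed by blast
  then show ?thesis using card_set_mult[OF assms(1,2)] by simp
qed

lemma subgroup_set_mult_commuting:
  assumes A: "subgroup A G" and B: "subgroup B G" and "B \<subseteq> centralizer G A"
  shows "subgroup (A <#> B) G"
proof (rule subgroup_set_mult[OF A B])
  show "B <#> A \<subseteq> A <#> B"
  proof
    fix x assume "x \<in> B <#> A"
    then obtain b a where "b \<in> B" "a \<in> A" "x = b \<otimes> a" by (rule set_multE)
    then show "x \<in> A <#> B" using assms(3) set_multI[of a A b B G] by (auto simp: centralizer_def)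
  qed
qed

text \<open>Balance is applied to \<open>H V\<close>. All four orders factor, and the contribution
  |V| |Z(V)| cancels.\<close>

lemma balanced_left_factor:
  assumes bal: "balanced G" and U: "subgroup U G" and V: "subgroup V G"
    and UV: "V \<subseteq> centralizer G U" "U \<inter> V \<subseteq> {\<one>}" "U <#> V = carrier G"
  shows "balanced (G\<lparr>carrier := U\<rparr>)"
  unfolding balanced_restrict_iff[OF U]
proof (intro allI impI)
  fix H assume H: "subgroup H G" "U \<inter> centralizer G U \<subseteq> H" "H \<subseteq> U"
  note Uc = subgroup.subset[OF U] and Vc = subgroup.subset[OF V]
  note one = subgroup.one_closed[OF U] subgroup.one_closed[OF V] subgroup.one_closed[OF H(1)]
  have HV: "V \<subseteq> centralizer G H" using UV(1) H(3) by (auto simp: centralizer_def)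
  let ?K = "H <#> V"
  have K: "subgroup ?K G" by (rule subgroup_set_mult_commuting[OF H(1) V HV])
  have CK: "centralizer G ?K = (U \<inter> centralizer G H) <#> (V \<inter> centralizer G V)"
    using centralizer_set_mult[OF U V UV(1) H(3) one(3) subset_refl one(2)] centralizer_subset[of G ?K]
    unfolding UV(3) by blast
  have CG: "group_center G = (U \<inter> centralizer G U) <#> (V \<inter> centralizer G V)"
    using centralizer_set_mult[OF U V UV(1) subset_refl one(1) subset_refl one(2)]
      centralizer_subset[of G "carrier G"]
    unfolding UV(3) group_center_eq by blast
  have Z: "group_center G \<subseteq> ?K" unfolding CG using H(2) by (intro mono_set_mult) auto
  have UH: "subgroup (U \<inter> centralizer G H) G" and UU: "subgroup (U \<inter> centralizer G U) G"
    and VV: "subgroup (V \<inter> centralizer G V) G"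
    using subgroup_Int_centralizer U V Uc Vc H(3) by auto
  have "card ?K * card (centralizer G ?K) = order G * card (group_center G)"
    by (rule balancedD[OF bal K Z])
  moreover have "card ?K = card H * card V"
    using UV(2) H(3) by (intro card_set_mult_disjoint H(1) V) auto
  moreover have "card (centralizer G ?K) = card (U \<inter> centralizer G H) * card (V \<inter> centralizer G V)"
    unfolding CK using UV(2) by (intro card_set_mult_disjoint UH VV) auto
  moreover have "card (group_center G) = card (U \<inter> centralizer G U) * card (V \<inter> centralizer G V)"
    unfolding CG using UV(2) by (intro card_set_mult_disjoint UU VV) auto
  moreover have "order G = card U * card V"
    unfolding order_def UV(3)[symmetric] by (rule card_set_mult_disjoint[OF U V UV(2)])
  ultimately have "(card V * card (V \<inter> centralizer G V)) * (card H * card (U \<inter> centralizer G H))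
      = (card V * card (V \<inter> centralizer G V)) * (card U * card (U \<inter> centralizer G U))"
    by (simp only: ac_simps)
  then show "card H * card (U \<inter> centralizer G H) = card U * card (U \<inter> centralizer G U)"
    using card_subgroup_pos[OF V] card_subgroup_pos[OF VV] by simp
qed

lemma pow_card_subgroup:
  assumes "subgroup U G" "u \<in> U" shows "u [^] card U = \<one>"
proof -
  interpret U: group "G\<lparr>carrier := U\<rparr>" by (rule subgroup_imp_group[OF assms(1)])
  show ?thesis using U.pow_order_eq_1[of u] assms(2) by (simp add: order_def flip: nat_pow_consistent)
qed

lemma Int_trivial_of_coprime:
  assumes U: "subgroup U G" and V: "subgroup V G" and cop: "coprime (card U) (card V)"
  shows "U \<inter> V = {\<one>}"
proof -
  have "subgroup (U \<inter> V) G" by (rule subgroups_Inter_pair[OF U V])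
  then have "card (U \<inter> V) dvd card U" "card (U \<inter> V) dvd card V"
    using card_subgroup_dvd U V by auto
  then have "card (U \<inter> V) = 1" using cop by (metis coprime_common_divisor_nat)
  moreover have "\<one> \<in> U \<inter> V" using U V subgroup.one_closed by blast
  ultimately show ?thesis by (metis card_1_singletonE singletonD)
qed

text \<open>The Chinese remainder theorem provides an exponent \<open>e\<close> with
  \<open>(u v)^e = u\<close>.\<close>

lemma subgroup_of_coprime_product:
  assumes U: "subgroup U G" and V: "subgroup V G" and UV: "V \<subseteq> centralizer G U"
    and cop: "coprime (card U) (card V)" and H: "subgroup H G" "H \<subseteq> U <#> V"
  shows "H = (H \<inter> U) <#> (H \<inter> V)"
proof
  show "(H \<inter> U) <#> (H \<inter> V) \<subseteq> H" using subgroup.m_closed[OF H(1)] by (auto elim!: set_multE)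
  show "H \<subseteq> (H \<inter> U) <#> (H \<inter> V)"
  proof
    fix h assume h: "h \<in> H"
    then obtain u v where uv: "u \<in> U" "v \<in> V" "h = u \<otimes> v" using H(2) by (blast elim: set_multE)
    have c: "u \<in> carrier G" "v \<in> carrier G"
      using uv subgroup.mem_carrier[OF U] subgroup.mem_carrier[OF V] by auto
    have "u \<otimes> v = v \<otimes> u" using uv UV by (auto simp: centralizer_def)
    obtain e where e: "[e = 1] (mod card U)" "[e = 0] (mod card V)"
      using binary_chinese_remainder_nat[OF cop] by blast
    have "h [^] e = u [^] e \<otimes> v [^] e" using pow_mult_distrib[OF \<open>u \<otimes> v = v \<otimes> u\<close> c] uv by simp
    also have "u [^] e = u [^] (1::nat)"
      by (rule pow_eq_of_cong[OF c(1) pow_card_subgroup[OF U uv(1)] e(1)])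
    also have "v [^] e = v [^] (0::nat)"
      by (rule pow_eq_of_cong[OF c(2) pow_card_subgroup[OF V uv(2)] e(2)])
    finally have "u \<in> H" using subgroup_pow_closed[OF H(1) h, of e] c by simp
    moreover have "v = inv u \<otimes> h" using uv c by simp
    ultimately have "v \<in> H" using h subgroup.m_closed[OF H(1)] subgroup.m_inv_closed[OF H(1)] by metis
    then show "h \<in> (H \<inter> U) <#> (H \<inter> V)" using uv \<open>u \<in> H\<close> by (auto intro: set_multI)
  qed
qed

text \<open>Every subgroup splits along the two factors, so the balance equation is the product of
  those for \<open>U\<close> and \<open>V\<close>.\<close>

lemma balanced_coprime_product:
  assumes U: "subgroup U G" and V: "subgroup V G" and UV: "V \<subseteq> centralizer G U"
    and cop: "coprime (card U) (card V)"
    and balU: "balanced (G\<lparr>carrier := U\<rparr>)" and balV: "balanced (G\<lparr>carrier := V\<rparr>)"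
  shows "balanced (G\<lparr>carrier := U <#> V\<rparr>)"
proof -
  let ?W = "U <#> V" and ?C = "centralizer G"
  have W: "subgroup ?W G" by (rule subgroup_set_mult_commuting[OF U V UV])
  note Uc = subgroup.subset[OF U] and Vc = subgroup.subset[OF V]
  note one = subgroup.one_closed[OF U] subgroup.one_closed[OF V]
  have disj: "U \<inter> V \<subseteq> {\<one>}" using Int_trivial_of_coprime[OF U V cop] by simp
  have CW: "?W \<inter> ?C ?W = (U \<inter> ?C U) <#> (V \<inter> ?C V)"
    by (rule centralizer_set_mult[OF U V UV subset_refl one(1) subset_refl one(2)])
  have UU: "subgroup (U \<inter> ?C U) G" and VV: "subgroup (V \<inter> ?C V) G"
    using subgroup_Int_centralizer U V Uc Vc by auto
  show ?thesis
    unfolding balanced_restrict_iff[OF W]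
  proof (intro allI impI)
    fix H assume H: "subgroup H G" "?W \<inter> ?C ?W \<subseteq> H" "H \<subseteq> ?W"
    let ?A = "H \<inter> U" and ?B = "H \<inter> V"
    have A: "subgroup ?A G" and B: "subgroup ?B G" using subgroups_Inter_pair H(1) U V by auto
    have HAB: "H = ?A <#> ?B" by (rule subgroup_of_coprime_product[OF U V UV cop H(1,3)])
    have CH: "?W \<inter> ?C H = (U \<inter> ?C ?A) <#> (V \<inter> ?C ?B)"
      using centralizer_set_mult[OF U V UV, of ?A ?B] subgroup.one_closed[OF A] subgroup.one_closed[OF B]
      by (simp flip: HAB)
    note UA = subgroup_Int_centralizer[OF U subgroup.subset[OF A]]
      and VB = subgroup_Int_centralizer[OF V subgroup.subset[OF B]]
    have "U \<inter> ?C U \<subseteq> ?W \<inter> ?C ?W" "V \<inter> ?C V \<subseteq> ?W \<inter> ?C ?W"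
      unfolding CW using subset_set_mult[OF UU VV] by auto
    then have inc: "U \<inter> ?C U \<subseteq> ?A" "V \<inter> ?C V \<subseteq> ?B" using H(2) by blast+
    note a = balU[unfolded balanced_restrict_iff[OF U], rule_format, OF A inc(1) Int_lower2]
      and b = balV[unfolded balanced_restrict_iff[OF V], rule_format, OF B inc(2) Int_lower2]
    have "card H = card ?A * card ?B"
      by (subst HAB, rule card_set_mult_disjoint[OF A B]) (use disj in auto)
    moreover have "card (?W \<inter> ?C H) = card (U \<inter> ?C ?A) * card (V \<inter> ?C ?B)"
      unfolding CH by (rule card_set_mult_disjoint[OF UA VB]) (use disj in auto)
    moreover have "card ?W = card U * card V" by (rule card_set_mult_disjoint[OF U V disj])
    moreover have "card (?W \<inter> ?C ?W) = card (U \<inter> ?C U) * card (V \<inter> ?C V)"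
      unfolding CW by (rule card_set_mult_disjoint[OF UU VV]) (use disj in auto)
    ultimately have "card H * card (?W \<inter> ?C H)
        = (card ?A * card (U \<inter> ?C ?A)) * (card ?B * card (V \<inter> ?C ?B))"
      "card ?W * card (?W \<inter> ?C ?W) = (card U * card (U \<inter> ?C U)) * (card V * card (V \<inter> ?C V))"
      by (simp_all only: ac_simps)
    then show "card H * card (?W \<inter> ?C H) = card ?W * card (?W \<inter> ?C ?W)" using a b by simp
  qed
qed

lemma generate_normal_insert:
  assumes U: "U \<lhd> G" and V: "generate G X' \<lhd> G" and X': "X' \<subseteq> carrier G"
  shows "generate G (U \<union> X') = U <#> generate G X'"
proof -
  note sU = normal_imp_subgroup[OF U] and sV = normal_imp_subgroup[OF V]
  have UV: "subgroup (U <#> generate G X') G"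
    by (rule subgroup_set_mult[OF sU sV]) (simp add: commut_normal[OF sU V])
  have X: "U \<union> X' \<subseteq> carrier G" using X' subgroup.subset[OF sU] by blast
  have "generate G (U \<union> X') \<subseteq> U <#> generate G X'"
    using subset_set_mult[OF sU sV] by (intro generate_subgroup_incl UV) (auto intro: generate.incl)
  moreover have "U <#> generate G X' \<subseteq> generate G (U \<union> X')"
    using mono_generate[of X' "U \<union> X'"] by (auto elim!: set_multE intro!: generate.eng intro: generate.incl)
  ultimately show ?thesis by blast
qed

lemma generate_normal_family:
  assumes "finite I" "\<And>i. i \<in> I \<Longrightarrow> Hs i \<lhd> G"
  shows "generate G (\<Union>i\<in>I. Hs i) \<lhd> G" and "card (generate G (\<Union>i\<in>I. Hs i)) dvd (\<Prod>i\<in>I. card (Hs i))"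
proof -
  have norm: "generate G (\<Union>i\<in>J. Hs i) \<lhd> G" and sub: "(\<Union>i\<in>J. Hs i) \<subseteq> carrier G" if J: "J \<subseteq> I" for J
  proof -
    have n: "Hs i \<lhd> G" if "i \<in> J" for i using that J assms(2) by blast
    show s: "(\<Union>i\<in>J. Hs i) \<subseteq> carrier G" using n normal_imp_subgroup subgroup.subset by blast
    show "generate G (\<Union>i\<in>J. Hs i) \<lhd> G"
    proof (rule normal_generateI[OF s])
      fix h g assume "h \<in> (\<Union>i\<in>J. Hs i)" and g: "g \<in> carrier G"
      then obtain i where i: "i \<in> J" "h \<in> Hs i" by blast
      then show "g \<otimes> h \<otimes> inv g \<in> (\<Union>i\<in>J. Hs i)"
        using normal.inv_op_closed2[OF n[OF i(1)] g i(2)] by blast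
    qed
  qed
  show "generate G (\<Union>i\<in>I. Hs i) \<lhd> G" by (rule norm) simp
  have "card (generate G (\<Union>i\<in>J. Hs i)) dvd (\<Prod>i\<in>J. card (Hs i))" if "J \<subseteq> I" for J
    using finite_subset[OF that assms(1)] that
  proof (induct J)
    case (insert i J)
    then have i: "Hs i \<lhd> G" and J: "J \<subseteq> I" using assms(2) by auto
    have "generate G (\<Union>j\<in>insert i J. Hs j) = Hs i <#> generate G (\<Union>j\<in>J. Hs j)"
      using generate_normal_insert[OF i norm[OF J] sub[OF J]] by simp
    moreover have "card (Hs i <#> generate G (\<Union>j\<in>J. Hs j)) dvd card (Hs i) * card (generate G (\<Union>j\<in>J. Hs j))"
      using card_set_mult[of "Hs i"] i norm[OF J] normal_imp_subgroup by (metis dvd_triv_left)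
    ultimately show ?case
      using insert(1,2) insert(3)[OF J] by (simp add: dvd_trans mult_dvd_mono)
  qed (simp add: generate_empty)
  then show "card (generate G (\<Union>i\<in>I. Hs i)) dvd (\<Prod>i\<in>I. card (Hs i))" by blast
qed

lemma balanced_trivial: "balanced (G\<lparr>carrier := {\<one>}\<rparr>)"
  unfolding balanced_restrict_iff[OF triv_subgroup]
  using subgroup.one_closed by (auto simp: centralizer_def dest: subset_singletonD) 

lemma normal_commuting:
  assumes "U \<lhd> G" "V \<lhd> G" "U \<inter> V \<subseteq> {\<one>}" shows "V \<subseteq> centralizer G U"
proof
  fix v assume v: "v \<in> V"
  then have "v \<in> carrier G" using assms(2) normal_imp_subgroup subgroup.mem_carrier by metis
  moreover have "u \<otimes> v = v \<otimes> u" if "u \<in> U" for u by (rule normal_imp_commuting[OF assms that v])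
  ultimately show "v \<in> centralizer G U" by (auto simp: centralizer_def)
qed

lemma balanced_coprime_family:
  assumes "finite I" "\<And>i. i \<in> I \<Longrightarrow> Hs i \<lhd> G" "\<And>i. i \<in> I \<Longrightarrow> balanced (G\<lparr>carrier := Hs i\<rparr>)"
    and "\<And>i j. i \<in> I \<Longrightarrow> j \<in> I \<Longrightarrow> i \<noteq> j \<Longrightarrow> coprime (card (Hs i)) (card (Hs j))"
  shows "balanced (G\<lparr>carrier := generate G (\<Union>i\<in>I. Hs i)\<rparr>)"
  using assms
proof (induct I)
  case empty
  then show ?case using balanced_trivial by (simp add: generate_empty)
next
  case (insert i I)
  let ?V = "generate G (\<Union>j\<in>I. Hs j)"
  have n: "\<And>j. j \<in> I \<Longrightarrow> Hs j \<lhd> G" using insert.prems(1) by blast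
  have V: "?V \<lhd> G" "card ?V dvd (\<Prod>j\<in>I. card (Hs j))"
    using generate_normal_family[OF insert.hyps(1), of Hs] n by blast+
  have U: "Hs i \<lhd> G" using insert.prems(1) by blast
  note sU = normal_imp_subgroup[OF U] and sV = normal_imp_subgroup[OF V(1)]
  have "coprime (card (Hs i)) (\<Prod>j\<in>I. card (Hs j))"
    using insert.prems(3) insert.hyps(2) by (intro prod_coprime_right) blast
  then have cop: "coprime (card (Hs i)) (card ?V)" by (rule coprime_divisors[OF dvd_refl V(2)])
  have com: "?V \<subseteq> centralizer G (Hs i)"
    using Int_trivial_of_coprime[OF sU sV cop] by (intro normal_commuting[OF U V(1)]) simp
  have "(\<Union>j\<in>I. Hs j) \<subseteq> carrier G"
    by (rule UN_least) (rule subgroup.subset[OF normal_imp_subgroup[OF n]])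
  then have "generate G (\<Union>j\<in>insert i I. Hs j) = Hs i <#> ?V"
    using generate_normal_insert[OF U V(1)] by simp
  moreover have "balanced (G\<lparr>carrier := ?V\<rparr>)" using insert.hyps(3) insert.prems by blast
  ultimately show ?case
    using balanced_coprime_product[OF sU sV com cop] insert.prems(2) by simp
qed

end

section \<open>Sylow subgroups and the decomposition\<close>

context finite_group
begin

text \<open>|K T| is |T| times the index of \<open>K \<inter> T\<close> in \<open>K\<close>, a power
  of \<open>p\<close>. It divides |G|, whose full \<open>p\<close>-part already divides |T|, so that
  index is 1.\<close>

lemma p_subgroup_subset:
  assumes p: "Factorial_Ring.prime p" and ord: "order G = p ^ a * m" "\<not> p dvd m"
    and K: "subgroup K G" "card K = p ^ b" and T: "subgroup T G" "p ^ a dvd card T"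
    and KT: "subgroup (K <#> T) G"
  shows "K \<subseteq> T"
proof -
  have I: "subgroup (K \<inter> T) G" by (rule subgroups_Inter_pair[OF K(1) T(1)])
  have "card (K \<inter> T) dvd p ^ b" using card_subgroup_dvd[OF I K(1)] K(2) by simp
  then obtain c where c: "c \<le> b" "card (K \<inter> T) = p ^ c" using divides_primepow_nat[OF p] by blast
  have p0: "0 < p" by (rule prime_gt_0_nat[OF p])
  have "card (K <#> T) * p ^ c = p ^ b * card T" using card_set_mult[OF K(1) T(1)] c K by simp
  also have "p ^ b = p ^ (b - c) * p ^ c" using c by (simp flip: power_add)
  finally have "card (K <#> T) = p ^ (b - c) * card T" using p0 by simp
  moreover have "card (K <#> T) dvd order G"
    using card_subgroup_dvd[OF KT subgroup_self subgroup.subset[OF KT]] by (simp add: order_def)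
  ultimately have "p ^ (b - c) * p ^ a dvd p ^ a * m" using T(2) ord by (metis dvd_trans mult_dvd_mono dvd_refl)
  then have "p ^ (b - c) dvd m" using p0 by (simp add: mult.commute)
  then have "b - c = 0" using ord(2) by (metis dvd_power dvd_trans not_gr_zero)
  then have "card (K \<inter> T) = card K" using c K by simp
  then have "K \<inter> T = K" using card_subset_eq[OF finite_subgroup[OF K(1)], of "K \<inter> T"] by simp
  then show ?thesis by blast
qed

lemma subgroup_conjugate:
  assumes P: "subgroup P G" and g: "g \<in> carrier G"
  shows "subgroup ((\<lambda>x. g \<otimes> x \<otimes> inv g) ` P) G" "card ((\<lambda>x. g \<otimes> x \<otimes> inv g) ` P) = card P"
proof -
  note Pc = subgroup.mem_carrier[OF P]
  show "subgroup ((\<lambda>x. g \<otimes> x \<otimes> inv g) ` P) G"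
  proof (rule finite_subgroupI)
    show "\<one> \<in> (\<lambda>x. g \<otimes> x \<otimes> inv g) ` P"
      using subgroup.one_closed[OF P] g by (intro image_eqI[of _ _ \<one>]) auto
    fix x y assume "x \<in> (\<lambda>x. g \<otimes> x \<otimes> inv g) ` P" "y \<in> (\<lambda>x. g \<otimes> x \<otimes> inv g) ` P"
    then obtain a b where ab: "a \<in> P" "b \<in> P" "x = g \<otimes> a \<otimes> inv g" "y = g \<otimes> b \<otimes> inv g" by blast
    then have "x \<otimes> y = g \<otimes> (a \<otimes> b) \<otimes> inv g" using conj_mult[OF g] Pc by simp
    then show "x \<otimes> y \<in> (\<lambda>x. g \<otimes> x \<otimes> inv g) ` P" using ab subgroup.m_closed[OF P] by blast
  qed (use Pc g in auto)
  have "inj_on (\<lambda>x. g \<otimes> x \<otimes> inv g) P" using Pc g by (auto simp: inj_on_def)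
  then show "card ((\<lambda>x. g \<otimes> x \<otimes> inv g) ` P) = card P" by (rule card_image)
qed

text \<open>Permutability is known only above the center, so \<open>P\<close> is compared with the
  product of a conjugate and \<open>Z\<close>. This product contains \<open>P\<close>, and the
  central factors that occur have \<open>p\<close>-power order, which places them in the
  conjugate.\<close>

lemma balanced_sylow_normal:
  assumes bal: "balanced G" and p: "Factorial_Ring.prime p" and ord: "order G = p ^ a * m" "\<not> p dvd m"
    and P: "subgroup P G" "card P = p ^ a"
  shows "P \<lhd> G"
proof -
  let ?Z = "group_center G"
  note Zs = subgroup_group_center
  have cZ: "?Z \<subseteq> centralizer G H" if "subgroup H G" for H
    by (rule group_center_subset_centralizer[OF subgroup.subset[OF that]])
  have sub: "P \<subseteq> (\<lambda>x. g \<otimes> x \<otimes> inv g) ` P" if g: "g \<in> carrier G" for g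
  proof
    let ?P = "(\<lambda>x. g \<otimes> x \<otimes> inv g) ` P"
    note P' = subgroup_conjugate[OF P(1) g]
    have P'c: "?P \<subseteq> carrier G" by (rule subgroup.subset[OF P'(1)])
    let ?T = "?P <#> ?Z"
    have T: "subgroup ?T G" "?Z \<subseteq> ?T" "?P \<subseteq> ?T"
      using subgroup_set_mult_commuting[OF P'(1) Zs cZ[OF P'(1)]] subset_set_mult[OF P'(1) Zs] by auto
    have PZ: "subgroup (P <#> ?Z) G" "?Z \<subseteq> P <#> ?Z"
      using subgroup_set_mult_commuting[OF P(1) Zs cZ[OF P(1)]] subset_set_mult[OF P(1) Zs] by auto
    have ZT: "?Z <#> ?T = ?T"
    proof
      show "?Z <#> ?T \<subseteq> ?T"
      proof
        fix x assume "x \<in> ?Z <#> ?T"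
        then obtain z u where "z \<in> ?Z" "u \<in> ?T" "x = z \<otimes> u" by (rule set_multE)
        then show "x \<in> ?T" using T(2) subgroup.m_closed[OF T(1)] by blast
      qed
    qed (use subset_set_mult[OF Zs T(1)] in auto)
    have "(P <#> ?Z) <#> ?T = P <#> ?T"
      using set_mult_assoc[OF subgroup.subset[OF P(1)] subgroup.subset[OF Zs] subgroup.subset[OF T(1)]]
      by (simp add: ZT)
    then have PT: "subgroup (P <#> ?T) G"
      using balanced_subgroup_set_mult[OF bal PZ T(1,2)] by simp
    have "p ^ a dvd card ?T" using card_subgroup_dvd[OF P'(1) T(1,3)] P'(2) P(2) by simp
    then have PsubT: "P \<subseteq> ?T" by (intro p_subgroup_subset[OF p ord P T(1) _ PT])
    fix x assume x: "x \<in> P"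
    then obtain y z where yz: "y \<in> ?P" "z \<in> ?Z" "x = y \<otimes> z" using PsubT by (blast elim: set_multE)
    have c: "y \<in> carrier G" "z \<in> carrier G" using yz P'c subgroup.mem_carrier[OF Zs] by auto
    have "y \<otimes> z = z \<otimes> y" using center_commute[OF yz(2) c(1)] by simp
    then have "x [^] (p ^ a) = y [^] (p ^ a) \<otimes> z [^] (p ^ a)"
      using pow_mult_distrib c yz(3) by simp
    moreover have "x [^] (p ^ a) = \<one>" "y [^] (p ^ a) = \<one>"
      using pow_card_subgroup[OF P(1) x] pow_card_subgroup[OF P'(1) yz(1)] P(2) P'(2) by auto
    ultimately have "z [^] (p ^ a) = \<one>" using c by simp
    then have "ord z dvd p ^ a" using pow_eq_id[OF c(2)] by simp
    then obtain b where b: "ord z = p ^ b" using divides_primepow_nat[OF p] by blast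
    let ?K = "generate G {z}"
    have K: "subgroup ?K G" using c by (intro generate_is_subgroup) auto
    have KZ: "?K \<subseteq> ?Z" using yz by (intro generate_subgroup_incl Zs) auto
    have "card ?K = p ^ b" using generate_pow_card[OF c(2)] b by simp
    moreover have "?P \<subseteq> centralizer G ?K"
      using KZ P'c by (auto simp: centralizer_def group_center_def subset_iff)
    then have "subgroup (?K <#> ?P) G" by (rule subgroup_set_mult_commuting[OF K P'(1)])
    ultimately have "?K \<subseteq> ?P"
      using P'(2) P(2) by (intro p_subgroup_subset[OF p ord K _ P'(1)]) auto
    then have "z \<in> ?P" by (auto intro: generate.incl)
    then show "x \<in> ?P" using yz(1,3) subgroup.m_closed[OF P'(1)] by blast
  qed
  show ?thesis
  proof (rule normal_invI[OF P(1)])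
    fix x h assume x: "x \<in> carrier G" and h: "h \<in> P"
    obtain k where k: "k \<in> P" "h = inv x \<otimes> k \<otimes> x" using sub[of "inv x"] x h by auto
    then have "x \<otimes> h \<otimes> inv x = k" using x subgroup.mem_carrier[OF P(1) k(1)] by (simp add: m_assoc)
    then show "x \<otimes> h \<otimes> inv x \<in> P" using k by simp
  qed
qed

lemma exists_sylow:
  assumes p: "Factorial_Ring.prime p"
  shows "\<exists>P. subgroup P G \<and> card P = p ^ multiplicity p (order G)"
proof -
  obtain m where "order G = p ^ multiplicity p (order G) * m"
    using multiplicity_dvd[of p "order G"] by (metis dvdE)
  then show ?thesis using sylow_thm[OF p is_group _ finite_carrier] by blast
qed

lemma balanced_imp_decomposition:
  assumes bal: "balanced G"
  shows "\<exists>(r :: nat) Gs A.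
       length Gs = r \<and>
       internal_direct_product G (Gs @ [A]) \<and>
       (\<forall>i < r. \<forall>j < r. i \<noteq> j \<longrightarrow> gcd (card (Gs ! i)) (card (Gs ! j)) = 1) \<and>
       (\<forall>i < r. gcd (card (Gs ! i)) (card A) = 1) \<and>
       comm_group (G\<lparr>carrier := A\<rparr>) \<and>
       (\<forall>i < r.
          (\<exists>p. p_group p (G\<lparr>carrier := Gs ! i\<rparr>)) \<and>
          modular_lattice (inclusion_order (center_interval (G\<lparr>carrier := Gs ! i\<rparr>))) \<and>
          cyclic_group (G\<lparr>carrier := derived G (Gs ! i)\<rparr>))"
proof -
  define ps where "ps = sorted_list_of_set (prime_factors (order G))"
  define syl where "syl p = (SOME P. subgroup P G \<and> card P = p ^ multiplicity p (order G))" for p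
  define Gs where "Gs = map syl ps"
  define r where "r = length ps"
  \<comment> \<open>The abelian factor is chosen trivial: abelian Sylow subgroups already qualify as
    factors \<open>Gs ! i\<close>.\<close>
  define Hs where "Hs = Gs @ [{\<one>}]"
  let ?I = "{..<Suc r}"
  have prime: "Factorial_Ring.prime (ps ! i)" if "i < r" for i
    using nth_mem[of i ps] that by (auto simp: ps_def r_def)
  have ps_neq: "ps ! i \<noteq> ps ! j" if "i < r" "j < r" "i \<noteq> j" for i j
    using that nth_eq_iff_index_eq[of ps i j] by (simp add: ps_def r_def)
  have syl: "subgroup (Gs ! i) G" "card (Gs ! i) = (ps ! i) ^ multiplicity (ps ! i) (order G)" if "i < r" for i
    using someI_ex[OF exists_sylow[OF prime[OF that]]] that by (auto simp: Gs_def syl_def r_def)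
  have o0: "order G \<noteq> 0" using order_pos by simp
  have Gn: "Gs ! i \<lhd> G" if i: "i < r" for i
  proof -
    obtain m where m: "order G = (ps ! i) ^ multiplicity (ps ! i) (order G) * m" "\<not> ps ! i dvd m"
      using multiplicity_decompose'[OF o0] prime[OF i] by (metis not_prime_unit)
    show ?thesis by (rule balanced_sylow_normal[OF bal prime[OF i] m syl[OF i]])
  qed
  have len: "length Hs = Suc r" by (simp add: Hs_def Gs_def r_def)
  have Hs_nth: "Hs ! i = (if i < r then Gs ! i else {\<one>})" if "i < Suc r" for i
    using that by (auto simp: Hs_def Gs_def r_def nth_append)
  have Hn: "Hs ! i \<lhd> G" if "i \<in> ?I" for i using Gn one_is_normal Hs_nth that by auto
  have cop: "coprime (card (Hs ! i)) (card (Hs ! j))" if ij: "i \<in> ?I" "j \<in> ?I" "i \<noteq> j" for i j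
  proof (cases "i < r \<and> j < r")
    case True
    then have "coprime (ps ! i) (ps ! j)" using ij prime ps_neq primes_coprime by metis
    then show ?thesis using True syl Hs_nth by simp
  next
    case False
    then show ?thesis using ij Hs_nth by auto
  qed
  have rest: "generate G (\<Union>j\<in>?I - {i}. Hs ! j) \<lhd> G"
    "coprime (card (Hs ! i)) (card (generate G (\<Union>j\<in>?I - {i}. Hs ! j)))" if i: "i \<in> ?I" for i
  proof -
    note V = generate_normal_family[of "?I - {i}" "\<lambda>j. Hs ! j"]
    show "generate G (\<Union>j\<in>?I - {i}. Hs ! j) \<lhd> G" using Hn by (intro V(1)) auto
    have "coprime (card (Hs ! i)) (\<Prod>j\<in>?I - {i}. card (Hs ! j))"
      using cop i by (intro prod_coprime_right) auto
    then show "coprime (card (Hs ! i)) (card (generate G (\<Union>j\<in>?I - {i}. Hs ! j)))"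
      using coprime_divisors[OF dvd_refl V(2)] Hn by auto
  qed
  have whole: "generate G (\<Union>i\<in>?I. Hs ! i) = carrier G"
  proof -
    let ?N = "generate G (\<Union>i\<in>?I. Hs ! i)"
    have N: "subgroup ?N G" using generate_normal_family(1)[of ?I "\<lambda>i. Hs ! i"] Hn normal_imp_subgroup by blast
    \<comment> \<open>\<open>?N\<close> contains a Sylow subgroup for every prime divisor of the
      order.\<close>
    have "order G dvd card ?N"
    proof (rule multiplicity_le_imp_dvd[OF o0])
      fix q :: nat assume q: "Factorial_Ring.prime q"
      show "multiplicity q (order G) \<le> multiplicity q (card ?N)"
      proof (cases "q dvd order G")
        case True
        then have "q \<in> set ps" using q o0 by (simp add: ps_def prime_factors_dvd)
        then obtain i where i: "i < r" "ps ! i = q" by (auto simp: in_set_conv_nth r_def)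
        have "Gs ! i \<subseteq> ?N" using i Hs_nth[of i] by (auto intro!: generate.incl bexI[of _ i])
        then have "q ^ multiplicity q (order G) dvd card ?N"
          using card_subgroup_dvd[OF syl(1)[OF i(1)] N] syl(2)[OF i(1)] i by simp
        then show ?thesis using q card_subgroup_pos[OF N] by (intro multiplicity_geI) auto
      qed (simp add: not_dvd_imp_multiplicity_0)
    qed
    then have "card (carrier G) \<le> card ?N" using card_subgroup_pos[OF N] dvd_imp_le by (simp add: order_def)
    then show ?thesis using card_seteq[OF finite_carrier subgroup.subset[OF N]] by simp
  qed
  have idp: "internal_direct_product G (Gs @ [{\<one>}])"
    unfolding internal_direct_product_def Hs_def[symmetric] len
  proof (intro conjI allI impI whole)
    fix i assume "i < Suc r"
    then have i: "i \<in> ?I" by simp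
    show "Hs ! i \<lhd> G" by (rule Hn[OF i])
    show "Hs ! i \<inter> generate G (\<Union>j\<in>?I - {i}. Hs ! j) = {\<one>}"
      using Hn[OF i] rest[OF i] by (intro Int_trivial_of_coprime) (auto dest: normal_imp_subgroup)
  qed
  have factor: "(\<exists>p. p_group p (G\<lparr>carrier := Gs ! i\<rparr>)) \<and>
          modular_lattice (inclusion_order (center_interval (G\<lparr>carrier := Gs ! i\<rparr>))) \<and>
          cyclic_group (G\<lparr>carrier := derived G (Gs ! i)\<rparr>)" if i: "i < r" for i
  proof -
    let ?U = "Gs ! i" and ?p = "ps ! i" and ?V = "generate G (\<Union>j\<in>?I - {i}. Hs ! j)"
    have iI: "i \<in> ?I" and HU: "Hs ! i = ?U" using i Hs_nth by auto
    note U = syl(1)[OF i] and V = rest(1)[OF iI]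
    have sV: "subgroup ?V G" by (rule normal_imp_subgroup[OF V])
    have disj: "?U \<inter> ?V = {\<one>}" using Int_trivial_of_coprime[OF U sV] rest(2)[OF iI] HU by simp
    have "(\<Union>j\<in>?I - {i}. Hs ! j) \<subseteq> carrier G"
      by (rule UN_least) (rule subgroup.subset[OF normal_imp_subgroup[OF Hn]], simp)
    then have "?U <#> ?V = generate G (?U \<union> (\<Union>j\<in>?I - {i}. Hs ! j))"
      using generate_normal_insert[OF Gn[OF i] V] by simp
    also have "?U \<union> (\<Union>j\<in>?I - {i}. Hs ! j) = (\<Union>j\<in>?I. Hs ! j)" using iI HU by blast
    finally have UV: "?U <#> ?V = carrier G" using whole by simp
    have balU: "balanced (G\<lparr>carrier := ?U\<rparr>)"
      by (rule balanced_left_factor[OF bal U sV normal_commuting[OF Gn[OF i] V] _ UV]) (use disj in auto)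
    have gU: "group (G\<lparr>carrier := ?U\<rparr>)" by (rule subgroup_imp_group[OF U])
    have oU: "order (G\<lparr>carrier := ?U\<rparr>) = ?p ^ multiplicity ?p (order G)" using syl(2)[OF i] by (simp add: order_def)
    have ppU: "prime_power_group (G\<lparr>carrier := ?U\<rparr>) ?p (multiplicity ?p (order G))"
      by (intro prime_power_group.intro prime_power_group_axioms.intro gU oU prime[OF i])
    interpret U: prime_power_group "G\<lparr>carrier := ?U\<rparr>" ?p "multiplicity ?p (order G)" by (rule ppU)
    have "p_group ?p (G\<lparr>carrier := ?U\<rparr>)" using prime[OF i] gU oU by (auto simp: p_group_def)
    moreover have "modular_lattice (inclusion_order (center_interval (G\<lparr>carrier := ?U\<rparr>)))"
      by (rule U.balanced_modular_lattice[OF balU])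
    moreover have "cyclic_group (G\<lparr>carrier := derived G ?U\<rparr>)"
    proof -
      obtain x y where xy: "x \<in> ?U" "y \<in> ?U"
        and all: "\<And>u v. u \<in> ?U \<Longrightarrow> v \<in> ?U \<Longrightarrow> commutator (G\<lparr>carrier := ?U\<rparr>) u v
          \<in> generate (G\<lparr>carrier := ?U\<rparr>) {commutator (G\<lparr>carrier := ?U\<rparr>) x y}"
        using balanced_commutators_cyclic[OF ppU balU] by auto
      have "commutator G x y \<in> ?U" using U.commutator_closed[of x y] xy commutator_restrict[OF U xy] by simp
      then have "commutator G u v \<in> generate G {commutator G x y}" if "u \<in> ?U" "v \<in> ?U" for u v
        using all[OF that] commutator_restrict[OF U] that xy generate_consistent[OF _ U] by simp
      then show ?thesis by (rule cyclic_derivedI[OF U xy])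
    qed
    ultimately show ?thesis by blast
  qed
  have comm: "comm_group (G\<lparr>carrier := {\<one>}\<rparr>)"
    by (rule group.group_comm_groupI[OF subgroup_imp_group[OF triv_subgroup]]) simp
  have copGs: "gcd (card (Gs ! i)) (card (Gs ! j)) = 1" if "i < r" "j < r" "i \<noteq> j" for i j
    using cop[of i j] that Hs_nth by (simp add: coprime_iff_gcd_eq_1)
  have "length Gs = r" by (simp add: Gs_def r_def)
  then show ?thesis using idp copGs comm factor by (intro exI[of _ r] exI[of _ Gs] exI[of _ "{\<one>}"]) simp
qed

lemma balanced_of_comm:
  assumes A: "subgroup A G" and comm: "comm_group (G\<lparr>carrier := A\<rparr>)"
  shows "balanced (G\<lparr>carrier := A\<rparr>)"
proof -
  have "A \<subseteq> centralizer G A"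
    using comm_groupE(4)[OF comm] subgroup.subset[OF A] by (auto simp: centralizer_def subset_iff)
  then have "A \<inter> centralizer G A = A" by blast
  then show ?thesis unfolding balanced_restrict_iff[OF A] by (metis subset_antisym)
qed

lemma balanced_of_modular_p_subgroup:
  assumes U: "subgroup U G" and p: "p_group p (G\<lparr>carrier := U\<rparr>)"
    and modl: "modular_lattice (inclusion_order (center_interval (G\<lparr>carrier := U\<rparr>)))"
    and cyc: "cyclic_group (G\<lparr>carrier := derived G U\<rparr>)"
  shows "balanced (G\<lparr>carrier := U\<rparr>)"
proof -
  obtain n where n: "order (G\<lparr>carrier := U\<rparr>) = p ^ n" and pr: "Factorial_Ring.prime p"
    using p by (auto simp: p_group_def)
  interpret U: prime_power_group "G\<lparr>carrier := U\<rparr>" p n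
    by (intro prime_power_group.intro prime_power_group_axioms.intro subgroup_imp_group[OF U] n pr)
  obtain t where t: "t \<in> U" "\<And>u v. u \<in> U \<Longrightarrow> v \<in> U \<Longrightarrow> commutator G u v \<in> generate G {t}"
    using commutators_in_cyclic_of_cyclic_derived[OF U cyc] by blast
  show ?thesis
    by (rule U.balanced_of_modular_cyclic[OF modl, of t])
      (use t commutator_restrict[OF U] generate_consistent[OF _ U, of "{t}"] in auto)
qed

end

theorem theorem1:
  fixes G :: "('a, 'b) monoid_scheme"
  assumes "group G" and "finite (carrier G)"
  shows "CD_lattice G = center_interval G \<longleftrightarrow>
    (\<exists>(r :: nat) Gs A.
       length Gs = r \<and>
       internal_direct_product G (Gs @ [A]) \<and>
       (\<forall>i < r. \<forall>j < r. i \<noteq> j \<longrightarrow> gcd (card (Gs ! i)) (card (Gs ! j)) = 1) \<and>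
       (\<forall>i < r. gcd (card (Gs ! i)) (card A) = 1) \<and>
       comm_group (G\<lparr>carrier := A\<rparr>) \<and>
       (\<forall>i < r.
          (\<exists>p. p_group p (G\<lparr>carrier := Gs ! i\<rparr>)) \<and>
          modular_lattice (inclusion_order (center_interval (G\<lparr>carrier := Gs ! i\<rparr>))) \<and>
          cyclic_group (G\<lparr>carrier := derived G (Gs ! i)\<rparr>)))"
    (is "_ \<longleftrightarrow> ?decomposition")
proof -
  interpret group G by (rule assms(1))
  interpret finite_group G by unfold_locales (rule assms(2))
  have "balanced G" if dec: ?decomposition
  proof -
    obtain r Gs A where len: "length Gs = r"
      and idp: "internal_direct_product G (Gs @ [A])"
      and cop: "\<forall>i<r. \<forall>j<r. i \<noteq> j \<longrightarrow> gcd (card (Gs ! i)) (card (Gs ! j)) = 1"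
      and copA: "\<forall>i<r. gcd (card (Gs ! i)) (card A) = 1"
      and comm: "comm_group (G\<lparr>carrier := A\<rparr>)"
      and factor: "\<forall>i<r. (\<exists>p. p_group p (G\<lparr>carrier := Gs ! i\<rparr>)) \<and>
          modular_lattice (inclusion_order (center_interval (G\<lparr>carrier := Gs ! i\<rparr>))) \<and>
          cyclic_group (G\<lparr>carrier := derived G (Gs ! i)\<rparr>)"
      using dec by (elim exE conjE)
    let ?Hs = "Gs @ [A]"
    have nth: "?Hs ! i = (if i < r then Gs ! i else A)" if "i < Suc r" for i
      using that len by (auto simp: nth_append)
    have norm: "?Hs ! i \<lhd> G" if "i < Suc r" for i
      using idp that len by (simp add: internal_direct_product_def)
    \<comment> \<open>The abelian factor is treated as one more member of a coprime family of
      balanced normal subgroups.\<close>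
    have "balanced (G\<lparr>carrier := generate G (\<Union>i\<in>{..<Suc r}. ?Hs ! i)\<rparr>)"
    proof (rule balanced_coprime_family)
      fix i assume "i \<in> {..<Suc r}"
      then have i: "i < Suc r" by simp
      note U = normal_imp_subgroup[OF norm[OF i]]
      show "?Hs ! i \<lhd> G" by (rule norm[OF i])
      show "balanced (G\<lparr>carrier := ?Hs ! i\<rparr>)"
      proof (cases "i < r")
        case True
        have Gi: "?Hs ! i = Gs ! i" using nth[OF i] True by simp
        from factor True obtain p where p: "p_group p (G\<lparr>carrier := Gs ! i\<rparr>)" by blast
        have "subgroup (Gs ! i) G" using U Gi by simp
        then have "balanced (G\<lparr>carrier := Gs ! i\<rparr>)"
          by (rule balanced_of_modular_p_subgroup[OF _ p]) (use factor True in blast)+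
        then show ?thesis by (simp only: Gi)
      next
        case False
        then show ?thesis using balanced_of_comm[OF U] comm nth[OF i] by simp
      qed
    next
      fix i j assume "i \<in> {..<Suc r}" "j \<in> {..<Suc r}" and ij: "i \<noteq> j"
      then have i: "i < Suc r" and j: "j < Suc r" by auto
      consider "i < r" "j < r" | "i < r" "\<not> j < r" | "\<not> i < r" "j < r" using i j ij by linarith
      then have "gcd (card (?Hs ! i)) (card (?Hs ! j)) = 1"
      proof cases
        case 1
        then show ?thesis unfolding nth[OF i] nth[OF j] using cop ij by simp
      next
        case 2
        then show ?thesis unfolding nth[OF i] nth[OF j] using copA by simp
      next
        case 3
        then show ?thesis unfolding nth[OF i] nth[OF j] using copA by (simp add: gcd.commute[of "card A"])
      qed
      then show "coprime (card (?Hs ! i)) (card (?Hs ! j))" by (simp only: coprime_iff_gcd_eq_1)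
    qed simp
    moreover have "generate G (\<Union>i\<in>{..<Suc r}. ?Hs ! i) = carrier G"
      using idp len by (simp add: internal_direct_product_def)
    ultimately show ?thesis by simp
  qed
  then show ?thesis using CD_lattice_eq_center_interval_iff balanced_imp_decomposition by blast
qed

end
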